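(* Let $O_0=\{C_1,\dots,C_m\}$ be a quadtree (with neighbouring cells differing by at most one level) on the square domain $[0,a_x]\times[0,a_y]$, $a_x=a_y$, with root grid of cell length $h$, where $$C_k=[a_{k,x}-\ell_{C_k},a_{k,x}]\times[a_{k,y}-\ell_{C_k},a_{k,y}].$$ Let $O_n$ be the $n$-times uniform refinement of $O_0$, and let $\tau_{k,\boldsymbol i}$ be the localized estimator of condition number at the subcell $C_{k,\boldsymbol i}\in O_n$, for the finite volume matrix $A$ on $O_n$ of the variable coefficient Poisson equation with coefficient $\sigma$ and the quadtree order. For $\boldsymbol i=(i,j)\in\{1,\dots,2^n\}^2$ put $$g_{k,n,\boldsymbol i}=\exp\!\left(\Big(a_{k,x}+a_{k,y}-\frac{(2^{n+1}-i-j)h}{2^{\mathcal L(C_k)+n}}\Big)\sup\frac{\|\nabla\sigma\|_1}{\sigma}\right)\frac{a_{k,x}+a_{k,y}}{h}\,2^{\,n+\mathcal L(C_k)+1}.$$ Then for any $n\in\mathbb N$, any $\boldsymbol i\in I_0$ and any $C_{k,\boldsymbol i}\in O_n$, $$\tau_{k,\boldsymbol i}\le g_{k,n,\boldsymbol i}+o(2^n),$$ and there exists a constant $c\in\mathbb R$ independent of $n$ such that for any $n\in\mathbb N$ and any $\boldsymbol i\in\{1,\dots,2^n\}^2$ (and any $k$), $$\tau_{k,\boldsymbol i}\le c\,g_{k,n,\boldsymbol i}+o(2^n).$$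
   Context: Here $o(2^n)$ denotes a term bounded, uniformly in $k$ and $\boldsymbol i$, by some $r(n)$ with $r(n)/2^n\to0$ as $n\to\infty$. Quadtree: the root grid $R_0$ is a uniform grid of square cells of length $h$; a quadtree is obtained by finitely many steps $R_{i+1}=(R_i\setminus\{C\})\cup\mathcal R(C)$, $C\in R_i$, where $\mathcal R(C)$ is the set of four equal subsquares of $C$. $\ell_C$ is the edge length of $C$, and the level $\mathcal L(C)=l$ means $\ell_C=2^{-l}h$. $n_0(C)$ is the set of cells other than $C$ sharing (part of) an edge with $C$. Standing condition: $|\mathcal L(C_1)-\mathcal L(C_2)|\le1$ if $C_1\in n_0(C_2)$. Quadtree order $\prec_O$: on $R_0$ it is the lexicographic order (starting from the lower left). On $R_{i+1}=(R_i\setminus\{C\})\cup\mathcal R(C)$: two cells of $R_i\setminus\{C\}$ are ordered as in $R_i$; a cell of $R_i\setminus\{C\}$ and a cell of $\mathcal R(C)$ are ordered as that cell and $C$ are in $R_i$; two cells of $\mathcal R(C)$ are ordered lexicographically. Uniform refinement: $O_{n+1}=\bigcup_{C\in O_n}\mathcal R(C)$. Each $C_k\in O_0$ is divided into $2^n\times2^n$ subcells in $O_n$; $C_{k,\boldsymbol i}$, $\boldsymbol i=(i,j)\in\{1,\dots,2^n\}^2$, is the one in column $i$ (from the left) and row $j$ (from the bottom). $I_0$ is the set of $\boldsymbol i=(i_1,i_2)$ with $1<i_1,i_2<2^n$ and $i_1=2^n-1$ or $i_2=2^n-1$. Matrix: $\sigma>0$ is a $C^1$ coefficient function on the domain $\Omega$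 in $-\nabla\cdot(\sigma\nabla u)=f$ with Dirichlet boundary condition; $\sigma_C$ is the value of $\sigma$ at the center of $C$; $\bar B(C)$ is the number of edges of $C$ contained in $\partial\Omega$; $\alpha=\frac23$. The symmetric matrix $A$, indexed by the cells, is $$A_{C_1,C_2}=\begin{cases}-2(\sigma_{C_1}^{-1}+\sigma_{C_2}^{-1})^{-1}&C_2\in n_0(C_1),\ \mathcal L(C_1)=\mathcal L(C_2),\\-3\alpha(\sigma_{C_1}^{-1}+2\sigma_{C_2}^{-1})^{-1}&C_2\in n_0(C_1),\ \mathcal L(C_1)=\mathcal L(C_2)+1,\\-\sum_{C'\in n_0(C)}A_{C,C'}+2\bar B(C)\sigma_C&C_1=C_2=C,\\0&\text{non-neighbouring }C_1\ne C_2,\end{cases}$$ with $A_{C_1,C_2}=A_{C_2,C_1}$. It is assumed that there is a constant $P_\sigma$ such that $|\sigma_{C_2}/\sigma_{C_1}-1|\le P_\sigma/2^{n+1}$ for all neighbouring cells $C_1,C_2$ of $O_n$; the supremum $\sup\|\nabla\sigma\|_1/\sigma$ is over $\Omega$ with $\|\cdot\|_1$ the $\ell^1$ norm. MILU and LECN: with $p(K)=\{K'\in n_0(K):K'\prec_OK\}$ and $s(K)=\{K'\in n_0(K):K\prec_OK'\}$, recursively along $\prec_O$ $$e_K=A_{K,K}-\sum_{K_1\in p(K)}\sum_{K_2\in s(K_1)}\frac{A_{K,K_1}A_{K_1,K_2}}{e_{K_1}},\qquad \tau_K=\frac{e_K}{e_K+\sum_{K_1\in s(K)}A_{K,K_1}},$$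 and $\tau_{k,\boldsymbol i}=\tau_{C_{k,\boldsymbol i}}$. *)

theory Defs
  imports "HOL-Analysis.Analysis" "HOL-Library.Landau_Symbols"
begin

section \<open>Cells\<close>

text \<open>
  \<open>Cell l i j\<close> encodes the closed square with edge length \<open>2\<^sup>-\<^sup>l h\<close> and lower left corner
  \<open>(i 2\<^sup>-\<^sup>l h, j 2\<^sup>-\<^sup>l h)\<close>, where \<open>h\<close> is the cell length of the root grid. Every cell that a quadtree
  over a root grid with origin \<open>(0,0)\<close> can contain has exactly one such code.
\<close>

datatype cell = Cell (level: nat) (xpos: nat) (ypos: nat)

definition edge_len :: "real \<Rightarrow> cell \<Rightarrow> real" where
  "edge_len h C = h / 2 ^ level C"

definition left_x :: "real \<Rightarrow> cell \<Rightarrow> real" where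
  "left_x h C = real (xpos C) * edge_len h C"

definition right_x :: "real \<Rightarrow> cell \<Rightarrow> real" where
  "right_x h C = (real (xpos C) + 1) * edge_len h C"

definition bottom_y :: "real \<Rightarrow> cell \<Rightarrow> real" where
  "bottom_y h C = real (ypos C) * edge_len h C"

definition top_y :: "real \<Rightarrow> cell \<Rightarrow> real" where
  "top_y h C = (real (ypos C) + 1) * edge_len h C"

definition center :: "real \<Rightarrow> cell \<Rightarrow> real \<times> real" where
  "center h C = ((left_x h C + right_x h C) / 2, (bottom_y h C + top_y h C) / 2)"

definition edges :: "real \<Rightarrow> cell \<Rightarrow> (real \<times> real) set set" where
  "edges h C =
    {{left_x h C} \<times> {bottom_y h C..top_y h C},
     {right_x h C} \<times> {bottom_y h C..top_y h C},
     {left_x h C..right_x h C} \<times> {bottom_y h C},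
     {left_x h C..right_x h C} \<times> {top_y h C}}"

definition children :: "cell \<Rightarrow> cell set" where
  "children C = {Cell (level C + 1) (2 * xpos C + p) (2 * ypos C + q) | p q. p \<in> {0,1} \<and> q \<in> {0,1}}"

text \<open>
  Two axis-parallel edges have more than a point in common iff their intersection is infinite;
  cells that meet only in a corner are not neighbours.
\<close>

definition nbrs :: "real \<Rightarrow> cell set \<Rightarrow> cell \<Rightarrow> cell set" where
  "nbrs h R C = {C' \<in> R. C' \<noteq> C \<and> (\<exists>s\<in>edges h C. \<exists>s'\<in>edges h C'. infinite (s \<inter> s'))}"

section \<open>Quadtrees and their order\<close>

definition root_grid :: "nat \<Rightarrow> cell set" where
  "root_grid N = {Cell 0 i j | i j. i < N \<and> j < N}"

text \<open>
  Lexicographic order of cells of one size: row by row from the bottom, each row from the left.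
\<close>

definition cell_lex :: "cell \<Rightarrow> cell \<Rightarrow> bool" where
  "cell_lex C D \<longleftrightarrow> ypos C < ypos D \<or> (ypos C = ypos D \<and> xpos C < xpos D)"

definition refine_order :: "cell set \<Rightarrow> cell rel \<Rightarrow> cell \<Rightarrow> cell rel" where
  "refine_order R r C =
     {(D, E). D \<in> R - {C} \<and> E \<in> R - {C} \<and> (D, E) \<in> r} \<union>
     {(D, E). D \<in> R - {C} \<and> E \<in> children C \<and> (D, C) \<in> r} \<union>
     {(D, E). D \<in> children C \<and> E \<in> R - {C} \<and> (C, E) \<in> r} \<union>
     {(D, E). D \<in> children C \<and> E \<in> children C \<and> cell_lex D E}"

text \<open>
  \<open>quadtree N R r\<close>: some sequence of refinement steps leads from the \<open>N \<times> N\<close> root grid to the set of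
  cells \<open>R\<close>, and carries the strict order of the root grid over to \<open>r\<close>.
\<close>

inductive quadtree :: "nat \<Rightarrow> cell set \<Rightarrow> cell rel \<Rightarrow> bool" for N where
  root: "quadtree N (root_grid N) {(D, E). D \<in> root_grid N \<and> E \<in> root_grid N \<and> cell_lex D E}"
| step: "quadtree N R r \<Longrightarrow> C \<in> R \<Longrightarrow> quadtree N ((R - {C}) \<union> children C) (refine_order R r C)"

definition is_quadtree :: "nat \<Rightarrow> cell set \<Rightarrow> bool" where
  "is_quadtree N R \<longleftrightarrow> (\<exists>r. quadtree N R r)"

text \<open>The order does not depend on the sequence of steps, see \<open>quadtree_order\<close> below.\<close>

definition quad_order :: "nat \<Rightarrow> cell set \<Rightarrow> cell rel" where
  "quad_order N R = (THE r. quadtree N R r)"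

definition balanced :: "real \<Rightarrow> cell set \<Rightarrow> bool" where
  "balanced h R \<longleftrightarrow>
     (\<forall>C\<in>R. \<forall>C'\<in>nbrs h R C. \<bar>int (level C) - int (level C')\<bar> \<le> 1)"

fun uniform_refine :: "nat \<Rightarrow> cell set \<Rightarrow> cell set" where
  "uniform_refine 0 R = R"
| "uniform_refine (Suc n) R = (\<Union>C\<in>uniform_refine n R. children C)"

text \<open>The subcell of \<open>C\<close> in column \<open>i\<close> from the left and row \<open>j\<close> from the bottom, both counted from 1.\<close>

definition subcell :: "nat \<Rightarrow> cell \<Rightarrow> nat \<times> nat \<Rightarrow> cell" where
  "subcell n C ij = Cell (level C + n) (2 ^ n * xpos C + (fst ij - 1)) (2 ^ n * ypos C + (snd ij - 1))"

definition index_set :: "nat \<Rightarrow> (nat \<times> nat) set" where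
  "index_set n = {1..2 ^ n} \<times> {1..2 ^ n}"

definition I0 :: "nat \<Rightarrow> (nat \<times> nat) set" where
  "I0 n = {(i, j). 1 < i \<and> i < 2 ^ n \<and> 1 < j \<and> j < 2 ^ n \<and> (i = 2 ^ n - 1 \<or> j = 2 ^ n - 1)}"

section \<open>The finite volume matrix\<close>

definition square_domain :: "real \<Rightarrow> (real \<times> real) set" where
  "square_domain a = {0..a} \<times> {0..a}"

definition coeff_at :: "real \<Rightarrow> (real \<times> real \<Rightarrow> real) \<Rightarrow> cell \<Rightarrow> real" where
  "coeff_at h \<sigma> C = \<sigma> (center h C)"

definition boundary_edges :: "real \<Rightarrow> real \<Rightarrow> cell \<Rightarrow> nat" where
  "boundary_edges a h C = card {s \<in> edges h C. s \<subseteq> frontier (square_domain a)}"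

definition \<alpha>_fv :: real where
  "\<alpha>_fv = 2 / 3"

text \<open>
  The last branch is the transpose of the one before it (\<open>C2\<close> is one level finer than \<open>C1\<close>); level
  differences above 1 do not occur in balanced quadtrees.
\<close>

definition off_diag :: "real \<Rightarrow> (real \<times> real \<Rightarrow> real) \<Rightarrow> cell set \<Rightarrow> cell \<Rightarrow> cell \<Rightarrow> real" where
  "off_diag h \<sigma> R C1 C2 =
    (let s1 = coeff_at h \<sigma> C1; s2 = coeff_at h \<sigma> C2 in
     if C2 \<notin> nbrs h R C1 then 0
     else if level C1 = level C2 then - 2 * inverse (inverse s1 + inverse s2)
     else if level C1 = level C2 + 1 then - 3 * \<alpha>_fv * inverse (inverse s1 + 2 * inverse s2)
     else - 3 * \<alpha>_fv * inverse (inverse s2 + 2 * inverse s1))"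

definition fv_matrix ::
  "real \<Rightarrow> real \<Rightarrow> (real \<times> real \<Rightarrow> real) \<Rightarrow> cell set \<Rightarrow> cell \<Rightarrow> cell \<Rightarrow> real" where
  "fv_matrix a h \<sigma> R C1 C2 =
    (if C1 = C2
     then - (\<Sum>C'\<in>nbrs h R C1. off_diag h \<sigma> R C1 C') + 2 * real (boundary_edges a h C1) * coeff_at h \<sigma> C1
     else off_diag h \<sigma> R C1 C2)"

section \<open>MILU and the localized estimator of condition number\<close>

definition prec_nbrs :: "real \<Rightarrow> cell set \<Rightarrow> cell rel \<Rightarrow> cell \<Rightarrow> cell set" where
  "prec_nbrs h R r K = {K' \<in> nbrs h R K. (K', K) \<in> r}"

definition succ_nbrs :: "real \<Rightarrow> cell set \<Rightarrow> cell rel \<Rightarrow> cell \<Rightarrow> cell set" where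
  "succ_nbrs h R r K = {K' \<in> nbrs h R K. (K, K') \<in> r}"

text \<open>Recursion along the order \<open>r\<close>; the recursion equation is \<open>milu_rec\<close> below.\<close>

definition milu :: "real \<Rightarrow> cell set \<Rightarrow> cell rel \<Rightarrow> (cell \<Rightarrow> cell \<Rightarrow> real) \<Rightarrow> cell \<Rightarrow> real" where
  "milu h R r A = wfrec r (\<lambda>e K.
     A K K - (\<Sum>K1\<in>prec_nbrs h R r K. \<Sum>K2\<in>succ_nbrs h R r K1. A K K1 * A K1 K2 / e K1))"

definition lecn :: "real \<Rightarrow> cell set \<Rightarrow> cell rel \<Rightarrow> (cell \<Rightarrow> cell \<Rightarrow> real) \<Rightarrow> cell \<Rightarrow> real" where
  "lecn h R r A K =
     milu h R r A K / (milu h R r A K + (\<Sum>K1\<in>succ_nbrs h R r K. A K K1))"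

definition tau :: "nat \<Rightarrow> real \<Rightarrow> real \<Rightarrow> (real \<times> real \<Rightarrow> real) \<Rightarrow> cell set \<Rightarrow> nat \<Rightarrow> cell \<Rightarrow> nat \<times> nat \<Rightarrow> real" where
  "tau N a h \<sigma> R0 n C ij =
     (let R = uniform_refine n R0
      in lecn h R (quad_order N R) (fv_matrix a h \<sigma> R) (subcell n C ij))"

text \<open>
  \<open>\<sigma>'\<close> is the gradient of \<open>\<sigma>\<close>. On the closed square the derivatives at the boundary are one-sided, and
  are unique; compactness makes the supremum below finite for a positive \<open>\<sigma>\<close>.
\<close>

definition C1_on :: "(real \<times> real) set \<Rightarrow> (real \<times> real \<Rightarrow> real) \<Rightarrow> (real \<times> real \<Rightarrow> real \<times> real) \<Rightarrow> bool" where
  "C1_on S \<sigma> \<sigma>' \<longleftrightarrow>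
     (\<forall>x\<in>S. (\<sigma> has_derivative (\<lambda>v. \<sigma>' x \<bullet> v)) (at x within S)) \<and> continuous_on S \<sigma>'"

definition sup_grad :: "(real \<times> real) set \<Rightarrow> (real \<times> real \<Rightarrow> real) \<Rightarrow> (real \<times> real \<Rightarrow> real \<times> real) \<Rightarrow> real" where
  "sup_grad S \<sigma> \<sigma>' = (SUP x\<in>S. (\<bar>fst (\<sigma>' x)\<bar> + \<bar>snd (\<sigma>' x)\<bar>) / \<sigma> x)"

definition g_bound :: "real \<Rightarrow> real \<Rightarrow> cell \<Rightarrow> nat \<Rightarrow> nat \<times> nat \<Rightarrow> real" where
  "g_bound h S C n ij =
     exp ((right_x h C + top_y h C
           - (2 ^ (n + 1) - real (fst ij) - real (snd ij)) * h / 2 ^ (level C + n)) * S)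
     * ((right_x h C + top_y h C) / h) * 2 ^ (n + level C + 1)"

section \<open>Well-definedness of the order and of the recursion\<close>

definition anc :: "nat \<Rightarrow> cell \<Rightarrow> cell" where
  "anc l C = Cell l (xpos C div 2 ^ (level C - l)) (ypos C div 2 ^ (level C - l))"

definition zless :: "cell \<Rightarrow> cell \<Rightarrow> bool" where
  "zless D E \<longleftrightarrow> (\<exists>l. l \<le> level D \<and> l \<le> level E \<and> cell_lex (anc l D) (anc l E) \<and> (\<forall>l'<l. anc l' D = anc l' E))"

lemma anc_level [simp]: "anc (level C) C = C"
  by (simp add: anc_def)

lemma level_anc [simp]: "level (anc l C) = l"
  by (simp add: anc_def)

lemma level_children: "D \<in> children C \<Longrightarrow> level D = Suc (level C)"
  by (auto simp: children_def)

lemma cell_lex_irrefl [simp]: "\<not> cell_lex C C"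
  by (simp add: cell_lex_def)

lemma cell_lex_trans: "cell_lex C D \<Longrightarrow> cell_lex D E \<Longrightarrow> cell_lex C E"
  by (auto simp: cell_lex_def)

lemma anc_children:
  assumes "D \<in> children C" "l \<le> level C"
  shows "anc l D = anc l C"
proof -
  obtain p q where D: "D = Cell (Suc (level C)) (2 * xpos C + p) (2 * ypos C + q)" "p < 2" "q < 2"
    using assms(1) by (auto simp: children_def)
  have "(2 * x + p) div 2 ^ Suc k = x div 2 ^ k" if "p < 2" for x p k :: nat
    using that by (simp add: div_mult2_eq)
  then show ?thesis
    using D assms(2) by (simp add: anc_def Suc_diff_le)
qed

lemma zless_irrefl: "\<not> zless C C"
  by (auto simp: zless_def)

lemma zless_trans:
  assumes "zless C D" "zless D E"
  shows "zless C E"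
proof -
  obtain l where l: "l \<le> level C" "l \<le> level D" "cell_lex (anc l C) (anc l D)" "\<forall>l'<l. anc l' C = anc l' D"
    using assms(1) by (auto simp: zless_def)
  obtain m where m: "m \<le> level D" "m \<le> level E" "cell_lex (anc m D) (anc m E)" "\<forall>l'<m. anc l' D = anc l' E"
    using assms(2) by (auto simp: zless_def)
  consider "l < m" | "l = m" | "m < l" by linarith
  then show ?thesis
  proof cases
    case 1 then show ?thesis unfolding zless_def using l m by (intro exI[of _ l]) auto
  next
    case 2 then show ?thesis unfolding zless_def using l m cell_lex_trans by (intro exI[of _ l]) auto
  next
    case 3 then show ?thesis unfolding zless_def using l m by (intro exI[of _ m]) auto
  qed
qed

lemma zless_child:
  assumes D: "D \<in> children C"
    and "level C \<le> level E \<Longrightarrow> anc (level C) E \<noteq> C"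
  shows "zless E D \<longleftrightarrow> zless E C" "zless D E \<longleftrightarrow> zless C E"
proof -
  have lvD [simp]: "level D = Suc (level C)" using level_children[OF D] .
  have k: "l \<le> level C" if "l \<le> level E" "l \<le> Suc (level C)" "\<forall>l'<l. anc l' E = anc l' D" for l
  proof (rule ccontr)
    assume "\<not> l \<le> level C"
    with that have "l = Suc (level C)" by simp
    then show False using that assms anc_children[OF D, of "level C"] by force
  qed
  have eq: "anc l D = anc l C" if "l \<le> level C" for l
    using anc_children[OF D that] .
  show "zless E D \<longleftrightarrow> zless E C"
    unfolding zless_def by (rule ex_cong1) (use k eq in \<open>auto intro: le_SucI\<close>)
  show "zless D E \<longleftrightarrow> zless C E"
    unfolding zless_def
  proof (rule ex_cong1)
    fix l
    show "(l \<le> level D \<and> l \<le> level E \<and> cell_lex (anc l D) (anc l E) \<and> (\<forall>l'<l. anc l' D = anc l' E)) \<longleftrightarrow>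
          (l \<le> level C \<and> l \<le> level E \<and> cell_lex (anc l C) (anc l E) \<and> (\<forall>l'<l. anc l' C = anc l' E))"
    proof (cases "l \<le> level C")
      case True
      then show ?thesis using eq by auto
    next
      case False
      then show ?thesis using k[of l] by (metis lvD)
    qed
  qed
qed

lemma zless_children:
  assumes D: "D \<in> children C" and E: "E \<in> children C"
  shows "zless D E \<longleftrightarrow> cell_lex D E"
proof
  have eq: "anc l D = anc l E" if "l \<le> level C" for l
    using anc_children[OF D that] anc_children[OF E that] by simp
  have lv: "level D = Suc (level C)" "level E = Suc (level C)"
    using D E level_children by auto
  { assume "zless D E"
    then obtain l where l: "l \<le> level D" "cell_lex (anc l D) (anc l E)"
      by (auto simp: zless_def)
    then have "\<not> l \<le> level C" using eq by force
    then have "l = level D" "l = level E" using l(1) lv by auto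
    then show "cell_lex D E" using l(2) anc_level by metis }
  { assume "cell_lex D E"
    then show "zless D E"
      unfolding zless_def using lv eq
      by (intro exI[of _ "level D"]) (metis anc_level less_Suc_eq_le order_refl) }
qed

lemma quadtree_antichain:
  assumes "quadtree N R r"
  shows "\<forall>C\<in>R. \<forall>D\<in>R. level C \<le> level D \<longrightarrow> anc (level C) D = C \<longrightarrow> D = C"
  using assms
proof induction
  case root
  show ?case by (auto simp: root_grid_def anc_def)
next
  case (step R r C)
  show ?case
  proof (intro ballI impI)
    fix D E
    assume D: "D \<in> R - {C} \<union> children C" and E: "E \<in> R - {C} \<union> children C"
      and le: "level D \<le> level E" and an: "anc (level D) E = D"
    show "E = D"
    proof (cases "E \<in> children C")
      case EC: True
      show ?thesis
      proof (cases "D \<in> children C")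
        case True
        then show ?thesis using an level_children[OF EC] level_children[OF True] anc_level[of E] by simp
      next
        case False
        then have DR: "D \<in> R" "D \<noteq> C" using D by auto
        show ?thesis
        proof (cases "level D \<le> level C")
          case True
          then have "anc (level D) C = D" using an anc_children[OF EC] by simp
          then show ?thesis using step DR True by blast
        next
          case False
          then have "level D = level E" using le level_children[OF EC] by simp
          then show ?thesis using an by simp
        qed
      qed
    next
      case False
      then have ER: "E \<in> R" "E \<noteq> C" using E by auto
      show ?thesis
      proof (cases "D \<in> children C")
        case True
        have "level C \<le> level E" using le level_children[OF True] by simp
        moreover have "anc (level C) E = C"
        proof -
          have gen: "anc k (anc m E) = anc k E" if "k \<le> m" "m \<le> level E" for k m
            using that by (simp add: anc_def div_mult2_eq[symmetric] power_add[symmetric])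
          have "anc (level C) E = anc (level C) (anc (level D) E)"
            using le level_children[OF True] by (simp add: gen)
          also have "\<dots> = anc (level C) D" by (simp add: an)
          also have "\<dots> = C" using anc_children[OF True, of "level C"] by simp
          finally show ?thesis .
        qed
        ultimately show ?thesis using step ER by blast
      next
        case False
        then show ?thesis using step D ER le an by blast
      qed
    qed
  qed
qed

lemma quadtree_zless:
  assumes "quadtree N R r"
  shows "r = {(D, E). D \<in> R \<and> E \<in> R \<and> zless D E}"
  using assms
proof induction
  case root
  have "zless D E \<longleftrightarrow> cell_lex D E" if "level D = 0" "level E = 0" for D E
    using that anc_level[of D] anc_level[of E] unfolding zless_def by auto
  then show ?case by (auto simp: root_grid_def)
next
  case (step R r C)
  have ac: "anc (level C) E \<noteq> C" if "E \<in> R - {C}" "level C \<le> level E" for E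
    using quadtree_antichain[OF step(1)] that step(2) by blast
  have "(D, E) \<in> refine_order R r C \<longleftrightarrow>
        D \<in> R - {C} \<union> children C \<and> E \<in> R - {C} \<union> children C \<and> zless D E" for D E
  proof -
    have dis: "E \<notin> R - {C}" if "E \<in> children C" for E
      using ac[of E] anc_children[OF that, of "level C"] level_children[OF that] by auto
    have 1: "(F, G) \<in> r \<longleftrightarrow> F \<in> R \<and> G \<in> R \<and> zless F G" for F G
      using step.IH by blast
    have zc: "zless F G \<longleftrightarrow> zless F C" "zless G F \<longleftrightarrow> zless C F"
      if "F \<in> R - {C}" "G \<in> children C" for F G
      using zless_child[OF that(2) ac[OF that(1)]] by blast+
    consider "D \<in> children C" "E \<in> children C" | "D \<in> children C" "E \<notin> children C"
      | "D \<notin> children C" "E \<in> children C" | "D \<notin> children C" "E \<notin> children C" by blast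
    then show ?thesis
    proof cases
      case a: 1
      then have "(D, E) \<in> refine_order R r C \<longleftrightarrow> cell_lex D E"
        unfolding refine_order_def using dis by blast
      then show ?thesis using a zless_children by blast
    next
      case a: 2
      then have "(D, E) \<in> refine_order R r C \<longleftrightarrow> E \<in> R - {C} \<and> (C, E) \<in> r"
        unfolding refine_order_def using dis by blast
      then show ?thesis using a zc(2)[of E D] 1[of C E] step(2) by blast
    next
      case a: 3
      then have "(D, E) \<in> refine_order R r C \<longleftrightarrow> D \<in> R - {C} \<and> (D, C) \<in> r"
        unfolding refine_order_def using dis by blast
      then show ?thesis using a zc(1)[of D E] 1[of D C] step(2) by blast
    next
      case a: 4
      then have "(D, E) \<in> refine_order R r C \<longleftrightarrow> D \<in> R - {C} \<and> E \<in> R - {C} \<and> (D, E) \<in> r"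
        unfolding refine_order_def by blast
      then show ?thesis using a 1[of D E] by blast
    qed
  qed
  then show ?case by auto
qed

lemma quadtree_order:
  assumes "quadtree N R r"
  shows "quad_order N R = r"
  unfolding quad_order_def using assms quadtree_zless by (intro the_equality) blast+

lemma finite_children: "finite (children C)"
proof -
  have "children C = (\<lambda>(p, q). Cell (level C + 1) (2 * xpos C + p) (2 * ypos C + q)) ` ({0,1} \<times> {0,1})"
    by (auto simp: children_def)
  then show ?thesis by simp
qed

lemma quadtree_finite: "quadtree N R r \<Longrightarrow> finite R"
proof (induction rule: quadtree.induct)
  case root
  have "root_grid N = (\<lambda>(i, j). Cell 0 i j) ` ({..<N} \<times> {..<N})"
    by (auto simp: root_grid_def)
  then show ?case by simp
qed (simp add: finite_children)

lemma quadtree_wf: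
  assumes "quadtree N R r"
  shows "wf r"
proof (rule finite_acyclic_wf)
  have r: "r = {(D, E). D \<in> R \<and> E \<in> R \<and> zless D E}" using quadtree_zless[OF assms] .
  then have "r \<subseteq> R \<times> R" by auto
  then show "finite r" using quadtree_finite[OF assms] by (meson finite_SigmaI finite_subset)
  have "trans r" unfolding r by (auto intro!: transI intro: zless_trans)
  moreover have "irrefl r" unfolding r by (auto simp: irrefl_def zless_irrefl)
  ultimately show "acyclic r" by (simp add: acyclic_irrefl)
qed

lemma is_quadtree_refine:
  assumes "is_quadtree N R"
  shows "is_quadtree N (uniform_refine n R)"
proof (induction n)
  case 0
  then show ?case using assms by simp
next
  case (Suc n)
  let ?R = "uniform_refine n R"
  obtain r0 where r0: "quadtree N ?R r0" using Suc by (auto simp: is_quadtree_def)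
  have disj: "children C \<inter> ?R = {}" if "C \<in> ?R" for C
  proof (intro equals0I)
    fix D assume "D \<in> children C \<inter> ?R"
    then have "D \<in> ?R" "level D = Suc (level C)" "anc (level C) D = C"
      using anc_children[of D C "level C"] level_children by auto
    then show False using quadtree_antichain[OF r0] that by (metis le_SucI n_not_Suc_n order_refl)
  qed
  have "finite S \<Longrightarrow> S \<subseteq> ?R \<Longrightarrow> is_quadtree N ((?R - S) \<union> (\<Union>C\<in>S. children C))" for S
  proof (induction S rule: finite_induct)
    case empty
    then show ?case using Suc by simp
  next
    case (insert C S)
    let ?Q = "(?R - S) \<union> (\<Union>C\<in>S. children C)"
    obtain r where r: "quadtree N ?Q r" using insert by (auto simp: is_quadtree_def)
    have "C \<in> ?Q" using insert by auto
    from quadtree.step[OF r this] have "is_quadtree N (?Q - {C} \<union> children C)"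
      by (auto simp: is_quadtree_def)
    moreover have "?Q - {C} \<union> children C = (?R - insert C S) \<union> (\<Union>C\<in>insert C S. children C)"
      using insert disj by blast
    ultimately show ?case by simp
  qed
  from this[OF quadtree_finite[OF r0] order_refl] show ?case by simp
qed

lemma quad_order_refine:
  assumes "is_quadtree N R"
  shows "quadtree N (uniform_refine n R) (quad_order N (uniform_refine n R))"
  using is_quadtree_refine[OF assms, of n] quadtree_order by (auto simp: is_quadtree_def)

lemma uniform_refine_subcell:
  "uniform_refine n R = (\<Union>C\<in>R. subcell n C ` index_set n)"
proof (induction n)
  case 0
  then show ?case by (auto simp: subcell_def index_set_def)
next
  case (Suc n)
  have "(\<Union>D\<in>subcell n C ` index_set n. children D) = subcell (Suc n) C ` index_set (Suc n)" for C
  proof (intro equalityI subsetI)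
    fix E assume "E \<in> (\<Union>D\<in>subcell n C ` index_set n. children D)"
    then obtain i j p q where ij: "i \<in> {1..2^n}" "j \<in> {1..2^n}" "p < 2" "q < 2"
      and E: "E = Cell (level C + n + 1) (2 * (2 ^ n * xpos C + (i - 1)) + p) (2 * (2 ^ n * ypos C + (j - 1)) + q)"
    proof -
      from \<open>E \<in> (\<Union>D\<in>subcell n C ` index_set n. children D)\<close> obtain i j
        where "i \<in> {1..2^n}" "j \<in> {1..2^n}" "E \<in> children (subcell n C (i, j))"
        by (auto simp: index_set_def)
      moreover from this(3) obtain p q where "p \<in> {0,1}" "q \<in> {0,1}"
        "E = Cell (level C + n + 1) (2 * (2 ^ n * xpos C + (i - 1)) + p) (2 * (2 ^ n * ypos C + (j - 1)) + q)"
        by (auto simp: subcell_def children_def simp del: One_nat_def)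
      moreover from this have "p < 2" "q < 2" by auto
      ultimately show thesis using that by blast
    qed
    have "E = subcell (Suc n) C (2 * (i - 1) + p + 1, 2 * (j - 1) + q + 1)"
      by (simp add: E subcell_def algebra_simps)
    moreover have "(2 * (i - 1) + p + 1, 2 * (j - 1) + q + 1) \<in> index_set (Suc n)"
      using ij by (auto simp: index_set_def)
    ultimately show "E \<in> subcell (Suc n) C ` index_set (Suc n)" by blast
  next
    fix E assume "E \<in> subcell (Suc n) C ` index_set (Suc n)"
    then obtain i j where ij: "i \<in> {1..2^Suc n}" "j \<in> {1..2^Suc n}" and E: "E = subcell (Suc n) C (i, j)"
      by (auto simp: index_set_def)
    let ?i = "(i - 1) div 2 + 1" and ?j = "(j - 1) div 2 + 1"
    have m: "(?i, ?j) \<in> index_set n" using ij by (auto simp: index_set_def)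
    have "E \<in> children (subcell n C (?i, ?j))"
    proof -
      have "E = Cell (level C + n + 1) (2 * (2 ^ n * xpos C + (i - 1) div 2) + (i - 1) mod 2)
                  (2 * (2 ^ n * ypos C + (j - 1) div 2) + (j - 1) mod 2)"
        by (simp add: E subcell_def algebra_simps)
      moreover have "(i - 1) mod 2 \<in> {0,1}" "(j - 1) mod 2 \<in> {0,1}" by auto
      ultimately show ?thesis unfolding children_def subcell_def by fastforce
    qed
    then show "E \<in> (\<Union>D\<in>subcell n C ` index_set n. children D)" using m by blast
  qed
  then show ?case using Suc by auto
qed

lemma milu_rec:
  assumes "quadtree N R r"
  shows "milu h R r A K =
    A K K - (\<Sum>K1\<in>prec_nbrs h R r K. \<Sum>K2\<in>succ_nbrs h R r K1. A K K1 * A K1 K2 / milu h R r A K1)"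
proof -
  let ?F = "\<lambda>e K. A K K - (\<Sum>K1\<in>prec_nbrs h R r K. \<Sum>K2\<in>succ_nbrs h R r K1. A K K1 * A K1 K2 / e K1)"
  have "milu h R r A K = ?F (cut (milu h R r A) r K) K"
    unfolding milu_def by (rule wfrec[OF quadtree_wf[OF assms]])
  also have "\<dots> = ?F (milu h R r A) K"
    by (intro arg_cong2[of _ _ _ _ "(-)"] sum.cong refl) (simp add: cut_apply prec_nbrs_def)
  finally show ?thesis .
qed

end

(*
  Let d be the inflow of a cell K (boundary term plus the sum of w(K,P) / tau(P) over its predecessors P)
  and S its outgoing weight. The MILU recursion says 1 / tau(K) = d / (d + S), which is monotone in the
  predecessors, so any u with S u <= d(u) (1 - u) bounds tau by 1 / u. This is a discrete transport
  equation: up to the factor 1 - u the flux w / tau is passed on to the east and to the north.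

  With outgoing weights a (east) and b (north), measured in units of sigma, and edge length l, the function
  l exp(-S s) / ((s + delta) a b), s being the sum of the coordinates of the upper right corner, is a
  subsolution up to factors close to 1, except where b changes between horizontal neighbours or a between
  vertical ones. This happens only at corners of blocks, i.e. of cells of O_0. A constant loss per block
  gives the bound with c. For the sharp bound, the deficit emitted near a corner is carried by a
  symmetric random walk into the block and dies out like 1 / sqrt(distance), so that each block costs only
  1 - epsilon. The indices in I_0 avoid the remaining local disturbances up to a deficit 1/4, which the
  factor 2 in g absorbs. In both cases the correction is needed for finitely many n only.
*)

theory Submission
  imports Defs
begin

text \<open>Neighbours precede a cell exactly when they lie to its west or south. So reflection in
  the diagonal, although it does not preserve the order, preserves the inequalities to be shown, and
  each northern statement is the reflection of an eastern one. The subsolution is shaped by an error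
  budget. A path crosses about 2^n cells of a block, so inside blocks only second-order errors are
  affordable. The scaling by 9 / 10 pays for them: the growth of \<open>s\<close> offsets the factor
  \<open>1 - u\<close> with a tenth of a cell length to spare. Block sides are crossed a number of
  times independent of n, so a small fixed loss is harmless there. A corner is worse: the eastern
  flux is proportional to 1 / b and may jump by a factor 2 on any mesh, and what makes this
  tolerable is that it concerns few rows. \<open>\<delta>\<close> keeps \<open>u\<close> below 1 and
  the fluxes near the boundary below the boundary term; 8 \<open>\<delta>\<close> is at most the
  coordinate sum of the upper right corner of any block, so it costs a factor 9 / 8. In total 9 / 8
  * 10 / 9 * 20 / 19 * 4 / 3 < 2, and 2 is the factor in \<open>g_bound\<close>.\<close>

section \<open>Quadtrees as tilings\<close>

text \<open>The properties of a quadtree that the geometry needs, in a form invariant under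
  reflection. The covering clause tests with cells at least as fine as all of \<open>R\<close>; for
  these, being covered means having an ancestor in \<open>R\<close>.\<close>

definition tiling :: "nat \<Rightarrow> cell set \<Rightarrow> bool" where
  "tiling N R \<longleftrightarrow> finite R
     \<and> (\<forall>C\<in>R. xpos C < N * 2 ^ level C \<and> ypos C < N * 2 ^ level C)
     \<and> (\<forall>C\<in>R. \<forall>D\<in>R. level C \<le> level D \<longrightarrow> anc (level C) D = C \<longrightarrow> D = C)
     \<and> (\<forall>D. xpos D < N * 2 ^ level D \<longrightarrow> ypos D < N * 2 ^ level D \<longrightarrow>
          (\<forall>C\<in>R. level C \<le> level D) \<longrightarrow> (\<exists>l\<le>level D. anc l D \<in> R))"

lemma tilingD:
  assumes "tiling N R"
  shows tiling_finite: "finite R"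
    and tiling_range: "C \<in> R \<Longrightarrow> xpos C < N * 2 ^ level C" "C \<in> R \<Longrightarrow> ypos C < N * 2 ^ level C"
    and tiling_antichain: "C \<in> R \<Longrightarrow> D \<in> R \<Longrightarrow> level C \<le> level D \<Longrightarrow> anc (level C) D = C \<Longrightarrow> D = C"
    and tiling_cover: "xpos D < N * 2 ^ level D \<Longrightarrow> ypos D < N * 2 ^ level D \<Longrightarrow>
          (\<And>C. C \<in> R \<Longrightarrow> level C \<le> level D) \<Longrightarrow> \<exists>l\<le>level D. anc l D \<in> R"
  using assms unfolding tiling_def by blast+

lemma anc_anc: "k \<le> m \<Longrightarrow> m \<le> level E \<Longrightarrow> anc k (anc m E) = anc k E"
  by (simp add: anc_def div_mult2_eq[symmetric] power_add[symmetric])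

lemma children_iff: "E \<in> children C \<longleftrightarrow> level E = Suc (level C) \<and> anc (level C) E = C"
proof
  assume "E \<in> children C"
  then show "level E = Suc (level C) \<and> anc (level C) E = C"
    using level_children anc_children[of E C "level C"] by auto
next
  assume a: "level E = Suc (level C) \<and> anc (level C) E = C"
  then have "xpos C = xpos E div 2" "ypos C = ypos E div 2"
    by (cases C; simp add: anc_def)+
  then have "E = Cell (level C + 1) (2 * xpos C + xpos E mod 2) (2 * ypos C + ypos E mod 2)"
    using a by (cases E) simp
  then show "E \<in> children C" unfolding children_def by fastforce
qed

lemma tiling_quadtree:
  assumes "quadtree N R r"
  shows "tiling N R"
proof -
  have rng: "\<forall>C\<in>R. xpos C < N * 2 ^ level C \<and> ypos C < N * 2 ^ level C"
    using assms
  proof induction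
    case root then show ?case by (auto simp: root_grid_def)
  next
    case (step R r C)
    then have "xpos C < N * 2 ^ level C" "ypos C < N * 2 ^ level C" by auto
    then show ?case using step by (auto simp: children_def)
  qed
  have cov: "(\<forall>D. xpos D < N * 2 ^ level D \<longrightarrow> ypos D < N * 2 ^ level D \<longrightarrow>
          (\<forall>C\<in>R. level C \<le> level D) \<longrightarrow> (\<exists>l\<le>level D. anc l D \<in> R))"
    using assms
  proof induction
    case root
    show ?case
    proof (intro allI impI)
      fix D assume "xpos D < N * 2 ^ level D" "ypos D < N * 2 ^ level D"
      then have "anc 0 D \<in> root_grid N"
        by (simp add: root_grid_def anc_def less_mult_imp_div_less)
      then show "\<exists>l\<le>level D. anc l D \<in> root_grid N" by blast
    qed
  next
    case (step R r C)
    show ?case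
    proof (intro allI impI)
      fix D assume D: "xpos D < N * 2 ^ level D" "ypos D < N * 2 ^ level D"
        "\<forall>E\<in>R - {C} \<union> children C. level E \<le> level D"
      \<comment> \<open>The children of \<open>C\<close> bound the level of \<open>D\<close> from
        below, so \<open>D\<close> is finer than \<open>C\<close> as well and the induction
        hypothesis applies to it.\<close>
      have "Cell (level C + 1) (2 * xpos C + 0) (2 * ypos C + 0) \<in> children C"
        unfolding children_def by blast
      then have lC: "Suc (level C) \<le> level D" using D(3) level_children by (metis UnI2)
      then have "\<forall>E\<in>R. level E \<le> level D" using D(3) by (metis DiffI Suc_leD UnI1 singletonD)
      then obtain l where l: "l \<le> level D" "anc l D \<in> R" using step.IH D by blast
      show "\<exists>l\<le>level D. anc l D \<in> R - {C} \<union> children C"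
      proof (cases "anc l D = C")
        case False then show ?thesis using l by blast
      next
        case True
        then have "level C = l" by (metis level_anc)
        then have "anc (Suc l) D \<in> children C"
          using True lC by (simp add: children_iff anc_anc)
        then show ?thesis using lC \<open>level C = l\<close> by blast
      qed
    qed
  qed
  show ?thesis
    unfolding tiling_def using quadtree_finite[OF assms] rng cov quadtree_antichain[OF assms] by blast
qed

lemma tiling_refine: "is_quadtree N R \<Longrightarrow> tiling N (uniform_refine n R)"
  using is_quadtree_refine[of N R n] tiling_quadtree by (auto simp: is_quadtree_def)

lemma uniform_refine_iff:
  "D \<in> uniform_refine n R \<longleftrightarrow> n \<le> level D \<and> anc (level D - n) D \<in> R"
proof (induction n arbitrary: D)
  case (Suc n)
  have "D \<in> uniform_refine (Suc n) R \<longleftrightarrow> level D \<noteq> 0 \<and> anc (level D - 1) D \<in> uniform_refine n R"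
  proof -
    have "D \<in> uniform_refine (Suc n) R \<longleftrightarrow> (\<exists>C\<in>uniform_refine n R. level D = Suc (level C) \<and> anc (level C) D = C)"
      by (auto simp: children_iff)
    also have "\<dots> \<longleftrightarrow> level D \<noteq> 0 \<and> anc (level D - 1) D \<in> uniform_refine n R"
      by (metis Suc_pred' bot_nat_0.not_eq_extremum diff_Suc_1 level_anc nat.distinct(1))
    finally show ?thesis .
  qed
  also have "\<dots> \<longleftrightarrow> Suc n \<le> level D \<and> anc (level D - Suc n) D \<in> R"
    by (auto simp: Suc.IH anc_anc Suc_le_eq)
  finally show ?case .
qed simp

section \<open>Reflection in the diagonal, and adjacency in integer coordinates\<close>

definition swp :: "cell \<Rightarrow> cell" where
  "swp C = Cell (level C) (ypos C) (xpos C)"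

lemma swp_simps [simp]:
  "level (swp C) = level C" "xpos (swp C) = ypos C" "ypos (swp C) = xpos C" "swp (swp C) = C"
  "swp (Cell l x y) = Cell l y x"
  by (auto simp: swp_def)

lemma swp_eq_iff [simp]: "swp C = swp D \<longleftrightarrow> C = D"
  by (metis swp_simps(4))

lemma swp_image_iff: "C \<in> swp ` R \<longleftrightarrow> swp C \<in> R"
  by (metis image_iff swp_simps(4))

lemma anc_swp: "anc l (swp C) = swp (anc l C)"
  by (simp add: anc_def)

lemma swp_swp_image [simp]: "swp ` swp ` R = R"
  by (simp add: image_image)

lemma swp_refine: "uniform_refine n (swp ` R) = swp ` uniform_refine n R"
  by (auto simp: uniform_refine_iff swp_image_iff anc_swp set_eq_iff)

lemma tiling_swp:
  assumes "tiling N R"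
  shows "tiling N (swp ` R)"
proof -
  have "\<exists>l\<le>level D. anc l D \<in> swp ` R"
    if "xpos D < N * 2 ^ level D" "ypos D < N * 2 ^ level D" "\<forall>C\<in>swp ` R. level C \<le> level D" for D
    using tiling_cover[OF assms, of "swp D"] that by (auto simp: swp_image_iff anc_swp)
  moreover have "D = C" if "C \<in> swp ` R" "D \<in> swp ` R" "level C \<le> level D" "anc (level C) D = C" for C D
    using tiling_antichain[OF assms, of "swp C" "swp D"] that by (auto simp: swp_image_iff anc_swp)
  ultimately show ?thesis
    unfolding tiling_def using tilingD[OF assms] by auto
qed

text \<open>All coordinates are scaled by both powers of two, which keeps the comparison within the
  naturals. The strict inequalities exclude cells that meet in a corner.\<close>

definition east :: "cell \<Rightarrow> cell \<Rightarrow> bool" where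
  "east C D \<longleftrightarrow> (xpos C + 1) * 2 ^ level D = xpos D * 2 ^ level C
     \<and> ypos C * 2 ^ level D < (ypos D + 1) * 2 ^ level C
     \<and> ypos D * 2 ^ level C < (ypos C + 1) * 2 ^ level D"

definition north :: "cell \<Rightarrow> cell \<Rightarrow> bool" where
  "north C D \<longleftrightarrow> east (swp C) (swp D)"

text \<open>Dyadic intervals whose interiors meet are nested, so the position of the coarser one
  results from that of the finer one by division.\<close>

lemma dyadic_nested:
  fixes x x' :: nat
  assumes "l \<le> l'" "x * 2 ^ l' < (x' + 1) * 2 ^ l" "x' * 2 ^ l < (x + 1) * 2 ^ l'"
  shows "x' div 2 ^ (l' - l) = x"
proof -
  obtain k where k: "l' = l + k" using assms(1) le_Suc_ex by blast
  have "x * 2 ^ k * 2 ^ l < (x' + 1) * 2 ^ l" "x' * 2 ^ l < (x + 1) * 2 ^ k * 2 ^ l"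
    using assms by (auto simp: k power_add algebra_simps)
  then have "x * 2 ^ k < x' + 1" "x' < (x + 1) * 2 ^ k" by (simp_all only: mult_less_cancel2)
  then have "x * 2 ^ k \<le> x'" "x' < (x + 1) * 2 ^ k" by simp_all
  then show ?thesis using k by (intro div_nat_eqI) (auto simp: algebra_simps)
qed

definition overlap :: "cell \<Rightarrow> cell \<Rightarrow> bool" where
  "overlap C D \<longleftrightarrow> xpos C * 2 ^ level D < (xpos D + 1) * 2 ^ level C
     \<and> xpos D * 2 ^ level C < (xpos C + 1) * 2 ^ level D
     \<and> ypos C * 2 ^ level D < (ypos D + 1) * 2 ^ level C
     \<and> ypos D * 2 ^ level C < (ypos C + 1) * 2 ^ level D"

lemma overlap_anc:
  assumes "overlap C D" "level C \<le> level D"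
  shows "anc (level C) D = C"
  using assms dyadic_nested[of "level C" "level D" "xpos C" "xpos D"]
    dyadic_nested[of "level C" "level D" "ypos C" "ypos D"]
  by (cases C) (auto simp: overlap_def anc_def)

lemma overlap_sym: "overlap C D \<Longrightarrow> overlap D C"
  by (auto simp: overlap_def)

lemma overlap_eq:
  assumes "tiling N R" "C \<in> R" "D \<in> R" "overlap C D"
  shows "C = D"
  using assms overlap_anc overlap_sym tiling_antichain by (metis linorder_linear)

lemma real_dyadic:
  assumes "h > 0"
  shows "real a * (h / 2 ^ l) < real b * (h / 2 ^ m) \<longleftrightarrow> a * 2 ^ m < b * 2 ^ l"
    and "real a * (h / 2 ^ l) = real b * (h / 2 ^ m) \<longleftrightarrow> a * 2 ^ m = b * 2 ^ l"
proof -
  have "real a * (h / 2 ^ l) < real b * (h / 2 ^ m) \<longleftrightarrow> real a * 2 ^ m < real b * 2 ^ l"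
    using assms by (simp add: field_simps)
  also have "\<dots> \<longleftrightarrow> real (a * 2 ^ m) < real (b * 2 ^ l)" by simp
  finally show "real a * (h / 2 ^ l) < real b * (h / 2 ^ m) \<longleftrightarrow> a * 2 ^ m < b * 2 ^ l"
    by (simp only: of_nat_less_iff)
  have "real a * (h / 2 ^ l) = real b * (h / 2 ^ m) \<longleftrightarrow> real a * 2 ^ m = real b * 2 ^ l"
    using assms by (simp add: field_simps)
  also have "\<dots> \<longleftrightarrow> real (a * 2 ^ m) = real (b * 2 ^ l)" by simp
  finally show "real a * (h / 2 ^ l) = real b * (h / 2 ^ m) \<longleftrightarrow> a * 2 ^ m = b * 2 ^ l"
    by (simp only: of_nat_eq_iff)
qed

lemma finite_vertical:
  fixes x x' a b c d :: real
  assumes "a < b" "c < d"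
  shows "finite (({x} \<times> {a..b}) \<inter> ({x'} \<times> {c..d})) \<longleftrightarrow> \<not> (x = x' \<and> a < d \<and> c < b)"
proof (cases "x = x'")
  case True
  then have eq: "({x} \<times> {a..b}) \<inter> ({x'} \<times> {c..d}) = {x} \<times> {max a c..min b d}" by auto
  have "infinite ({x} \<times> {max a c..min b d}) \<longleftrightarrow> infinite {max a c..min b d}"
    by (auto simp: finite_cartesian_product_iff)
  also have "\<dots> \<longleftrightarrow> max a c < min b d" by (simp add: infinite_Icc_iff)
  finally show ?thesis using True eq assms by auto
next
  case False
  then have "({x} \<times> {a..b}) \<inter> ({x'} \<times> {c..d}) = {}" by auto
  then show ?thesis using False by simp
qed

lemma finite_horizontal:
  fixes y y' a b c d :: real
  assumes "a < b" "c < d"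
  shows "finite (({a..b} \<times> {y}) \<inter> ({c..d} \<times> {y'})) \<longleftrightarrow> \<not> (y = y' \<and> a < d \<and> c < b)"
proof -
  have "({a..b} \<times> {y}) \<inter> ({c..d} \<times> {y'}) = prod.swap ` (({y} \<times> {a..b}) \<inter> ({y'} \<times> {c..d}))"
    by force
  moreover have "finite (prod.swap ` A) \<longleftrightarrow> finite A" for A :: "(real \<times> real) set"
    by (rule finite_image_iff) (auto simp: inj_on_def)
  ultimately show ?thesis
    using finite_vertical[OF assms, of y y'] by simp
qed

lemma finite_cross:
  "finite (({x} \<times> A) \<inter> (B \<times> {y}))" "finite ((B \<times> {y}) \<inter> ({x} \<times> A))"
  by (rule finite_subset[of _ "{(x, y)}"]; auto)+

lemma cell_sides:
  "right_x h C = real (xpos C + 1) * (h / 2 ^ level C)" "left_x h C = real (xpos C) * (h / 2 ^ level C)"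
  "top_y h C = real (ypos C + 1) * (h / 2 ^ level C)" "bottom_y h C = real (ypos C) * (h / 2 ^ level C)"
  by (simp_all add: right_x_def left_x_def top_y_def bottom_y_def edge_len_def)

lemma east_iff:
  assumes h: "h > 0"
  shows "east C D \<longleftrightarrow> right_x h C = left_x h D \<and> bottom_y h C < top_y h D \<and> bottom_y h D < top_y h C"
  unfolding east_def cell_sides real_dyadic[OF h] by simp

text \<open>Edges may also share a segment when both are left edges, or both right, bottom or top
  edges. Then the cells overlap, which the antichain property rules out for distinct cells.\<close>

lemma nbrs_iff:
  assumes h: "h > 0" and t: "tiling N R" "C \<in> R"
  shows "D \<in> nbrs h R C \<longleftrightarrow> D \<in> R \<and> (east C D \<or> east D C \<or> north C D \<or> north D C)"
proof (cases "D \<in> R")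
  case D: True
  have ly: "bottom_y h E < top_y h E" "left_x h E < right_x h E" for E
    using h by (auto simp: bottom_y_def top_y_def left_x_def right_x_def edge_len_def field_simps)
  have e: "(\<exists>s\<in>edges h C. \<exists>s'\<in>edges h D. infinite (s \<inter> s')) \<longleftrightarrow>
     ((left_x h C = left_x h D \<or> left_x h C = right_x h D \<or> right_x h C = left_x h D \<or> right_x h C = right_x h D)
        \<and> bottom_y h C < top_y h D \<and> bottom_y h D < top_y h C) \<or>
     ((bottom_y h C = bottom_y h D \<or> bottom_y h C = top_y h D \<or> top_y h C = bottom_y h D \<or> top_y h C = top_y h D)
        \<and> left_x h C < right_x h D \<and> left_x h D < right_x h C)"
    unfolding edges_def
    by (simp add: finite_vertical[OF ly(1) ly(1)] finite_horizontal[OF ly(2) ly(2)] finite_cross) blast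
  have o: "overlap C D \<longleftrightarrow> left_x h C < right_x h D \<and> left_x h D < right_x h C \<and>
     bottom_y h C < top_y h D \<and> bottom_y h D < top_y h C"
    unfolding overlap_def cell_sides real_dyadic[OF h] by simp
  note ea = east_iff[OF h]
  have no: "north C' D' \<longleftrightarrow> top_y h C' = bottom_y h D' \<and> left_x h C' < right_x h D' \<and> left_x h D' < right_x h C'" for C' D'
    unfolding north_def east_def cell_sides real_dyadic[OF h] by simp
  show ?thesis
  proof (cases "C = D")
    case True
    then show ?thesis unfolding nbrs_def ea no using ly[of D] by auto
  next
    case False
    then have "\<not> overlap C D" using overlap_eq t D by blast
    then have "\<not> ((left_x h C = left_x h D \<or> right_x h C = right_x h D) \<and> bottom_y h C < top_y h D \<and> bottom_y h D < top_y h C)"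
      "\<not> ((bottom_y h C = bottom_y h D \<or> top_y h C = top_y h D) \<and> left_x h C < right_x h D \<and> left_x h D < right_x h C)"
      unfolding o using ly[of C] ly[of D] by auto
    moreover have "D \<in> nbrs h R C \<longleftrightarrow> (\<exists>s\<in>edges h C. \<exists>s'\<in>edges h D. infinite (s \<inter> s'))"
      using D False by (auto simp: nbrs_def)
    ultimately show ?thesis unfolding e ea no using D
      by (metis (lifting))
  qed
qed (simp add: nbrs_def)

text \<open>Division by powers of two is monotone, so the coordinatewise comparison persists up to
  the coarsest level at which the ancestors differ, and there it decides the lexicographic
  order.\<close>

lemma zlessI:
  assumes "m \<le> level C" "m \<le> level D" "xpos (anc m C) \<le> xpos (anc m D)" "ypos (anc m C) \<le> ypos (anc m D)"
    and "anc m C \<noteq> anc m D"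
  shows "zless C D"
proof -
  define l where "l = (LEAST l. anc l C \<noteq> anc l D)"
  have l: "anc l C \<noteq> anc l D" "l \<le> m" "\<forall>l'<l. anc l' C = anc l' D"
    unfolding l_def using assms(5) by (metis (mono_tags, lifting) LeastI, rule Least_le, auto dest: not_less_Least)
  have mono: "xpos (anc l (anc m C)) \<le> xpos (anc l (anc m D))" "ypos (anc l (anc m C)) \<le> ypos (anc l (anc m D))"
    using assms(3,4) by (auto simp: anc_def[of l] intro: div_le_mono)
  then have "xpos (anc l C) \<le> xpos (anc l D)" "ypos (anc l C) \<le> ypos (anc l D)"
    using l(2) assms(1,2) by (simp_all add: anc_anc)
  then have "cell_lex (anc l C) (anc l D)"
    using l(1) by (auto simp: cell_lex_def anc_def)
  then show ?thesis unfolding zless_def using l assms(1,2) by (intro exI[of _ l]) auto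
qed

text \<open>Input for \<open>zlessI\<close>: lifted to the level of the coarser cell, the two cells
  become equal-sized horizontal neighbours.\<close>

lemma east_anc:
  assumes "east C D" and m: "m = min (level C) (level D)"
  shows "Suc (xpos (anc m C)) = xpos (anc m D)" "ypos (anc m C) = ypos (anc m D)"
proof -
  have e: "(xpos C + 1) * 2 ^ level D = xpos D * 2 ^ level C"
    and y: "ypos C * 2 ^ level D < (ypos D + 1) * 2 ^ level C" "ypos D * 2 ^ level C < (ypos C + 1) * 2 ^ level D"
    using assms(1) by (auto simp: east_def)
  show "Suc (xpos (anc m C)) = xpos (anc m D)"
  proof (cases "level C \<le> level D")
    case True
    then obtain k where k: "level D = level C + k" using le_Suc_ex by blast
    then have "(xpos C + 1) * 2 ^ k * 2 ^ level C = xpos D * 2 ^ level C" using e unfolding k power_add by (simp only: mult_ac)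
    then have "xpos D = (xpos C + 1) * 2 ^ k" by (metis mult_cancel2 power_not_zero zero_neq_numeral)
    then show ?thesis using k m by (simp add: anc_def)
  next
    case False
    then obtain k where k: "level C = level D + k" using le_Suc_ex by (metis linorder_linear)
    then have "(xpos C + 1) * 2 ^ level D = xpos D * 2 ^ k * 2 ^ level D" using e unfolding k power_add by (simp only: mult_ac)
    then have "xpos C + 1 = xpos D * 2 ^ k" by (metis mult_cancel2 power_not_zero zero_neq_numeral)
    moreover from this have "xpos D > 0" by (cases "xpos D") auto
    ultimately obtain z where z: "xpos D = Suc z" "xpos C + 1 = z * 2 ^ k + 2 ^ k"
      by (cases "xpos D") auto
    moreover have "z * 2 ^ k < z * 2 ^ k + 2 ^ k" by simp
    ultimately have "2 ^ k * (xpos D - 1) \<le> xpos C" "xpos C < 2 ^ k * Suc (xpos D - 1)"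
      by (simp_all only: diff_Suc_1 mult_Suc_right mult.commute[of "2 ^ k"])
    then have "xpos C div 2 ^ k = xpos D - 1"
      by (rule div_nat_eqI)
    then show ?thesis using k m \<open>xpos D > 0\<close> by (simp add: anc_def)
  qed
  show "ypos (anc m C) = ypos (anc m D)"
    using dyadic_nested[OF _ y] dyadic_nested[OF _ y(2,1)] m
    by (cases "level C \<le> level D") (simp_all add: anc_def)
qed

lemma east_zless: "east C D \<Longrightarrow> zless C D"
  using east_anc[of C D "min (level C) (level D)"]
  by (intro zlessI[of "min (level C) (level D)"]) auto

lemma north_zless:
  assumes "north C D" shows "zless C D"
  using east_anc[of "swp C" "swp D" "min (level C) (level D)"] assms
  by (intro zlessI[of "min (level C) (level D)"]) (auto simp: north_def anc_swp)

lemma not_east_north: "east C D \<Longrightarrow> \<not> north C D"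
  by (auto simp: east_def north_def)

section \<open>Neighbours across a side\<close>

lemma div_overlap:
  fixes y Y :: nat
  assumes "l' \<le> l" "Y = y div 2 ^ (l - l')"
  shows "Y * 2 ^ l < (y + 1) * 2 ^ l'" "y * 2 ^ l' < (Y + 1) * 2 ^ l"
proof -
  obtain k where k: "l = l' + k" using assms(1) le_Suc_ex by blast
  then have Y: "Y = y div 2 ^ k" using assms by simp
  have "Y * 2 ^ k < y + 1" using Y by (simp add: less_Suc_eq_le)
  then have "Y * 2 ^ k * 2 ^ l' < (y + 1) * 2 ^ l'" by (simp only: mult_less_cancel2) simp
  then show "Y * 2 ^ l < (y + 1) * 2 ^ l'" by (simp add: k power_add mult_ac)
  have "y < (Y + 1) * 2 ^ k" using Y
    by (metis Suc_eq_plus1 dividend_less_div_times mult_Suc pos2 zero_less_power add.commute)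
  then have "y * 2 ^ l' < (Y + 1) * 2 ^ k * 2 ^ l'" by (intro mult_strict_right_mono) auto
  then show "y * 2 ^ l' < (Y + 1) * 2 ^ l" unfolding k power_add by (simp only: mult_ac)
qed

lemma balanced_east:
  assumes "h > 0" "tiling N R" "balanced h R" "C \<in> R" "D \<in> R" "east C D \<or> east D C"
  shows "level C \<le> Suc (level D)" "level D \<le> Suc (level C)"
proof -
  have "D \<in> nbrs h R C" using assms nbrs_iff by blast
  then have "\<bar>int (level C) - int (level D)\<bar> \<le> 1" using assms(3,4) unfolding balanced_def by blast
  then show "level C \<le> Suc (level D)" "level D \<le> Suc (level C)" by auto
qed

text \<open>A step of one column changes the block only across a multiple of the block
  width.\<close>

lemma sub_one_div:
  fixes x k :: nat
  assumes "0 < x" "\<not> 2 ^ k dvd x"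
  shows "(x - 1) div 2 ^ k = x div 2 ^ k"
proof -
  obtain z where z: "x = Suc z" using assms by (cases x) auto
  show ?thesis using assms(2) unfolding z by (simp add: div_Suc dvd_eq_mod_eq_0)
qed

lemma div_pred:
  fixes a b x :: nat
  assumes "0 < a" "0 < b"
  shows "(x * (b * a) + (b * a - 1)) div a = x * b + (b - 1)"
proof -
  obtain a' b' where "a = Suc a'" "b = Suc b'" using assms by (metis gr0_implies_Suc)
  then show ?thesis by (intro div_nat_eqI) (auto simp: algebra_simps)
qed

text \<open>Point sampling: a cell \<open>P\<close> finer than all of \<open>R\<close> is placed
  inside the position \<open>(x, y)\<close>, and the cell covering it is the neighbour sought.
  \<open>rt\<close> selects the easternmost instead of the westernmost column of that position, and
  \<open>\<tau>\<close> the lower or upper half.\<close>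

lemma deep_cell:
  assumes t: "tiling N R" and C: "level C = l" "ypos C = y" "C \<in> R" and x: "x < N * 2 ^ l" and "\<tau> < 2"
  shows "\<exists>A\<in>R. (level A < l \<longrightarrow> A = anc (level A) (Cell l x y)) \<and>
    (l \<le> level A \<longrightarrow> xpos A = x * 2 ^ (level A - l) + (if rt then 2 ^ (level A - l) - 1 else 0)) \<and>
    (l \<le> level A \<longrightarrow> ypos A div 2 ^ (level A - l) = y) \<and>
    (level A = Suc l \<longrightarrow> ypos A = 2 * y + \<tau>)"
proof -
  define k where "k = Max (level ` R)"
  define L where "L = l + Suc k"
  define P where "P = Cell L (x * 2 ^ Suc k + (if rt then 2 ^ Suc k - 1 else 0)) ((2 * y + \<tau>) * 2 ^ k)"
  have lev: "level D \<le> level P" if "D \<in> R" for D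
    using that tiling_finite[OF t] by (simp add: P_def L_def k_def trans_le_add2 le_SucI)
  have y: "y < N * 2 ^ l" using tiling_range(2)[OF t C(3)] C by simp
  have "xpos P < N * 2 ^ level P"
  proof -
    have "xpos P < (x + 1) * 2 ^ Suc k" by (simp add: P_def)
    also have "\<dots> \<le> (N * 2 ^ l) * 2 ^ Suc k" using x by (intro mult_right_mono) auto
    finally show ?thesis by (simp add: P_def L_def power_add mult_ac)
  qed
  moreover have "2 * y + \<tau> < N * 2 ^ Suc l" using y \<open>\<tau> < 2\<close> by simp
  then have "(2 * y + \<tau>) * 2 ^ k < N * 2 ^ Suc l * 2 ^ k" by (simp only: mult_less_cancel2) simp
  then have "ypos P < N * 2 ^ level P" by (simp add: P_def L_def power_add mult_ac)
  ultimately obtain l' where l': "l' \<le> level P" "anc l' P \<in> R"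
    using tiling_cover[OF t] lev by blast
  have lP: "level P = l + Suc k" by (simp add: P_def L_def)
  have "(2 * y + \<tau>) * 2 ^ k div 2 ^ Suc k = y"
    using \<open>\<tau> < 2\<close> by (simp add: mult.commute[of 2 "2 ^ k"] mult.commute[of _ "2 ^ k"])
  moreover have "(x * 2 ^ Suc k + (if rt then 2 ^ Suc k - 1 else 0)) div 2 ^ Suc k = x"
    by (rule div_nat_eqI) auto
  ultimately have ancl: "anc l P = Cell l x y"
    by (simp add: anc_def P_def L_def del: power_Suc)
  have lA: "level (anc l' P) = l'" by simp
  show ?thesis
  proof (intro bexI[of _ "anc l' P"] conjI impI; (unfold lA)?)
    show "anc l' P \<in> R" using l' by simp
    show "anc l' P = anc l' (Cell l x y)" if "l' < l"
      using that ancl anc_anc[of l' l P] lP by simp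
    show "xpos (anc l' P) = x * 2 ^ (l' - l) + (if rt then 2 ^ (l' - l) - 1 else 0)" if le: "l \<le> l'"
    proof -
      obtain d where d: "l' = l + d" using le_Suc_ex[OF le] by blast
      then have "d \<le> Suc k" using l'(1) lP by linarith
      then obtain c where c: "Suc k = d + c" using le_Suc_ex by blast
      have "(x * 2 ^ (d + c) + (if rt then 2 ^ (d + c) - 1 else 0)) div 2 ^ c
          = x * 2 ^ d + (if rt then 2 ^ d - 1 else 0)"
        using div_pred[of "2 ^ c" "2 ^ d" x] by (simp add: power_add mult_ac)
      then show ?thesis using d unfolding anc_def P_def L_def c by (simp split del: if_split cong: if_cong)
    qed
    show "ypos (anc l' P) div 2 ^ (l' - l) = y" if "l \<le> l'"
      using that ancl anc_anc[of l l' P] l' by (simp add: anc_def[of l "anc l' P"])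
    show "ypos (anc l' P) = 2 * y + \<tau>" if "l' = Suc l"
      using that by (simp add: anc_def P_def L_def)
  qed
qed

lemma anc_Cell: "l' \<le> l \<Longrightarrow> anc l' (Cell l x y) = Cell l' (x div 2 ^ (l - l')) (y div 2 ^ (l - l'))"
  by (simp add: anc_def)

text \<open>Balance leaves three possible sizes for the cell sampled just across the side. Both
  halves are sampled; as the first two alternatives do not mention \<open>\<tau>\<close>, failure of
  both yields the two finer neighbours together.\<close>

lemma cover_east:
  assumes h: "h > 0" and t: "tiling N R" and bal: "balanced h R" and C: "C \<in> R" "C = Cell l x y"
    and x: "x + 1 < N * 2 ^ l"
  shows "Cell l (x + 1) y \<in> R
    \<or> (0 < l \<and> odd x \<and> Cell (l - 1) ((x + 1) div 2) (y div 2) \<in> R)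
    \<or> (Cell (l + 1) (2 * (x + 1)) (2 * y) \<in> R \<and> Cell (l + 1) (2 * (x + 1)) (2 * y + 1) \<in> R)"
proof -
  have *: "Cell l (x + 1) y \<in> R
    \<or> (0 < l \<and> odd x \<and> Cell (l - 1) ((x + 1) div 2) (y div 2) \<in> R)
    \<or> Cell (l + 1) (2 * (x + 1)) (2 * y + \<tau>) \<in> R" if "\<tau> < 2" for \<tau>
  proof -
    obtain A where A0: "A \<in> R" "level A < l \<longrightarrow> A = anc (level A) (Cell l (x + 1) y)"
      "l \<le> level A \<longrightarrow> xpos A = (x + 1) * 2 ^ (level A - l) + (if False then 2 ^ (level A - l) - 1 else 0)"
      "l \<le> level A \<longrightarrow> ypos A div 2 ^ (level A - l) = y"
      "level A = Suc l \<longrightarrow> ypos A = 2 * y + \<tau>"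
      using deep_cell[OF t _ _ C(1) x \<open>\<tau> < 2\<close>, where y = y and rt = False] C(2) by (simp only: cell.sel) blast
    define l' where "l' = level A"
    have A: "A \<in> R" "level A = l'" "l' < l \<Longrightarrow> A = anc l' (Cell l (x + 1) y)"
      "l \<le> l' \<Longrightarrow> xpos A = (x + 1) * 2 ^ (l' - l) + (if False then 2 ^ (l' - l) - 1 else 0)"
      "l \<le> l' \<Longrightarrow> ypos A div 2 ^ (l' - l) = y"
      "l' = Suc l \<Longrightarrow> ypos A = 2 * y + \<tau>"
      using A0 unfolding l'_def by blast+
    show ?thesis
    proof (cases "l \<le> l'")
      case True
      then obtain d where d: "l' = l + d" using le_Suc_ex by blast
      have "east C A"
        using A(4)[OF True] div_overlap[OF True A(5)[OF True, symmetric]] A(2) C(2) d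
        by (simp add: east_def power_add algebra_simps)
      then have "l' \<le> Suc l" using balanced_east[OF h t bal C(1) A(1)] A(2) C(2) by simp
      then consider "l' = l" | "l' = Suc l" using True by linarith
      then show ?thesis
      proof cases
        case 1 then have "A = Cell l (x + 1) y" using A by (cases A) simp
        then show ?thesis using A(1) by simp
      next
        case 2 then have "A = Cell (l + 1) (2 * (x + 1)) (2 * y + \<tau>)" using A(2,4,6) by (cases A) simp
        then show ?thesis using A(1) by simp
      qed
    next
      case False
      then obtain k where k: "l = l' + k" "0 < k" by (metis less_imp_add_positive not_le)
      have Aeq: "A = Cell l' ((x + 1) div 2 ^ k) (y div 2 ^ k)" using A(3) False k by (simp add: anc_Cell)
      \<comment> \<open>Otherwise the coarser cell \<open>A\<close> would contain \<open>C\<close>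
        itself.\<close>
      have dvd: "2 ^ k dvd x + 1"
      proof (rule ccontr)
        assume "\<not> 2 ^ k dvd x + 1"
        then have "x div 2 ^ k = (x + 1) div 2 ^ k" using sub_one_div[of "x + 1" k] by simp
        then have "anc (level A) C = A" using Aeq C(2) k by (simp add: anc_Cell)
        then have "C = A" using tiling_antichain[OF t A(1) C(1)] A(2) C(2) False by simp
        then have "level A = l" using C(2) by (metis cell.sel(1))
        then show False using A(2) False by simp
      qed
      then obtain z where z: "x + 1 = 2 ^ k * z" by (auto elim!: dvdE)
      then have "(x + 1) * 2 ^ l' = z * (2 ^ l' * 2 ^ k)" "(x + 1) div 2 ^ k = z" by (simp_all only: mult_ac) simp
      then have "east C A"
        using div_overlap[of l' l "y div 2 ^ k" y] Aeq C(2) k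
        by (simp add: east_def power_add)
      then have "l = Suc l'" using balanced_east[OF h t bal C(1) A(1)] A(2) C(2) False by simp
      then show ?thesis using Aeq A(1) dvd k by (auto simp: odd_iff_mod_2_eq_one)
    qed
  qed
  show ?thesis using *[of 0] *[of 1] by auto
qed

lemma cover_west:
  assumes h: "h > 0" and t: "tiling N R" and bal: "balanced h R" and C: "C \<in> R" "C = Cell l x y"
    and x: "0 < x"
  shows "Cell l (x - 1) y \<in> R
    \<or> (0 < l \<and> even x \<and> Cell (l - 1) (x div 2 - 1) (y div 2) \<in> R)
    \<or> (Cell (l + 1) (2 * x - 1) (2 * y) \<in> R \<and> Cell (l + 1) (2 * x - 1) (2 * y + 1) \<in> R)"
proof -
  have *: "Cell l (x - 1) y \<in> R
    \<or> (0 < l \<and> even x \<and> Cell (l - 1) (x div 2 - 1) (y div 2) \<in> R)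
    \<or> Cell (l + 1) (2 * x - 1) (2 * y + \<tau>) \<in> R" if "\<tau> < 2" for \<tau>
  proof -
    have xN: "x - 1 < N * 2 ^ l" using tiling_range(1)[OF t C(1)] C(2) x by simp
    obtain A where A0: "A \<in> R" "level A < l \<longrightarrow> A = anc (level A) (Cell l (x - 1) y)"
      "l \<le> level A \<longrightarrow> xpos A = (x - 1) * 2 ^ (level A - l) + (if True then 2 ^ (level A - l) - 1 else 0)"
      "l \<le> level A \<longrightarrow> ypos A div 2 ^ (level A - l) = y"
      "level A = Suc l \<longrightarrow> ypos A = 2 * y + \<tau>"
      using deep_cell[OF t _ _ C(1) xN \<open>\<tau> < 2\<close>, where y = y and rt = True] C(2) by (simp only: cell.sel) blast
    define l' where "l' = level A"
    have A: "A \<in> R" "level A = l'" "l' < l \<Longrightarrow> A = anc l' (Cell l (x - 1) y)"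
      "l \<le> l' \<Longrightarrow> xpos A = (x - 1) * 2 ^ (l' - l) + (if True then 2 ^ (l' - l) - 1 else 0)"
      "l \<le> l' \<Longrightarrow> ypos A div 2 ^ (l' - l) = y"
      "l' = Suc l \<Longrightarrow> ypos A = 2 * y + \<tau>"
      using A0 unfolding l'_def by blast+
    have xA: "xpos A + 1 = x * 2 ^ (l' - l)" if "l \<le> l'"
      using A(4)[OF that] x by (cases x) auto
    show ?thesis
    proof (cases "l \<le> l'")
      case True
      then obtain d where d: "l' = l + d" using le_Suc_ex by blast
      have "east A C"
        using xA[OF True] div_overlap[OF True A(5)[OF True, symmetric]] A(2) C(2) d
        by (simp add: east_def power_add algebra_simps)
      then have "l' \<le> Suc l" using balanced_east[OF h t bal C(1) A(1)] A(2) C(2) by simp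
      then consider "l' = l" | "l' = Suc l" using True by linarith
      then show ?thesis
      proof cases
        case 1 then have "A = Cell l (x - 1) y" using A by (cases A) simp
        then show ?thesis using A(1) by simp
      next
        case 2 then have "A = Cell (l + 1) (2 * x - 1) (2 * y + \<tau>)" using A(2,6) xA by (cases A) auto
        then show ?thesis using A(1) by simp
      qed
    next
      case False
      then obtain k where k: "l = l' + k" "0 < k" by (metis less_imp_add_positive not_le)
      have Aeq: "A = Cell l' ((x - 1) div 2 ^ k) (y div 2 ^ k)" using A(3) False k by (simp add: anc_Cell)
      have dvd: "2 ^ k dvd x"
      proof (rule ccontr)
        assume "\<not> 2 ^ k dvd x"
        then have "(x - 1) div 2 ^ k = x div 2 ^ k" using sub_one_div[of x k] x by simp
        then have "anc (level A) C = A" using Aeq C(2) k by (simp add: anc_Cell)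
        then have "C = A" using tiling_antichain[OF t A(1) C(1)] A(2) C(2) False by simp
        then have "level A = l" using C(2) by (metis cell.sel(1))
        then show False using A(2) False by simp
      qed
      then obtain z where z: "x = 2 ^ k * z" "0 < z" using x by (auto elim!: dvdE)
      have zd: "(x - 1) div 2 ^ k = z - 1"
        using z div_pred[of "2 ^ k" 1 "z - 1"] by (cases z) (auto simp: ac_simps)
      then have "east A C"
        using div_overlap[of l' l "y div 2 ^ k" y] Aeq C(2) k z
        by (auto simp: east_def power_add mult_ac)
      then have "l = Suc l'" using balanced_east[OF h t bal C(1) A(1)] A(2) C(2) False by simp
      then show ?thesis using Aeq A(1) dvd k z zd by auto
    qed
  qed
  show ?thesis using *[of 0] *[of 1] by auto
qed

lemma balanced_swp:
  assumes h: "h > 0" and t: "tiling N R" and b: "balanced h R"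
  shows "balanced h (swp ` R)"
  unfolding balanced_def
proof (intro ballI)
  fix C D assume C: "C \<in> swp ` R" and D: "D \<in> nbrs h (swp ` R) C"
  have s: "swp C \<in> R" using C by (simp add: swp_image_iff)
  have "swp D \<in> nbrs h R (swp C)"
    using D unfolding nbrs_iff[OF h tiling_swp[OF t] C] nbrs_iff[OF h t s]
    by (auto simp: swp_image_iff north_def)
  then show "\<bar>int (level C) - int (level D)\<bar> \<le> 1"
    using b s unfolding balanced_def by fastforce
qed

section \<open>Blocks of the initial quadtree, and the cells facing each other across their
  sides\<close>

definition blk :: "nat \<Rightarrow> cell \<Rightarrow> cell" where
  "blk n K = anc (level K - n) K"

definition east_pos :: "cell \<Rightarrow> cell" where
  "east_pos K = Cell (level K) (xpos K + 1) (ypos K)"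

text \<open>Total weight of the eastern faces for \<open>\<sigma> = 1\<close>; the last case is that of two finer neighbours. Next to the
  boundary \<open>4 / 3\<close> is a harmless choice, since only upper bounds for the outgoing weights are needed.\<close>

definition east_wt :: "cell set \<Rightarrow> cell \<Rightarrow> real" where
  "east_wt R K = (if east_pos K \<in> R then 1
     else if 0 < level K \<and> anc (level K - 1) (east_pos K) \<in> R then 2 / 3 else 4 / 3)"

lemma blk_Cell: "n \<le> l \<Longrightarrow> blk n (Cell l x y) = Cell (l - n) (x div 2 ^ n) (y div 2 ^ n)"
  by (simp add: blk_def anc_def)

lemma blk_swp: "blk n (swp K) = swp (blk n K)"
  by (simp add: blk_def anc_swp)

lemma refine_Cell:
  "Cell l x y \<in> uniform_refine n Q \<longleftrightarrow> n \<le> l \<and> Cell (l - n) (x div 2 ^ n) (y div 2 ^ n) \<in> Q"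
  by (auto simp: uniform_refine_iff anc_Cell)

lemma div_div_swap: "(a::nat) div b div c = a div c div b"
  by (simp add: div_mult2_eq[symmetric] mult.commute)

lemma mult_pred:
  fixes c q :: nat
  assumes "0 < c" "0 < q"
  shows "(c * q - 1) div q = c - 1" "(c * q - 1) mod q = q - 1"
proof -
  obtain c' where c: "c = Suc c'" using assms by (cases c) auto
  then have e: "c * q - 1 = (q - 1) + c' * q" using assms by simp
  have "((q - 1) + c' * q) div q = c'" "((q - 1) + c' * q) mod q = q - 1"
    using assms by (simp_all only: div_mult_self1 mod_mult_self1) auto
  then show "(c * q - 1) div q = c - 1" "(c * q - 1) mod q = q - 1"
    unfolding e by (simp_all add: c)
qed

lemma double_add_div:
  fixes q y :: nat
  assumes "0 < q"
  shows "(2 * y + \<tau>) div q = 2 * (y div q) + (2 * (y mod q) + \<tau>) div q"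
    "(2 * y + \<tau>) mod q = (2 * (y mod q) + \<tau>) mod q"
proof -
  have "2 * y + \<tau> = q * (2 * (y div q)) + (2 * (y mod q) + \<tau>)"
  proof -
    obtain d m where dm: "d = y div q" "m = y mod q" by blast
    then have "y = q * d + m" by simp
    then have "2 * y + \<tau> = q * (2 * d) + (2 * m + \<tau>)" by (simp add: algebra_simps)
    then show ?thesis using dm by simp
  qed
  then show "(2 * y + \<tau>) div q = 2 * (y div q) + (2 * (y mod q) + \<tau>) div q"
    "(2 * y + \<tau>) mod q = (2 * (y mod q) + \<tau>) mod q"
    using assms by (metis div_mult_self4 less_not_refl, metis mod_mult_self4)
qed

text \<open>Seen from a coarser block, the rows of a block fill the lower or the upper half,
  according to the parity of the block row \<open>y div q\<close>.\<close>

lemma half_mod: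
  fixes q y :: nat
  shows "(y div 2) mod q = ((y div q mod 2) * q + y mod q) div 2"
proof (cases "q = 0")
  case False
  have "y = 2 * q * (y div q div 2) + ((y div q mod 2) * q + y mod q)"
    by (metis (no_types, lifting) add.assoc add_mult_distrib2 div_mult_mod_eq mult.assoc mult.commute)
  then have "y div 2 = q * (y div q div 2) + ((y div q mod 2) * q + y mod q) div 2"
    by (metis div_mult_self4 mult.assoc zero_neq_numeral)
  moreover have "((y div q mod 2) * q + y mod q) div 2 < q"
  proof -
    have "(y div q mod 2) * q \<le> 1 * q" by (intro mult_right_mono) auto
    moreover have "y mod q < q" using False by simp
    ultimately show ?thesis by linarith
  qed
  ultimately show ?thesis by (metis mod_less mod_mult_self4)
qed (simp)

text \<open>\<open>tiling\<close> takes the place of \<open>is_quadtree\<close>, so that the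
  reflected sets satisfy the same assumptions (\<open>mesh_swp\<close>).\<close>

locale mesh =
  fixes N n :: nat and h :: real and Q R :: "cell set"
  assumes h: "0 < h" and tQ: "tiling N Q" and bal: "balanced h Q" and tR: "tiling N R"
    and R_def: "R = uniform_refine n Q"
begin

lemma mesh_swp: "mesh N n h (swp ` Q) (swp ` R)"
  by unfold_locales (use h tQ bal tR R_def tiling_swp balanced_swp swp_refine in auto)

lemma mem_R: "Cell l x y \<in> R \<longleftrightarrow> n \<le> l \<and> Cell (l - n) (x div 2 ^ n) (y div 2 ^ n) \<in> Q"
  by (simp add: R_def refine_Cell)

lemma blk_in: "K \<in> R \<Longrightarrow> blk n K \<in> Q" "K \<in> R \<Longrightarrow> n \<le> level K"
  by (auto simp: R_def uniform_refine_iff blk_def)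

text \<open>Level changes happen only across block sides. Inside a block the neighbour has equal
  size; at a multiple of \<open>2 ^ n\<close> the three alternatives for blocks carry over to
  cells.\<close>

lemma cover_east_R:
  assumes K: "Cell l x y \<in> R" and x: "x + 1 < N * 2 ^ l"
  shows "Cell l (x + 1) y \<in> R
    \<or> (0 < l \<and> Cell (l - 1) ((x + 1) div 2) (y div 2) \<in> R)
    \<or> (Cell (l + 1) (2 * (x + 1)) (2 * y) \<in> R \<and> Cell (l + 1) (2 * (x + 1)) (2 * y + 1) \<in> R)"
proof (cases "2 ^ n dvd x + 1")
  case False
  then have "(x + 1) div 2 ^ n = x div 2 ^ n" using sub_one_div[of "x + 1" n] by simp
  then show ?thesis using K by (simp add: mem_R)
next
  case True
  then obtain z where z: "x + 1 = z * 2 ^ n" by (metis dvdE mult.commute)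
  have nl: "n \<le> l" using K by (simp add: mem_R)
  then obtain b where b: "l = b + n" by (metis le_add_diff_inverse2)
  have z0: "0 < z" using z by (cases z) auto
  have X: "x div 2 ^ n = z - 1" using mult_pred(1)[OF z0, of "2 ^ n"] unfolding z[symmetric] by simp
  have B: "Cell b (z - 1) (y div 2 ^ n) \<in> Q" using K X b by (simp add: mem_R)
  have "z * 2 ^ n < (N * 2 ^ b) * 2 ^ n" using x b z by (simp add: power_add mult_ac)
  then have "z - 1 + 1 < N * 2 ^ b" using z0 by simp
  from cover_east[OF h tQ bal B refl this]
  have c: "Cell b z (y div 2 ^ n) \<in> Q \<or> 0 < b \<and> Cell (b - 1) (z div 2) (y div 2 ^ n div 2) \<in> Q
    \<or> Cell (b + 1) (2 * z) (2 * (y div 2 ^ n)) \<in> Q \<and> Cell (b + 1) (2 * z) (2 * (y div 2 ^ n) + 1) \<in> Q"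
    using z0 by auto
  consider "Cell b z (y div 2 ^ n) \<in> Q" | "0 < b" "Cell (b - 1) (z div 2) (y div 2 ^ n div 2) \<in> Q"
    | "Cell (b + 1) (2 * z) (2 * (y div 2 ^ n)) \<in> Q" "Cell (b + 1) (2 * z) (2 * (y div 2 ^ n) + 1) \<in> Q"
    using c by blast
  then show ?thesis
  proof cases
    case 1
    then have "Cell l (x + 1) y \<in> R" unfolding mem_R z using b by simp
    then show ?thesis by blast
  next
    case 2
    then have "Cell (l - 1) ((x + 1) div 2) (y div 2) \<in> R"
      unfolding mem_R z using b by (simp add: div_div_swap[of _ 2])
    then show ?thesis using b 2 by blast
  next
    case 3
    have "(2 * y + \<tau>) div 2 ^ n = 2 * (y div 2 ^ n) \<or> (2 * y + \<tau>) div 2 ^ n = 2 * (y div 2 ^ n) + 1"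
      if "\<tau> < 2" for \<tau>
    proof -
      have "y mod 2 ^ n < 2 ^ n" by simp
      then have "2 * (y mod 2 ^ n) + \<tau> < 2 * 2 ^ n" using that by linarith
      then have "(2 * (y mod 2 ^ n) + \<tau>) div 2 ^ n < 2" by (simp add: less_mult_imp_div_less)
      then show ?thesis using double_add_div(1)[of "2 ^ n" y \<tau>] by (auto simp: less_2_cases_iff)
    qed
    from this[of 0] this[of 1] have "Cell (l + 1) (2 * (x + 1)) (2 * y) \<in> R" "Cell (l + 1) (2 * (x + 1)) (2 * y + 1) \<in> R"
      unfolding mem_R z using b 3 by (auto simp: mult.assoc[symmetric] Suc_diff_le)
    then show ?thesis by blast
  qed
qed

text \<open>Every eastern neighbour overlaps the position \<open>east_pos K\<close>, whether or not
  this is a cell of \<open>R\<close>, and the antichain property leaves the listed cells. An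
  inclusion suffices, because it serves to bound the outgoing weight from above.\<close>

lemma east_nbrs:
  assumes K: "K \<in> R" "K = Cell l x y"
  shows "{D \<in> R. east K D} \<subseteq>
    (if east_pos K \<in> R then {east_pos K}
     else if 0 < level K \<and> anc (level K - 1) (east_pos K) \<in> R then {anc (level K - 1) (east_pos K)}
     else {Cell (l + 1) (2 * (x + 1)) (2 * y), Cell (l + 1) (2 * (x + 1)) (2 * y + 1)})"
proof (intro subsetI)
  fix D assume "D \<in> {D \<in> R. east K D}"
  then have D: "D \<in> R" "east K D" by auto
  let ?e = "Cell l (x + 1) y"
  have e: "east_pos K = ?e" using K by (simp add: east_pos_def)
  have ov: "overlap ?e D"
    using D(2) K(2) unfolding east_def overlap_def by (auto simp: algebra_simps)
  have xD: "x + 1 < N * 2 ^ l"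
  proof -
    have "(x + 1) * 2 ^ level D = xpos D * 2 ^ l" using D(2) K(2) by (simp add: east_def)
    also have "\<dots> < (N * 2 ^ level D) * 2 ^ l" using tiling_range(1)[OF tR D(1)] by simp
    finally have "(x + 1) * 2 ^ level D < (N * 2 ^ l) * 2 ^ level D" by (simp only: mult_ac)
    then show ?thesis by (simp only: mult_less_cancel2)
  qed
  have up: "anc l D = ?e" if "l \<le> level D" using overlap_anc[OF ov] that by simp
  have dn: "anc (level D) ?e = D" if "level D \<le> l" using overlap_anc[OF overlap_sym[OF ov]] that by simp
  show "D \<in> (if east_pos K \<in> R then {east_pos K}
     else if 0 < level K \<and> anc (level K - 1) (east_pos K) \<in> R then {anc (level K - 1) (east_pos K)}
     else {Cell (l + 1) (2 * (x + 1)) (2 * y), Cell (l + 1) (2 * (x + 1)) (2 * y + 1)})"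
  proof (cases "?e \<in> R")
    case True
    then show ?thesis using overlap_eq[OF tR True D(1) ov] e by simp
  next
    case nR: False
    show ?thesis
    proof (cases "0 < l \<and> anc (l - 1) ?e \<in> R")
      case True
      have "D = anc (l - 1) ?e"
      proof (cases "l \<le> level D")
        case le: True
        then have "anc (l - 1) D = anc (l - 1) ?e" using up anc_anc[of "l - 1" l D] by simp
        then show ?thesis using tiling_antichain[OF tR, of "anc (l - 1) ?e" D] True D(1) le by simp
      next
        case False
        then have "anc (level D) (anc (l - 1) ?e) = D" using dn anc_anc[of "level D" "l - 1" ?e] by simp
        then show ?thesis using tiling_antichain[OF tR D(1), of "anc (l - 1) ?e"] True False by simp
      qed
      then show ?thesis using nR True e K by simp
    next
      case False
      have c: "Cell (l + 1) (2 * (x + 1)) (2 * y) \<in> R" "Cell (l + 1) (2 * (x + 1)) (2 * y + 1) \<in> R"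
        using cover_east_R[of l x y] xD K nR False by (auto simp: anc_Cell)
      have "l < level D"
      proof (rule ccontr)
        assume le: "\<not> l < level D"
        let ?c = "Cell (l + 1) (2 * (x + 1)) (2 * y)"
        have "anc l ?c = ?e" by (simp add: anc_Cell)
        then have "anc (level D) ?c = D" using dn le anc_anc[of "level D" l ?c] by simp
        then have "?c = D" using tiling_antichain[OF tR D(1) c(1)] le by simp
        then show False using le by auto
      qed
      then obtain d where d: "level D = Suc l + d" by (metis less_iff_Suc_add add_Suc)
      have "anc l (anc (Suc l) D) = ?e" using up anc_anc[of l "Suc l" D] d by simp
      then have y': "ypos (anc (Suc l) D) div 2 = y" by (simp add: anc_def)
      have "(x + 1) * 2 ^ level D = xpos D * 2 ^ l" using D(2) K(2) by (simp add: east_def)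
      then have "(2 * (x + 1) * 2 ^ d) * 2 ^ l = xpos D * 2 ^ l" by (simp only: d power_add power_Suc mult_ac)
      then have "xpos D = 2 * (x + 1) * 2 ^ d" by (metis mult_cancel2 power_not_zero zero_neq_numeral)
      then have x': "xpos (anc (Suc l) D) = 2 * (x + 1)" using d by (simp add: anc_def)
      have "ypos (anc (Suc l) D) = 2 * y \<or> ypos (anc (Suc l) D) = 2 * y + 1"
        using y' by linarith
      then have "anc (Suc l) D \<in> {Cell (l + 1) (2 * (x + 1)) (2 * y), Cell (l + 1) (2 * (x + 1)) (2 * y + 1)}"
        using x' level_anc[of "Suc l" D] by (cases "anc (Suc l) D") auto
      moreover from this have "anc (Suc l) D \<in> R" using c by auto
      then have "D = anc (Suc l) D"
        using tiling_antichain[OF tR, of "anc (Suc l) D" D] D(1) d by simp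
      ultimately have "D \<in> {Cell (l + 1) (2 * (x + 1)) (2 * y), Cell (l + 1) (2 * (x + 1)) (2 * y + 1)}" by simp
      moreover have "\<not> (0 < level K \<and> anc (level K - 1) (east_pos K) \<in> R)" "east_pos K \<notin> R"
        using nR False e K by auto
      ultimately show ?thesis by (simp only: if_False)
    qed
  qed
qed

text \<open>The kind of neighbour is constant along the side of a block. Reflected, this says that
  the northern weight does not change along a row inside a block, so that it cancels in the eastern
  flux there.\<close>

lemma east_wt_cong:
  assumes "level K = level D" "xpos K = xpos D" "ypos K div 2 ^ n = ypos D div 2 ^ n" "n \<le> level K"
  shows "east_wt R K = east_wt R D"
proof -
  have "east_pos K \<in> R \<longleftrightarrow> east_pos D \<in> R"
    using assms by (simp add: east_pos_def mem_R)
  moreover have "anc (level K - 1) (east_pos K) \<in> R \<longleftrightarrow> anc (level D - 1) (east_pos D) \<in> R" if "0 < level K"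
    using assms that by (simp add: east_pos_def mem_R anc_Cell div_div_swap[of _ 2])
  ultimately show ?thesis using assms by (auto simp: east_wt_def)
qed

lemma east_wt_inner:
  assumes "K \<in> R" "Suc (xpos K mod 2 ^ n) \<noteq> 2 ^ n"
  shows "east_wt R K = 1"
proof -
  have "\<not> 2 ^ n dvd xpos K + 1"
    using assms(2) by (auto simp: dvd_eq_mod_eq_0 mod_Suc)
  then have "(xpos K + 1) div 2 ^ n = xpos K div 2 ^ n" using sub_one_div[of "xpos K + 1" n] by simp
  then show ?thesis using assms(1) by (cases K) (simp add: east_wt_def east_pos_def mem_R)
qed

text \<open>Across a block side each case also records the row of the neighbouring block that faces
  \<open>K\<close>, which yields the alternatives of \<open>rows_meet\<close>, and the adjacency of
  the two blocks, which brings in one step of the block factor.\<close>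

lemma west_flow:
  assumes K: "K \<in> R" "K = Cell l x y" and x: "0 < x"
  defines "q \<equiv> (2::nat) ^ n"
  obtains (inner) "x mod q \<noteq> 0" "Cell l (x - 1) y \<in> R" "blk n (Cell l (x - 1) y) = blk n K"
  | (same) "x mod q = 0" "Cell l (x - 1) y \<in> R" "(x - 1) mod q = q - 1" "east (blk n (Cell l (x - 1) y)) (blk n K)"
  | (coarse) "x mod q = 0" "0 < l" "even x" "Cell (l - 1) (x div 2 - 1) (y div 2) \<in> R" "(x div 2 - 1) mod q = q - 1"
      "(y div 2) mod q = (y mod q) div 2 \<or> (y div 2) mod q = (q + y mod q) div 2"
      "east (blk n (Cell (l - 1) (x div 2 - 1) (y div 2))) (blk n K)"
  | (fine) "x mod q = 0" "\<And>\<tau>. \<tau> < 2 \<Longrightarrow> Cell (l + 1) (2 * x - 1) (2 * y + \<tau>) \<in> R"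
      "(2 * x - 1) mod q = q - 1" "\<And>\<tau>. (2 * y + \<tau>) mod q = (2 * (y mod q) + \<tau>) mod q"
      "\<And>\<tau>. \<tau> < 2 \<Longrightarrow> east (blk n (Cell (l + 1) (2 * x - 1) (2 * y + \<tau>))) (blk n K)"
proof (cases "x mod q = 0")
  case False
  then have "\<not> 2 ^ n dvd x" by (auto simp: q_def)
  then have "(x - 1) div 2 ^ n = x div 2 ^ n" using sub_one_div x by simp
  then show thesis using inner False K by (simp add: mem_R blk_Cell)
next
  case True
  have q0: "0 < q" by (simp add: q_def)
  from True obtain X where X: "x = X * q" by (metis mod_0_imp_dvd dvdE mult.commute)
  have X0: "0 < X" using X x by (cases X) auto
  have nl: "n \<le> l" using K by (simp add: mem_R)
  then obtain b where b: "l = b + n" by (metis le_add_diff_inverse2)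
  define Y where "Y = y div q"
  have B: "Cell b X Y \<in> Q" using K(1) q0 unfolding K(2) mem_R by (simp add: X q_def[symmetric] b Y_def)
  have bK: "blk n K = Cell b X Y" using K(2) nl q0 by (simp add: blk_Cell b X q_def[symmetric] Y_def)
  note pred = mult_pred[OF _ q0]
  consider "Cell b (X - 1) Y \<in> Q" | "0 < b" "even X" "Cell (b - 1) (X div 2 - 1) (Y div 2) \<in> Q"
    | "Cell (b + 1) (2 * X - 1) (2 * Y) \<in> Q" "Cell (b + 1) (2 * X - 1) (2 * Y + 1) \<in> Q"
    using cover_west[OF h tQ bal B refl X0] by blast
  then show thesis
  proof cases
    case 1
    have bD: "blk n (Cell l (x - 1) y) = Cell b (X - 1) Y"
      using nl pred(1)[OF X0] by (simp add: blk_Cell b X Y_def q_def)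
    have "Cell l (x - 1) y \<in> R"
      using 1 pred(1)[OF X0] unfolding mem_R by (simp add: b X Y_def q_def)
    moreover have "east (Cell b (X - 1) Y) (Cell b X Y)" using X0 by (simp add: east_def)
    ultimately show thesis using same True X pred(2)[OF X0] bD bK by simp
  next
    case 2
    then obtain X' where X': "X = 2 * X'" by (auto elim: evenE)
    then have X'0: "0 < X'" using X0 by simp
    have xd: "x div 2 = X' * q" using X X' by simp
    have yd: "y div 2 div q = Y div 2" by (simp add: Y_def div_div_swap)
    have bD: "blk n (Cell (l - 1) (x div 2 - 1) (y div 2)) = Cell (b - 1) (X' - 1) (Y div 2)"
      using 2(1) pred(1)[OF X'0] xd yd by (simp add: blk_Cell b q_def)
    have D: "Cell (l - 1) (x div 2 - 1) (y div 2) \<in> R"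
      using 2 pred(1)[OF X'0] xd yd X' unfolding mem_R by (simp add: b q_def)
    have ea: "east (Cell (b - 1) (X' - 1) (Y div 2)) (Cell b X Y)"
      using div_overlap[of "b - 1" b "Y div 2" Y] 2(1) X'0 X' by (cases b) (simp_all add: east_def)
    have "(y div 2) mod q = (y mod q) div 2 \<or> (y div 2) mod q = (q + y mod q) div 2"
      using half_mod[of y q] by (cases "even (y div q)") (auto simp: odd_iff_mod_2_eq_one even_iff_mod_2_eq_zero)
    then show thesis using coarse True D bD bK ea 2(1) pred(2)[OF X'0] xd X X' b by simp
  next
    case 3
    have xd: "2 * x - 1 = (2 * X) * q - 1" using X by simp
    have X20: "0 < 2 * X" using X0 by simp
    have p: "(2 * y + \<tau>) div q = 2 * Y \<or> (2 * y + \<tau>) div q = 2 * Y + 1" if "\<tau> < 2" for \<tau>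
    proof -
      have "y mod q < q" using q0 by simp
      then have "2 * (y mod q) + \<tau> < 2 * q" using that by linarith
      then have "(2 * (y mod q) + \<tau>) div q < 2" by (simp add: less_mult_imp_div_less)
      then show ?thesis using double_add_div(1)[OF q0, of y \<tau>] by (auto simp: less_2_cases_iff Y_def)
    qed
    have bD: "blk n (Cell (l + 1) (2 * x - 1) (2 * y + \<tau>)) = Cell (b + 1) (2 * X - 1) ((2 * y + \<tau>) div q)" for \<tau>
      using pred(1)[OF X20] xd by (simp add: blk_Cell b q_def)
    have D: "Cell (l + 1) (2 * x - 1) (2 * y + \<tau>) \<in> R" if "\<tau> < 2" for \<tau>
      using p[OF that] 3 pred(1)[OF X20] xd unfolding mem_R by (auto simp: b q_def)
    have ea: "east (Cell (b + 1) (2 * X - 1) ((2 * y + \<tau>) div q)) (Cell b X Y)" if "\<tau> < 2" for \<tau>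
      using p[OF that] X0 by (auto simp: east_def)
    show thesis
      by (rule fine) (use True D bD bK ea pred(2)[OF X20] xd double_add_div(2)[OF q0] in simp_all)
  qed
qed

end

section \<open>The recursion as a comparison principle\<close>

text \<open>The negated matrix entry. Since \<open>3 * \<alpha>_fv\<close> is 2, all numerators are
  2; for constant \<open>\<sigma>\<close> the weight is \<open>\<sigma>\<close> between equal levels
  and two thirds of it otherwise.\<close>

definition face_wt :: "real \<Rightarrow> (real \<times> real \<Rightarrow> real) \<Rightarrow> cell \<Rightarrow> cell \<Rightarrow> real" where
  "face_wt h \<sigma> K D = (let s = coeff_at h \<sigma> K; t = coeff_at h \<sigma> D in
     if level K = level D then 2 * inverse (inverse s + inverse t)
     else if level K = level D + 1 then 2 * inverse (inverse s + 2 * inverse t)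
     else 2 * inverse (inverse t + 2 * inverse s))"

lemma off_diag_face_wt:
  "off_diag h \<sigma> R K D = (if D \<in> nbrs h R K then - face_wt h \<sigma> K D else 0)"
  by (simp add: off_diag_def face_wt_def Let_def \<alpha>_fv_def)

lemma face_wt_pos: "0 < coeff_at h \<sigma> K \<Longrightarrow> 0 < coeff_at h \<sigma> D \<Longrightarrow> 0 < face_wt h \<sigma> K D"
  by (auto simp: face_wt_def Let_def intro!: add_pos_pos)

lemma sum_fv_matrix:
  assumes "S \<subseteq> nbrs h R K"
  shows "(\<Sum>D\<in>S. fv_matrix a h \<sigma> R K D) = - (\<Sum>D\<in>S. face_wt h \<sigma> K D)"
proof -
  have "fv_matrix a h \<sigma> R K D = - face_wt h \<sigma> K D" if "D \<in> S" for D
    using that assms by (auto simp: fv_matrix_def off_diag_face_wt nbrs_def)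
  then show ?thesis by (simp add: sum_negf)
qed

lemma finite_nbrs: "finite R \<Longrightarrow> finite (nbrs h R K)"
  by (simp add: nbrs_def)

text \<open>Induction along the order. Where \<open>u\<close> is not positive it claims nothing,
  hence \<open>max (u D) 0\<close> in the inflow. \<open>T\<close> permits an overestimate of the
  outgoing weight; \<open>T * u K > 0\<close> forces a positive inflow and
  \<open>u K < 1\<close>.\<close>

lemma lecn_le:
  assumes qt: "quadtree N R r" and h: "0 < h"
    and pos: "\<And>K. K \<in> R \<Longrightarrow> 0 < coeff_at h \<sigma> K"
    and sub: "\<And>K. K \<in> R \<Longrightarrow> 0 < u K \<Longrightarrow>
      \<exists>T>0. (\<Sum>D\<in>succ_nbrs h R r K. face_wt h \<sigma> K D) \<le> T \<and>
        T * u K \<le> (2 * real (boundary_edges a h K) * coeff_at h \<sigma> K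
          + (\<Sum>D\<in>prec_nbrs h R r K. face_wt h \<sigma> K D * max (u D) 0)) * (1 - u K)"
    and K: "K \<in> R" "0 < u K"
  shows "lecn h R r (fv_matrix a h \<sigma> R) K \<le> 1 / u K"
proof -
  define A where "A = fv_matrix a h \<sigma> R"
  define e where "e = milu h R r A"
  define w where "w = face_wt h \<sigma>"
  define S where "S K = (\<Sum>D\<in>succ_nbrs h R r K. w K D)" for K
  define d where "d K = e K - S K" for K
  define B where "B K = 2 * real (boundary_edges a h K) * coeff_at h \<sigma> K" for K
  note t = tiling_quadtree[OF qt]
  have fin: "finite (nbrs h R K)" "finite (prec_nbrs h R r K)" "finite (succ_nbrs h R r K)" for K
    using finite_nbrs[OF tiling_finite[OF t]] by (simp_all add: prec_nbrs_def succ_nbrs_def)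
  have r: "r = {(D, E). D \<in> R \<and> E \<in> R \<and> zless D E}" using quadtree_zless[OF qt] .
  have sub_nb: "prec_nbrs h R r K \<subseteq> nbrs h R K" "succ_nbrs h R r K \<subseteq> nbrs h R K" for K
    by (auto simp: prec_nbrs_def succ_nbrs_def)
  have inR: "nbrs h R K \<subseteq> R" for K by (auto simp: nbrs_def)
  have split: "nbrs h R K = prec_nbrs h R r K \<union> succ_nbrs h R r K" if "K \<in> R" for K
  proof -
    have "zless D K \<or> zless K D" if "D \<in> nbrs h R K" for D
      using that nbrs_iff[OF h t \<open>K \<in> R\<close>] east_zless north_zless by blast
    then show ?thesis using that inR by (auto simp: prec_nbrs_def succ_nbrs_def r)
  qed
  have disj: "prec_nbrs h R r K \<inter> succ_nbrs h R r K = {}" for K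
    by (auto simp: prec_nbrs_def succ_nbrs_def r dest: zless_trans simp: zless_irrefl)
  have wpos: "0 < w K D" if "K \<in> R" "D \<in> R" for K D
    using that pos face_wt_pos by (simp add: w_def)
  have S0: "0 \<le> S K" if "K \<in> R" for K
    unfolding S_def using wpos[OF that] sub_nb inR by (intro sum_nonneg) (meson less_imp_le subsetD)
  have backward: "K \<in> succ_nbrs h R r P" "P \<in> R" if "P \<in> prec_nbrs h R r K" "K \<in> R" for P K
  proof -
    show P: "P \<in> R" using that sub_nb inR by blast
    show "K \<in> succ_nbrs h R r P"
      using that nbrs_iff[OF h t P] nbrs_iff[OF h t that(2)] by (auto simp: prec_nbrs_def succ_nbrs_def)
  qed
  have main: "0 \<le> d K \<and> (0 < u K \<longrightarrow> u K \<le> d K / e K)" if "K \<in> R" for K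
    using quadtree_wf[OF qt] that
  proof (induction K rule: wf_induct_rule)
    case (less K)
    have IH: "0 \<le> d P" "0 < e P" "max (u P) 0 \<le> d P / e P" if "P \<in> prec_nbrs h R r K" for P
    proof -
      have P: "(P, K) \<in> r" "P \<in> R" "K \<in> succ_nbrs h R r P"
        using that backward[OF that less.prems] by (auto simp: prec_nbrs_def)
      show dP: "0 \<le> d P" using less.IH[OF P(1,2)] by simp
      have "w P K \<le> S P" unfolding S_def
        by (rule member_le_sum[OF P(3) _ fin(3)]) (use wpos[OF P(2)] sub_nb inR in \<open>meson DiffD1 less_imp_le subsetD\<close>)
      then show eP: "0 < e P" using dP wpos[OF P(2) less.prems] by (simp add: d_def)
      show "max (u P) 0 \<le> d P / e P"
        using less.IH[OF P(1,2)] dP eP by (auto simp: max_def)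
    qed
    have "e K = A K K - (\<Sum>P\<in>prec_nbrs h R r K. \<Sum>D\<in>succ_nbrs h R r P. A K P * A P D / e P)"
      unfolding e_def by (rule milu_rec[OF qt])
    also have "(\<Sum>P\<in>prec_nbrs h R r K. \<Sum>D\<in>succ_nbrs h R r P. A K P * A P D / e P)
      = (\<Sum>P\<in>prec_nbrs h R r K. w K P * (1 - d P / e P))"
    proof (rule sum.cong[OF refl])
      fix P assume P: "P \<in> prec_nbrs h R r K"
      have "A K P = - w K P"
        using sum_fv_matrix[of "{P}" h R K a \<sigma>] P sub_nb by (auto simp: A_def w_def)
      moreover have "(\<Sum>D\<in>succ_nbrs h R r P. A P D) = - S P"
        using sum_fv_matrix[OF sub_nb(2)] by (simp add: A_def w_def S_def)
      moreover have "(\<Sum>D\<in>succ_nbrs h R r P. A K P * A P D / e P) = A K P * (\<Sum>D\<in>succ_nbrs h R r P. A P D) / e P"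
        by (simp add: sum_distrib_left sum_divide_distrib)
      ultimately have "(\<Sum>D\<in>succ_nbrs h R r P. A K P * A P D / e P) = w K P * (S P / e P)"
        by simp
      also have "S P / e P = 1 - d P / e P" using IH(2)[OF P] by (simp add: d_def field_simps)
      finally show "(\<Sum>D\<in>succ_nbrs h R r P. A K P * A P D / e P) = w K P * (1 - d P / e P)" .
    qed
    also have "A K K = (\<Sum>D\<in>prec_nbrs h R r K. w K D) + S K + B K"
    proof -
      have "(\<Sum>D\<in>nbrs h R K. off_diag h \<sigma> R K D) = - (\<Sum>D\<in>nbrs h R K. w K D)"
        by (simp add: off_diag_face_wt w_def sum_negf)
      then show ?thesis
        using sum.union_disjoint[OF fin(2,3) disj, of "w K" K] split[OF less.prems]
        by (simp add: A_def fv_matrix_def B_def S_def)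
    qed
    \<comment> \<open>Row sums of the matrix vanish up to the boundary term, so the weights towards
      the predecessors cancel and only the fractions \<open>d P / e P\<close> remain.\<close>
    finally have dK: "d K = B K + (\<Sum>P\<in>prec_nbrs h R r K. w K P * (d P / e P))"
      by (simp add: d_def right_diff_distrib sum_subtractf)
    have ge: "(\<Sum>P\<in>prec_nbrs h R r K. w K P * max (u P) 0) \<le> (\<Sum>P\<in>prec_nbrs h R r K. w K P * (d P / e P))"
      by (intro sum_mono mult_left_mono IH(3)) (use wpos[OF less.prems] backward(2)[OF _ less.prems] less_imp_le in blast)+
    have B0: "0 \<le> B K" using pos[OF less.prems] by (simp add: B_def)
    have "0 \<le> (\<Sum>P\<in>prec_nbrs h R r K. w K P * max (u P) 0)"
      by (intro sum_nonneg mult_nonneg_nonneg) (use wpos[OF less.prems] backward(2)[OF _ less.prems] less_imp_le in auto)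
    then have d0: "0 \<le> d K" using dK ge B0 by linarith
    have "u K \<le> d K / e K" if u: "0 < u K"
    proof -
      obtain T where T: "0 < T" "S K \<le> T"
        "T * u K \<le> (B K + (\<Sum>D\<in>prec_nbrs h R r K. w K D * max (u D) 0)) * (1 - u K)"
        using sub[OF less.prems u] by (auto simp: S_def B_def w_def)
      define d' where "d' = B K + (\<Sum>D\<in>prec_nbrs h R r K. w K D * max (u D) 0)"
      have d': "0 \<le> d'" "d' \<le> d K"
        using ge dK B0 \<open>0 \<le> (\<Sum>P\<in>prec_nbrs h R r K. w K P * max (u P) 0)\<close> by (auto simp: d'_def)
      have "0 < T * u K" using T u by simp
      then have "0 < d' * (1 - u K)" using T(3) by (simp add: d'_def)
      then have pos': "0 < d'" "0 < 1 - u K" using d'(1) by (auto simp: zero_less_mult_iff)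
      have "S K * u K \<le> T * u K" using T u by simp
      also have "\<dots> \<le> d' * (1 - u K)" using T(3) by (simp add: d'_def)
      also have "\<dots> \<le> d K * (1 - u K)" using d'(2) pos' by simp
      finally have "u K * e K \<le> d K" by (simp add: d_def algebra_simps)
      moreover have "0 < e K" using pos' d' S0[OF less.prems] by (simp add: d_def)
      ultimately show ?thesis by (simp add: pos_le_divide_eq)
    qed
    then show ?case using d0 by blast
  qed
  have "e K + (\<Sum>D\<in>succ_nbrs h R r K. A K D) = d K"
    using sum_fv_matrix[OF sub_nb(2)] by (simp add: A_def w_def S_def d_def)
  then have "lecn h R r A K = e K / d K" by (simp add: lecn_def e_def)
  moreover have "u K \<le> d K / e K" "0 \<le> d K" using main[OF K(1)] K(2) by auto
  moreover from this K(2) have "0 < d K" "0 < e K"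
    by (metis divide_eq_0_iff less_le_trans linorder_not_less order_less_le zero_less_divide_iff)+
  ultimately have "u K * e K \<le> d K" "lecn h R r A K * d K = e K" "0 < d K"
    by (simp_all add: pos_le_divide_eq)
  then have "u K * lecn h R r A K * d K \<le> 1 * d K" by (simp add: mult.assoc)
  then have "u K * lecn h R r A K \<le> 1" using \<open>0 < d K\<close> by (simp only: mult_le_cancel_right_pos)
  then show ?thesis using K(2) unfolding A_def[symmetric] by (simp add: pos_le_divide_eq mult.commute)
qed

text \<open>The factor \<open>exp (t / 2)\<close> matches the decay of
  \<open>exp (- S * s K)\<close> over one step exactly. What is lost beyond it is of second order in
  \<open>t\<close>, as is needed for a bound applied along about 2^n faces in a row.\<close>

lemma harmonic_bounds:
  fixes x y t :: real
  assumes "0 < x" "0 < y" "y \<le> x * exp t" "x \<le> y * exp t" "0 \<le> t"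
  shows "2 * inverse (inverse x + inverse y) \<le> x * exp (t / 2)"
    and "x * exp (- (t / 2)) * (1 - t\<^sup>2) \<le> 2 * inverse (inverse x + inverse y)"
proof -
  define z where "z = exp (t / 2)"
  have z: "1 \<le> z" "exp t = z\<^sup>2" using assms(5) by (auto simp: z_def power2_eq_square simp flip: exp_add)
  have eq: "2 * inverse (inverse x + inverse y) = 2 * x * y / (x + y)"
    using assms by (simp add: field_simps)
  show "2 * inverse (inverse x + inverse y) \<le> x * exp (t / 2)"
  proof -
    have "y * (2 * z - 1) \<le> y * z\<^sup>2" using assms(2) sum_squares_bound[of 1 z] by (intro mult_left_mono) auto
    have "y * (2 - z) \<le> x * z"
    proof (cases "z \<le> 2")
      case True
      have "y * (2 - z) \<le> x * z\<^sup>2 * (2 - z)" using assms(3) z True by (intro mult_right_mono) auto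
      also have "\<dots> = x * z * (z * (2 - z))" by (simp add: power2_eq_square)
      also have "\<dots> \<le> x * z * 1"
        using assms(1) z sum_squares_bound[of 1 z] by (intro mult_left_mono) (auto simp: algebra_simps power2_eq_square)
      finally show ?thesis by simp
    next
      case False
      then have "y * (2 - z) \<le> 0" using assms(2) by (simp add: mult_nonneg_nonpos)
      also have "0 \<le> x * z" using assms(1) z by simp
      finally show ?thesis .
    qed
    then have "2 * y \<le> z * (x + y)" by (simp add: algebra_simps)
    then have "x * (2 * y) \<le> x * (z * (x + y))" using assms(1) by (intro mult_left_mono) auto
    then show ?thesis using assms(1,2) unfolding eq by (simp add: pos_divide_le_eq mult_ac z_def[symmetric])
  qed
  have zi: "exp (- (t / 2)) = 1 / z" by (simp add: z_def exp_minus inverse_eq_divide)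
  \<comment> \<open>The goal reduces to
    \<open>(1 + z\<^sup>2) * (1 - t\<^sup>2) \<le> 2 * z\<close>, that is,
    \<open>(z - 1)\<^sup>2 \<le> (1 + z\<^sup>2) * t\<^sup>2\<close>.\<close>
  have "1 - t / 2 \<le> 1 / z" using exp_ge_add_one_self[of "- (t / 2)"] zi by simp
  then have "z - 1 \<le> z * (t / 2)" using z by (simp add: field_simps)
  then have "(z - 1)\<^sup>2 \<le> (z * (t / 2))\<^sup>2" using z by (intro power_mono) auto
  also have "\<dots> \<le> z\<^sup>2 * t\<^sup>2" by (simp add: power_mult_distrib power_divide)
  also have "\<dots> \<le> (1 + z\<^sup>2) * t\<^sup>2" by (simp add: distrib_right)
  finally have "(1 + z\<^sup>2) * (1 - t\<^sup>2) \<le> 2 * z" by (simp add: power2_eq_square algebra_simps)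
  then have "x * y * ((1 + z\<^sup>2) * (1 - t\<^sup>2)) \<le> x * y * (2 * z)" using assms by (intro mult_left_mono) auto
  moreover have "x * (x + y) * (1 - t\<^sup>2) \<le> x * (y * z\<^sup>2 + y) * (1 - t\<^sup>2)" if "t\<^sup>2 \<le> 1"
    using assms(1,4) z(2) that by (intro mult_right_mono mult_left_mono) auto
  moreover have "x * (x + y) * (1 - t\<^sup>2) \<le> 2 * x * y * z" if "\<not> t\<^sup>2 \<le> 1"
  proof -
    have "x * (x + y) * (1 - t\<^sup>2) \<le> 0" using assms that by (intro mult_nonneg_nonpos) auto
    also have "0 \<le> 2 * x * y * z" using assms z by simp
    finally show ?thesis .
  qed
  ultimately have "x * (x + y) * (1 - t\<^sup>2) \<le> 2 * x * y * z" by (cases "t\<^sup>2 \<le> 1") (auto simp: algebra_simps)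
  then show "x * exp (- (t / 2)) * (1 - t\<^sup>2) \<le> 2 * inverse (inverse x + inverse y)"
    using assms z unfolding eq zi by (simp add: field_simps)
qed

text \<open>Between different levels a first-order loss is acceptable: such faces lie on block
  sides, where \<open>\<eta>\<close> pays for it.\<close>

lemma weighted_harmonic_bounds:
  fixes x y t :: real
  assumes "0 < x" "0 < y" "y \<le> x * exp t" "x \<le> y * exp t" "0 \<le> t"
  shows "2 * inverse (inverse x + 2 * inverse y) \<le> 2 / 3 * x * exp t"
    and "2 / 3 * x * exp (- t) \<le> 2 * inverse (inverse x + 2 * inverse y)"
    and "2 * inverse (inverse y + 2 * inverse x) \<le> 2 / 3 * x * exp t"
    and "2 / 3 * x * exp (- t) \<le> 2 * inverse (inverse y + 2 * inverse x)"
proof -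
  have t: "1 \<le> exp t" using assms(5) by simp
  have yx: "inverse y \<le> inverse x * exp t" "inverse x \<le> inverse y * exp t" "inverse x \<le> inverse x * exp t"
    using assms t by (auto simp: field_simps)
  have i: "0 < inverse x" "0 < inverse y" using assms by auto
  have lo: "inverse (3 * inverse x * exp t) \<le> inverse v" if "0 < v" "v \<le> 3 * inverse x * exp t" for v
    using that by (intro le_imp_inverse_le) auto
  have hi: "inverse v \<le> x / 3 * exp t" if "0 < v" "3 * inverse x * exp (- t) \<le> v" for v
  proof -
    have "inverse v \<le> inverse (3 * inverse x * exp (- t))"
      using that assms(1) by (intro le_imp_inverse_le) auto
    then show ?thesis using assms(1) by (simp add: exp_minus field_simps)
  qed
  have "inverse x * exp (- t) \<le> inverse y" "inverse x * exp (- t) \<le> inverse x"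
    using yx i t by (auto simp: exp_minus field_simps)
  then have up: "inverse (inverse x + 2 * inverse y) \<le> x / 3 * exp t" "inverse (inverse y + 2 * inverse x) \<le> x / 3 * exp t"
    using i by - (rule hi; linarith)+
  then show "2 * inverse (inverse x + 2 * inverse y) \<le> 2 / 3 * x * exp t"
    "2 * inverse (inverse y + 2 * inverse x) \<le> 2 / 3 * x * exp t" by auto
  have "inverse (3 * inverse x * exp t) = x / 3 * exp (- t)" using assms by (simp add: exp_minus field_simps)
  then show "2 / 3 * x * exp (- t) \<le> 2 * inverse (inverse x + 2 * inverse y)"
    "2 / 3 * x * exp (- t) \<le> 2 * inverse (inverse y + 2 * inverse x)"
    using lo[of "inverse x + 2 * inverse y"] lo[of "inverse y + 2 * inverse x"] i yx by auto
qed

section \<open>Oscillation of the coefficient, and edges on the boundary of the domain\<close>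

lemma sup_grad_upper:
  assumes C1: "C1_on (square_domain a) \<sigma> \<sigma>'" and pos: "\<forall>x\<in>square_domain a. 0 < \<sigma> x" and x: "x \<in> square_domain a"
  shows "(\<bar>fst (\<sigma>' x)\<bar> + \<bar>snd (\<sigma>' x)\<bar>) / \<sigma> x \<le> sup_grad (square_domain a) \<sigma> \<sigma>'"
proof -
  let ?f = "\<lambda>x. (\<bar>fst (\<sigma>' x)\<bar> + \<bar>snd (\<sigma>' x)\<bar>) / \<sigma> x"
  have "continuous_on (square_domain a) \<sigma>"
    by (rule has_derivative_continuous_on[where f' = "\<lambda>x v. \<sigma>' x \<bullet> v"]) (use C1 in \<open>simp add: C1_on_def\<close>)
  moreover have "continuous_on (square_domain a) \<sigma>'" using C1 by (simp add: C1_on_def)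
  ultimately have "continuous_on (square_domain a) ?f"
    using pos by (intro continuous_intros) auto
  moreover have "compact (square_domain a)" by (simp add: square_domain_def compact_Times)
  ultimately have "bdd_above (?f ` square_domain a)"
    by (intro bounded_imp_bdd_above compact_imp_bounded compact_continuous_image)
  then show ?thesis unfolding sup_grad_def using x by (intro cSUP_upper)
qed

text \<open>Mean value theorem for the logarithm of \<open>\<sigma>\<close> on a segment of the
  convex square. The l1 norm of the gradient is dual to the maximum norm of the displacement, so
  \<open>M\<close> bounds each coordinate and not their sum.\<close>

lemma coefficient_ratio:
  assumes C1: "C1_on (square_domain a) \<sigma> \<sigma>'" and pos: "\<forall>x\<in>square_domain a. 0 < \<sigma> x"
    and p: "p \<in> square_domain a" and q: "q \<in> square_domain a"
    and M: "\<bar>fst p - fst q\<bar> \<le> M" "\<bar>snd p - snd q\<bar> \<le> M"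
  shows "\<sigma> p \<le> \<sigma> q * exp (sup_grad (square_domain a) \<sigma> \<sigma>' * M)"
proof -
  let ?S = "square_domain a"
  define \<gamma> where "\<gamma> t = q + t *\<^sub>R (p - q)" for t :: real
  have cv: "convex ?S" by (simp add: square_domain_def convex_Times)
  have \<gamma>: "\<gamma> t \<in> ?S" if "t \<in> {0..1}" for t
  proof -
    have "\<gamma> t = (1 - t) *\<^sub>R q + t *\<^sub>R p" by (simp add: \<gamma>_def algebra_simps)
    then show ?thesis using convexD[OF cv q p, of "1 - t" t] that by simp
  qed
  have d\<gamma>: "(\<gamma> has_derivative (\<lambda>t. t *\<^sub>R (p - q))) (at t within {0..1})" for t
    unfolding \<gamma>_def by (auto intro!: derivative_eq_intros)
  have der: "((\<lambda>t. ln (\<sigma> (\<gamma> t))) has_derivative (\<lambda>v. (\<sigma>' (\<gamma> t) \<bullet> (v *\<^sub>R (p - q))) * inverse (\<sigma> (\<gamma> t)))) (at t within {0..1})"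
    if "0 \<le> t" "t \<le> 1" for t
  proof -
    have t: "\<gamma> t \<in> ?S" using \<gamma> that by simp
    have "(\<sigma> has_derivative (\<lambda>v. \<sigma>' (\<gamma> t) \<bullet> v)) (at (\<gamma> t) within ?S)"
      using C1 t by (simp add: C1_on_def)
    then have "(\<sigma> has_derivative (\<lambda>v. \<sigma>' (\<gamma> t) \<bullet> v)) (at (\<gamma> t) within \<gamma> ` {0..1})"
      by (rule has_derivative_subset) (use \<gamma> in auto)
    from diff_chain_within[OF d\<gamma> this]
    have "((\<lambda>t. \<sigma> (\<gamma> t)) has_derivative (\<lambda>v. \<sigma>' (\<gamma> t) \<bullet> (v *\<^sub>R (p - q)))) (at t within {0..1})"
      by (simp add: o_def)
    from has_derivative_ln[OF _ this] show ?thesis using pos t by blast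
  qed
  have "\<exists>t\<in>{0..1}. ln (\<sigma> (\<gamma> 1)) - ln (\<sigma> (\<gamma> 0)) = (\<sigma>' (\<gamma> t) \<bullet> ((1 - 0) *\<^sub>R (p - q))) * inverse (\<sigma> (\<gamma> t))"
    by (rule mvt_very_simple) (use der in auto)
  then obtain t where t: "t \<in> {0..1}" "ln (\<sigma> p) - ln (\<sigma> q) = (\<sigma>' (\<gamma> t) \<bullet> (p - q)) / \<sigma> (\<gamma> t)"
    by (auto simp: \<gamma>_def divide_inverse)
  have M0: "0 \<le> M" using M(1) by linarith
  have "\<sigma>' (\<gamma> t) \<bullet> (p - q) \<le> \<bar>fst (\<sigma>' (\<gamma> t))\<bar> * \<bar>fst p - fst q\<bar> + \<bar>snd (\<sigma>' (\<gamma> t))\<bar> * \<bar>snd p - snd q\<bar>"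
    by (simp add: inner_prod_def abs_mult[symmetric] add_mono)
  also have "\<dots> \<le> (\<bar>fst (\<sigma>' (\<gamma> t))\<bar> + \<bar>snd (\<sigma>' (\<gamma> t))\<bar>) * M"
    using M by (simp add: distrib_right add_mono mult_left_mono)
  finally have "ln (\<sigma> p) - ln (\<sigma> q) \<le> (\<bar>fst (\<sigma>' (\<gamma> t))\<bar> + \<bar>snd (\<sigma>' (\<gamma> t))\<bar>) / \<sigma> (\<gamma> t) * M"
    using t pos \<gamma>[OF t(1)] by (simp add: divide_right_mono less_imp_le)
  also have "\<dots> \<le> sup_grad ?S \<sigma> \<sigma>' * M"
    using sup_grad_upper[OF C1 pos \<gamma>[OF t(1)]] M0 by (intro mult_right_mono)
  finally have "ln (\<sigma> p) \<le> ln (\<sigma> q) + sup_grad ?S \<sigma> \<sigma>' * M" by simp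
  then have "exp (ln (\<sigma> p)) \<le> exp (ln (\<sigma> q) + sup_grad ?S \<sigma> \<sigma>' * M)" by simp
  then show ?thesis using pos p q by (simp add: exp_add)
qed

lemma sup_grad_nonneg:
  assumes "C1_on (square_domain a) \<sigma> \<sigma>'" "\<forall>x\<in>square_domain a. 0 < \<sigma> x" "0 \<le> a"
  shows "0 \<le> sup_grad (square_domain a) \<sigma> \<sigma>'"
proof -
  have x: "(0, 0) \<in> square_domain a" using assms(3) by (simp add: square_domain_def)
  have "0 \<le> (\<bar>fst (\<sigma>' (0, 0))\<bar> + \<bar>snd (\<sigma>' (0, 0))\<bar>) / \<sigma> (0, 0)"
    using assms(2) x less_imp_le by (intro divide_nonneg_nonneg) auto
  then show ?thesis using sup_grad_upper[OF assms(1,2) x] by linarith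
qed

lemma boundary_edges_pos:
  assumes h: "0 < h" and K: "xpos K = 0 \<or> ypos K = 0" and top: "right_x h K \<le> a" "top_y h K \<le> a"
  shows "1 \<le> boundary_edges a h K"
proof -
  have nn: "0 \<le> left_x h K" "0 \<le> bottom_y h K" "left_x h K < right_x h K" "bottom_y h K < top_y h K"
    using h by (auto simp: left_x_def bottom_y_def right_x_def top_y_def edge_len_def divide_strict_right_mono)
  have fr: "frontier (square_domain a) = {0..a} \<times> {0..a} - {0<..<a} \<times> {0<..<a}"
    unfolding square_domain_def frontier_def interior_Times
    by (simp add: closure_Times)
  have "\<exists>s\<in>edges h K. s \<subseteq> frontier (square_domain a)"
  proof (cases "xpos K = 0")
    case True
    then have "{left_x h K} \<times> {bottom_y h K..top_y h K} \<subseteq> frontier (square_domain a)"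
      unfolding fr using nn top by (auto simp: left_x_def)
    then show ?thesis by (auto simp: edges_def)
  next
    case False
    then have "{left_x h K..right_x h K} \<times> {bottom_y h K} \<subseteq> frontier (square_domain a)"
      unfolding fr using nn top K by (auto simp: bottom_y_def)
    then show ?thesis by (auto simp: edges_def)
  qed
  moreover have "finite {s \<in> edges h K. s \<subseteq> frontier (square_domain a)}" by (simp add: edges_def)
  ultimately have "0 < card {s \<in> edges h K. s \<subseteq> frontier (square_domain a)}" by (auto simp: card_gt_0_iff)
  then show ?thesis by (simp add: boundary_edges_def)
qed

section \<open>Fluxes through the sides of a cell\<close>

text \<open>Row \<open>j\<close> of a block meets row \<open>r\<close> of a block across a vertical side (rows counted from 0): equal levels,
  lower and upper half of a coarser block, finer block.\<close>

definition rows_meet :: "nat \<Rightarrow> nat \<Rightarrow> nat \<Rightarrow> bool" where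
  "rows_meet q j r \<longleftrightarrow> r = j \<or> r = j div 2 \<or> r = (q + j) div 2 \<or> (\<exists>\<tau><2. r = (2 * j + \<tau>) mod q)"

text \<open>\<open>\<psi> i j\<close> is the factor by which a subsolution falls short of the equilibrium in the cell \<open>(i, j)\<close> of a block,
  with \<open>i, j\<close> counted from 1; the index 0 stands for what enters from the western or southern neighbour. The
  coupling condition says that this is covered by the outflow of that neighbour, \<open>\<beta>\<close> and \<open>\<gamma>\<close> being the northern
  weights of the two cells.\<close>

locale flow = mesh N n h Q R for N n h Q R +
  fixes \<sigma> :: "real \<times> real \<Rightarrow> real" and S \<delta> \<eta> \<theta> :: real and m :: "cell \<Rightarrow> real" and \<psi> :: "nat \<Rightarrow> nat \<Rightarrow> real"
  assumes pos: "K \<in> R \<Longrightarrow> 0 < coeff_at h \<sigma> K"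
    and ratio: "K \<in> R \<Longrightarrow> D \<in> R \<Longrightarrow> east K D \<or> east D K \<or> north K D \<or> north D K \<Longrightarrow>
      coeff_at h \<sigma> D \<le> coeff_at h \<sigma> K * exp (S * ((edge_len h K + edge_len h D) / 2))"
    and S0: "0 \<le> S" and \<delta>0: "0 < \<delta>" and \<eta>01: "0 \<le> \<eta>" "\<eta> < 1" and \<theta>0: "0 \<le> \<theta>"
    and m_pos: "B \<in> Q \<Longrightarrow> 0 < m B" and m_le: "B \<in> Q \<Longrightarrow> m B \<le> 9 / 10"
    and m_step: "C \<in> Q \<Longrightarrow> B \<in> Q \<Longrightarrow> east C B \<or> north C B \<Longrightarrow> m B \<le> \<theta> * m C"
    and \<psi>_le: "\<psi> i j \<le> 1" and \<psi>_sym: "\<psi> i j = \<psi> j i"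
    and coupling: "j < 2 ^ n \<Longrightarrow> r < 2 ^ n \<Longrightarrow> rows_meet (2 ^ n) j r \<Longrightarrow>
      \<beta> \<in> {1, 2 / 3, 4 / 3} \<Longrightarrow> \<gamma> \<in> {1, 2 / 3, 4 / 3} \<Longrightarrow> (Suc j \<noteq> 2 ^ n \<Longrightarrow> \<beta> = 1) \<Longrightarrow> (Suc r \<noteq> 2 ^ n \<Longrightarrow> \<gamma> = 1) \<Longrightarrow>
      \<theta> * \<psi> 0 (Suc j) / \<beta> \<le> (1 - \<eta>) * max (\<psi> (2 ^ n) (Suc r)) 0 / \<gamma>"
    and small2: "1 - \<eta> \<le> exp (- (5 / 2 * (S * (h / 2 ^ n)))) * (1 - h / 2 ^ n / \<delta>)"
    and small5: "S * (h / 2 ^ n) \<le> 1"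
begin

abbreviation "q \<equiv> (2::nat) ^ n"
abbreviation "len \<equiv> edge_len h"
abbreviation "cf \<equiv> coeff_at h \<sigma>"
abbreviation "w \<equiv> face_wt h \<sigma>"

definition ix :: "cell \<Rightarrow> nat" where "ix K = Suc (xpos K mod q)"
definition iy :: "cell \<Rightarrow> nat" where "iy K = Suc (ypos K mod q)"
definition bN :: "cell \<Rightarrow> real" where "bN K = east_wt (swp ` R) (swp K)"
definition s :: "cell \<Rightarrow> real" where "s K = right_x h K + top_y h K"
text \<open>What an equal-sized western or southern neighbour delivers per unit of
  \<open>cf K\<close>, apart from block factor, profile and transversal weight: its \<open>s\<close>
  is smaller by \<open>len K\<close>, and the face weight is replaced by its lower bound from
  \<open>harmonic_bounds\<close>.\<close>

definition Z :: "cell \<Rightarrow> real" where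
  "Z K = len K * exp (- S * s K) * exp (S * len K / 2) * (1 - (S * len K)\<^sup>2) / (s K - len K + \<delta>)"
definition u :: "cell \<Rightarrow> real" where
  "u K = m (blk n K) * (len K * exp (- S * s K) / (s K + \<delta>)) * \<psi> (ix K) (iy K) / (east_wt R K * bN K)"

lemma len_pos: "0 < len K"
  using h by (simp add: edge_len_def)

lemma len_le: "K \<in> R \<Longrightarrow> len K \<le> h / 2 ^ n"
  using h blk_in(2)[of K] by (auto simp: edge_len_def intro!: divide_left_mono power_increasing)

lemma s_ge: "2 * len K \<le> s K"
  using len_pos[of K] by (simp add: s_def right_x_def top_y_def distrib_right)

lemma Z_nonneg: "K \<in> R \<Longrightarrow> 0 \<le> Z K"
proof -
  assume K: "K \<in> R"
  have "S * len K \<le> S * (h / 2 ^ n)" using S0 len_le[OF K] by (intro mult_left_mono)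
  then have "(S * len K)\<^sup>2 \<le> 1\<^sup>2" using S0 len_pos[of K] order_trans[OF _ small5] by (intro power_mono) auto
  then show ?thesis unfolding Z_def using len_pos[of K] s_ge[of K] \<delta>0 by (intro divide_nonneg_nonneg mult_nonneg_nonneg) auto
qed

lemma bN_values: "bN K \<in> {1, 2 / 3, 4 / 3}"
  by (simp add: bN_def east_wt_def)

lemma bN_cong:
  assumes "level K = level D" "ypos K = ypos D" "xpos K div q = xpos D div q" "n \<le> level K"
  shows "bN K = bN D"
proof -
  interpret sw: mesh N n h "swp ` Q" "swp ` R" by (rule mesh_swp)
  show ?thesis unfolding bN_def by (rule sw.east_wt_cong) (use assms in auto)
qed

lemma bN_inner: "K \<in> R \<Longrightarrow> Suc (ypos K mod q) \<noteq> q \<Longrightarrow> bN K = 1"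
proof -
  interpret sw: mesh N n h "swp ` Q" "swp ` R" by (rule mesh_swp)
  show "K \<in> R \<Longrightarrow> Suc (ypos K mod q) \<noteq> q \<Longrightarrow> bN K = 1"
    unfolding bN_def by (rule sw.east_wt_inner) auto
qed

lemma w_pos: "K \<in> R \<Longrightarrow> D \<in> R \<Longrightarrow> 0 < w K D"
  using pos face_wt_pos by simp

lemma w_same:
  assumes "K \<in> R" "D \<in> R" "east K D \<or> east D K" "level K = level D"
  shows "w K D \<le> cf K * exp (S * len K / 2)"
    and "cf K * exp (- (S * len K / 2)) * (1 - (S * len K)\<^sup>2) \<le> w K D"
proof -
  have e: "len D = len K" using assms(4) by (simp add: edge_len_def)
  have c: "cf D \<le> cf K * exp (S * len K)" "cf K \<le> cf D * exp (S * len K)"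
    using ratio[OF assms(1,2)] ratio[OF assms(2,1)] assms(3) e by auto
  have t: "0 \<le> S * len K" using S0 len_pos[of K] by simp
  show "w K D \<le> cf K * exp (S * len K / 2)" "cf K * exp (- (S * len K / 2)) * (1 - (S * len K)\<^sup>2) \<le> w K D"
    using harmonic_bounds[OF pos[OF assms(1)] pos[OF assms(2)] c t] assms(4) by (simp_all add: face_wt_def)
qed

lemma w_cross:
  assumes "K \<in> R" "D \<in> R" "east K D \<or> east D K" "level K = Suc (level D) \<or> level D = Suc (level K)"
  shows "w K D \<le> 2 / 3 * cf K * exp (2 * (S * len K))"
    and "2 / 3 * cf K * exp (- (2 * (S * len K))) \<le> w K D"
proof -
  have e: "(len K + len D) / 2 \<le> 2 * len K"
    using assms(4) h by (auto simp: edge_len_def field_simps)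
  have le: "exp (S * ((len K + len D) / 2)) \<le> exp (2 * (S * len K))"
    using mult_left_mono[OF e S0] by simp
  have c: "cf D \<le> cf K * exp (2 * (S * len K))" "cf K \<le> cf D * exp (2 * (S * len K))"
    using ratio[OF assms(1,2)] ratio[OF assms(2,1)] assms(3) le pos[OF assms(1)] pos[OF assms(2)]
    by (smt (verit) add.commute mult_left_mono)+
  have t: "0 \<le> 2 * (S * len K)" using S0 len_pos[of K] by simp
  show "w K D \<le> 2 / 3 * cf K * exp (2 * (S * len K))" "2 / 3 * cf K * exp (- (2 * (S * len K))) \<le> w K D"
    using weighted_harmonic_bounds[OF pos[OF assms(1)] pos[OF assms(2)] c t] assms(4) by (auto simp: face_wt_def)
qed

text \<open>The second bound has the exponent that also occurs in \<open>Z\<close>, so that both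
  cancel in the bulk. The first has four times this exponent and serves in the last row and column
  of a block, where \<open>\<eta>\<close> gives room.\<close>

lemma east_outflow:
  assumes K: "K \<in> R"
  shows "(\<Sum>D\<in>{D \<in> R. east K D}. w K D) \<le> cf K * east_wt R K * exp (2 * (S * len K))"
    and "east_pos K \<in> R \<Longrightarrow> (\<Sum>D\<in>{D \<in> R. east K D}. w K D) \<le> cf K * exp (S * len K / 2)"
proof -
  obtain l x y where Kc: "K = Cell l x y" by (cases K)
  let ?X = "{D \<in> R. east K D}"
  note sub = east_nbrs[OF K Kc]
  have p: "0 < cf K" using pos[OF K] .
  have t: "0 \<le> S * len K" using S0 len_pos[of K] by simp
  have bd: "(\<Sum>D\<in>?X. w K D) \<le> real c * b" if "?X \<subseteq> F" "finite F" "card F \<le> c" "0 \<le> b" "\<And>D. D \<in> ?X \<Longrightarrow> w K D \<le> b" for F c b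
  proof -
    have "(\<Sum>D\<in>?X. w K D) \<le> real (card ?X) * b" using that(5) by (intro sum_bounded_above)
    also have "\<dots> \<le> real c * b" using card_mono[OF that(2,1)] that(3,4) by (intro mult_right_mono) auto
    finally show ?thesis .
  qed
  show 1: "(\<Sum>D\<in>?X. w K D) \<le> cf K * exp (S * len K / 2)" if e: "east_pos K \<in> R"
  proof -
    have "?X \<subseteq> {east_pos K}" using sub e by simp
    moreover from this have "w K D \<le> cf K * exp (S * len K / 2)" if "D \<in> ?X" for D
      using that w_same(1)[OF K, of D] by (auto simp: east_pos_def)
    ultimately show ?thesis using bd[of "{east_pos K}" 1] p by simp
  qed
  show "(\<Sum>D\<in>?X. w K D) \<le> cf K * east_wt R K * exp (2 * (S * len K))"
  proof (cases "east_pos K \<in> R")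
    case True
    have "cf K * exp (S * len K / 2) \<le> cf K * exp (2 * (S * len K))"
      using p t by simp
    then show ?thesis using 1[OF True] True by (simp add: east_wt_def)
  next
    case nR: False
    let ?P = "anc (level K - 1) (east_pos K)"
    show ?thesis
    proof (cases "0 < level K \<and> ?P \<in> R")
      case True
      then have "?X \<subseteq> {?P}" using sub nR by simp
      moreover from this have "w K D \<le> 2 / 3 * cf K * exp (2 * (S * len K))" if "D \<in> ?X" for D
        using that w_cross(1)[OF K, of D] True by auto
      ultimately show ?thesis using bd[of "{?P}" 1 "2 / 3 * cf K * exp (2 * (S * len K))"] p nR True by (simp add: east_wt_def)
    next
      case False
      let ?F = "{Cell (l + 1) (2 * (x + 1)) (2 * y), Cell (l + 1) (2 * (x + 1)) (2 * y + 1)}"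
      have X: "?X \<subseteq> ?F" using sub nR False by (simp only: if_False)
      then have "w K D \<le> 2 / 3 * cf K * exp (2 * (S * len K))" if "D \<in> ?X" for D
        using that w_cross(1)[OF K, of D] Kc by force
      then have b: "(\<Sum>D\<in>?X. w K D) \<le> real 2 * (2 / 3 * cf K * exp (2 * (S * len K)))"
        using p by (intro bd[OF X]) auto
      have e: "east_wt R K = 4 / 3" unfolding east_wt_def using nR False by (simp only: if_False)
      show ?thesis unfolding e using b by simp
    qed
  qed
qed

lemma s_pos: "0 < s K - len K + \<delta>" "0 < s K + \<delta>"
  using s_ge[of K] len_pos[of K] \<delta>0 by auto

text \<open>Across a level jump only \<open>s D \<le> s K\<close> is available for the neighbour
  \<open>D\<close>, so the gain from \<open>s K - len K\<close> is given up; the factor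
  \<open>exp (- (2 * (S * len K)))\<close> prepares for the loss in \<open>w_cross\<close>. Together
  with the half step contained in \<open>Z\<close> this makes the 5 / 2 in \<open>small2\<close>,
  and \<open>1 - \<eta>\<close> pays.\<close>

lemma Z_le:
  assumes K: "K \<in> R"
  shows "(1 - \<eta>) * Z K \<le> len K * exp (- S * s K) * exp (- (2 * (S * len K))) / (s K + \<delta>)"
proof -
  let ?H = "len K" and ?G = "h / 2 ^ n" and ?s = "s K"
  have le: "?H \<le> ?G" "S * ?H \<le> S * ?G" using len_le[OF K] mult_left_mono[OF len_le[OF K] S0] by auto
  have "1 - \<eta> \<le> exp (- (5 / 2 * (S * ?G))) * (1 - ?G / \<delta>)" by (rule small2)
  also have "\<dots> \<le> exp (- (5 / 2 * (S * ?H))) * (1 - ?H / (?s + \<delta>))"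
  proof (rule mult_mono)
    have "?H / (?s + \<delta>) \<le> ?G / \<delta>" using le len_pos[of K] \<delta>0 s_ge[of K] h by (intro frac_le) auto
    then show "1 - ?G / \<delta> \<le> 1 - ?H / (?s + \<delta>)" by simp
    show "0 \<le> 1 - ?G / \<delta>"
    proof (rule ccontr)
      assume "\<not> ?thesis"
      then have "exp (- (5 / 2 * (S * ?G))) * (1 - ?G / \<delta>) < 0" by (simp add: mult_pos_neg)
      then show False using small2 \<eta>01 by linarith
    qed
  qed (use le in auto)
  also have "1 - ?H / (?s + \<delta>) = (?s - ?H + \<delta>) / (?s + \<delta>)" using s_pos[of K] by (simp add: field_simps)
  finally have "(1 - \<eta>) * (1 / (?s - ?H + \<delta>)) \<le> exp (- (5 / 2 * (S * ?H))) * ((?s - ?H + \<delta>) / (?s + \<delta>)) * (1 / (?s - ?H + \<delta>))"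
    using s_pos[of K] by (intro mult_right_mono) auto
  also have "\<dots> = exp (- (5 / 2 * (S * ?H))) / (?s + \<delta>)" using s_pos[of K] by simp
  finally have 1: "(1 - \<eta>) / (?s - ?H + \<delta>) \<le> exp (- (5 / 2 * (S * ?H))) / (?s + \<delta>)" by simp
  have "(1 - \<eta>) * Z K = ?H * exp (- S * ?s) * exp (S * ?H / 2) * (1 - (S * ?H)\<^sup>2) * ((1 - \<eta>) / (?s - ?H + \<delta>))"
    by (simp add: Z_def)
  also have "\<dots> \<le> ?H * exp (- S * ?s) * exp (S * ?H / 2) * 1 * ((1 - \<eta>) / (?s - ?H + \<delta>))"
    using len_pos[of K] s_pos[of K] \<eta>01 by (intro mult_right_mono mult_left_mono) auto
  also have "\<dots> \<le> ?H * exp (- S * ?s) * exp (S * ?H / 2) * 1 * (exp (- (5 / 2 * (S * ?H))) / (?s + \<delta>))"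
    using 1 len_pos[of K] by (intro mult_left_mono) auto
  also have "\<dots> = ?H * exp (- S * ?s) * (exp (S * ?H / 2) * exp (- (5 / 2 * (S * ?H)))) / (?s + \<delta>)" by simp
  also have "exp (S * ?H / 2) * exp (- (5 / 2 * (S * ?H))) = exp (- (2 * (S * ?H)))"
    by (simp flip: exp_add add: field_simps)
  finally show ?thesis .
qed

lemma decay_mono:
  assumes "s D \<le> s K"
  shows "exp (- S * s K) / (s K + \<delta>) \<le> exp (- S * s D) / (s D + \<delta>)"
  using assms S0 s_pos(2)[of D] by (intro frac_le) (auto intro: mult_left_mono)

text \<open>Passage from one block to the next: \<open>coupling\<close> trades the profiles and
  northern weights of the two sides, and \<open>m_step\<close> trades the block factors.
  \<open>c\<close> is the share of the side that faces \<open>D\<close>, namely 1, or 1 / 2 for each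
  of two finer neighbours.\<close>

lemma inflow_term:
  assumes K: "K \<in> R" and D: "D \<in> R" and "ix D = q" "rows_meet q (ypos K mod q) (ypos D mod q)"
    and e: "east (blk n D) (blk n K)" and c: "0 \<le> c"
    and wD: "c * (1 - \<eta>) * cf K * Z K \<le> w K D * (len D * exp (- S * s D) / (s D + \<delta>) / east_wt R D)"
  shows "c * (cf K * Z K * m (blk n K) * \<psi> 0 (iy K) / bN K) \<le> w K D * max (u D) 0"
proof (cases "0 < \<psi> 0 (iy K)")
  case True
  let ?M = "max (\<psi> q (iy D)) 0"
  have cp: "\<theta> * \<psi> 0 (iy K) / bN K \<le> (1 - \<eta>) * ?M / bN D"
    unfolding iy_def by (rule coupling) (use assms(4) bN_values bN_inner K D in auto)
  have mD: "0 < m (blk n D)" "0 < m (blk n K)" "m (blk n K) \<le> \<theta> * m (blk n D)"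
    using m_pos m_step e blk_in(1) K D by blast+
  have b: "0 < bN K" "0 < bN D" "0 < east_wt R D" using bN_values[of K] bN_values[of D] by (auto simp: east_wt_def)
  have Zc: "0 \<le> c * (cf K * Z K)" using c pos[OF K] Z_nonneg[OF K] by simp
  have "c * (cf K * Z K * m (blk n K) * \<psi> 0 (iy K) / bN K) = c * (cf K * Z K) * (m (blk n K) * (\<psi> 0 (iy K) / bN K))"
    by simp
  also have "\<dots> \<le> c * (cf K * Z K) * (\<theta> * m (blk n D) * (\<psi> 0 (iy K) / bN K))"
    using Zc mD True b by (intro mult_left_mono mult_right_mono) auto
  also have "\<dots> = c * (cf K * Z K) * m (blk n D) * (\<theta> * \<psi> 0 (iy K) / bN K)" by simp
  also have "\<dots> \<le> c * (cf K * Z K) * m (blk n D) * ((1 - \<eta>) * ?M / bN D)"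
    using mult_nonneg_nonneg[OF Zc less_imp_le[OF mD(1)]] cp by (rule mult_left_mono[rotated])
  also have "\<dots> = (c * (1 - \<eta>) * cf K * Z K) * (m (blk n D) * ?M / bN D)" by simp
  also have "\<dots> \<le> (w K D * (len D * exp (- S * s D) / (s D + \<delta>) / east_wt R D)) * (m (blk n D) * ?M / bN D)"
    using wD mD b by (intro mult_right_mono) auto
  also have "\<dots> = w K D * (m (blk n D) * (len D * exp (- S * s D) / (s D + \<delta>)) / (east_wt R D * bN D) * ?M)"
    by (simp add: field_simps)
  also have "m (blk n D) * (len D * exp (- S * s D) / (s D + \<delta>)) / (east_wt R D * bN D) * ?M = max (u D) 0"
  proof -
    have "0 \<le> m (blk n D) * (len D * exp (- S * s D) / (s D + \<delta>)) / (east_wt R D * bN D)" (is "0 \<le> ?k")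
      using mD b len_pos[of D] s_pos[of D] by (intro divide_nonneg_nonneg mult_nonneg_nonneg) auto
    then have "?k * ?M = max (?k * \<psi> q (iy D)) 0" by (simp only: max_mult_distrib_left if_True mult_zero_right)
    then show ?thesis by (simp add: u_def assms(3))
  qed
  finally show ?thesis .
next
  case False
  have "0 < bN K" using bN_values[of K] by auto
  then have "c * (cf K * Z K * m (blk n K) * \<psi> 0 (iy K) / bN K) \<le> 0"
    using False c pos[OF K] Z_nonneg[OF K] m_pos[OF blk_in(1)[OF K]]
    by (intro mult_nonneg_nonpos divide_nonpos_pos) auto
  also have "0 \<le> w K D * max (u D) 0" using w_pos[OF K D] by simp
  finally show ?thesis .
qed

text \<open>At a level jump, face weight, edge length and total eastern weight of the neighbour
  balance. A coarser neighbour delivers at least 2/3 * 2 * 3/4 = 1, its eastern weight being at most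
  4 / 3; each of two finer ones delivers 2/3 * 1/2 * 3/2 = 1 / 2. This is why \<open>u\<close> is
  proportional to \<open>len K\<close> and divided by the outgoing weights.\<close>

lemma inflow_west:
  assumes K: "K \<in> R" and x: "0 < xpos K"
  shows "cf K * Z K * m (blk n K) * \<psi> (ix K - 1) (iy K) / bN K
    \<le> (\<Sum>D\<in>{D \<in> R. east D K}. w K D * max (u D) 0)"
proof -
  obtain l x y where Kc: "K = Cell l x y" by (cases K)
  let ?X = "{D \<in> R. east D K}"
  have fin: "finite ?X" using tiling_finite[OF tR] by simp
  have term0: "0 \<le> w K D * max (u D) 0" if "D \<in> ?X" for D
    using that w_pos[OF K, of D] by simp
  have one: "w K D * max (u D) 0 \<le> (\<Sum>D\<in>?X. w K D * max (u D) 0)" if "D \<in> ?X" for D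
    by (rule member_le_sum[OF that _ fin]) (use term0 in auto)
  have x0: "0 < x" using x Kc by simp
  have n: "n \<le> l" using blk_in(2)[OF K] Kc by simp
  have yq: "ypos K = y" "xpos K = x" "level K = l" using Kc by simp_all
  have q0: "0 < q" by simp
  show ?thesis
    using K Kc x0
  proof (cases rule: west_flow)
    case inner
    let ?D = "Cell l (x - 1) y"
    have eD: "east ?D K" using Kc x0 by (simp add: east_def)
    have i: "ix ?D = ix K - 1" "iy ?D = iy K"
      using inner(1) Kc x0 by (cases x; auto simp: ix_def iy_def mod_Suc split: if_splits)+
    have "\<not> q dvd x" using inner(1) by auto
    then have "(x - 1) div q = x div q" using sub_one_div x0 by simp
    then have b: "bN ?D = bN K" by (intro bN_cong) (use Kc n in auto)
    have a: "east_wt R ?D = 1" using K Kc x0 by (simp add: east_wt_def east_pos_def)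
    have l1: "len ?D = len K" using Kc by (simp add: edge_len_def)
    have "s ?D = s K - len K"
      unfolding s_def right_x_def top_y_def l1 using Kc x0 by (simp add: of_nat_diff algebra_simps)
    note l = l1 this
    have wl: "cf K * exp (- (S * len K / 2)) * (1 - (S * len K)\<^sup>2) \<le> w K ?D"
      by (rule w_same(2)[OF K inner(2)]) (use eD Kc in auto)
    have b0: "0 < bN K" using bN_values[of K] by auto
    show ?thesis
    proof (cases "0 < \<psi> (ix K - 1) (iy K)")
      case True
      have u: "u ?D = m (blk n K) * (len K * exp (- S * (s K - len K)) / (s K - len K + \<delta>)) * \<psi> (ix K - 1) (iy K) / bN K"
        using i b a l inner(3) by (simp add: u_def)
      have u0: "0 \<le> u ?D" unfolding u
        using True m_pos[OF blk_in(1)[OF K]] len_pos[of K] s_pos[of K] b0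
        by (intro divide_nonneg_nonneg mult_nonneg_nonneg) auto
      have ex: "exp (- (S * len K / 2)) * exp (- S * (s K - len K)) = exp (- S * s K) * exp (S * len K / 2)"
        by (simp flip: exp_add add: field_simps)
      have "cf K * Z K * m (blk n K) * \<psi> (ix K - 1) (iy K) / bN K
        = cf K * exp (- (S * len K / 2)) * (1 - (S * len K)\<^sup>2) * u ?D"
        unfolding u Z_def using ex by (simp add: mult_ac)
      also have "\<dots> \<le> w K ?D * u ?D" using wl u0 by (intro mult_right_mono)
      also have "\<dots> \<le> w K ?D * max (u ?D) 0" using w_pos[OF K inner(2)] by simp
      also have "\<dots> \<le> (\<Sum>D\<in>?X. w K D * max (u D) 0)" using one inner(2) eD by blast
      finally show ?thesis .
    next
      case False
      have "cf K * Z K * m (blk n K) * \<psi> (ix K - 1) (iy K) / bN K \<le> 0"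
        using False pos[OF K] Z_nonneg[OF K] m_pos[OF blk_in(1)[OF K]] b0
        by (intro divide_nonpos_pos mult_nonneg_nonpos) auto
      also have "0 \<le> (\<Sum>D\<in>?X. w K D * max (u D) 0)" using term0 by (intro sum_nonneg)
      finally show ?thesis .
    qed
  next
    case same
    let ?D = "Cell l (x - 1) y"
    have eD: "east ?D K" using Kc x0 by (simp add: east_def)
    have a: "east_wt R ?D = 1" using K Kc x0 by (simp add: east_wt_def east_pos_def)
    have l1: "len ?D = len K" using Kc by (simp add: edge_len_def)
    have "s ?D = s K - len K"
      unfolding s_def right_x_def top_y_def l1 using Kc x0 by (simp add: of_nat_diff algebra_simps)
    note l = l1 this
    have wl: "cf K * exp (- (S * len K / 2)) * (1 - (S * len K)\<^sup>2) \<le> w K ?D"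
      by (rule w_same(2)[OF K same(2)]) (use eD Kc in auto)
    have ex: "exp (- (S * len K / 2)) * exp (- S * (s K - len K)) = exp (- S * s K) * exp (S * len K / 2)"
      by (simp flip: exp_add add: field_simps)
    have "1 * (1 - \<eta>) * cf K * Z K \<le> 1 * cf K * Z K"
      using \<eta>01 pos[OF K] Z_nonneg[OF K] by (intro mult_right_mono) auto
    also have "\<dots> = cf K * exp (- (S * len K / 2)) * (1 - (S * len K)\<^sup>2) * (len K * exp (- S * (s K - len K)) / (s K - len K + \<delta>))"
      unfolding Z_def using ex by (simp add: mult_ac)
    also have "\<dots> \<le> w K ?D * (len K * exp (- S * (s K - len K)) / (s K - len K + \<delta>))"
      using wl len_pos[of K] s_pos[of K] by (intro mult_right_mono) auto
    also have "\<dots> = w K ?D * (len ?D * exp (- S * s ?D) / (s ?D + \<delta>) / east_wt R ?D)"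
      by (simp only: l a div_by_1)
    finally have "1 * (cf K * Z K * m (blk n K) * \<psi> 0 (iy K) / bN K) \<le> w K ?D * max (u ?D) 0"
      by (intro inflow_term K same) (use same Kc q0 in \<open>auto simp: ix_def rows_meet_def\<close>)
    moreover have "ix K - 1 = 0" using same(1) Kc by (simp add: ix_def)
    ultimately show ?thesis using one[of ?D] same(2) eD by simp
  next
    case coarse
    let ?D = "Cell (l - 1) (x div 2 - 1) (y div 2)"
    obtain x' where x': "x = 2 * x'" "0 < x'" using coarse(3) x0 by (auto elim: evenE)
    have eD: "east ?D K" using Kc x' coarse(2) div_overlap[of "l - 1" l "y div 2" y]
      by (cases l) (simp_all add: east_def)
    have l: "len ?D = 2 * len K"
      using Kc coarse(2) by (cases l) (simp_all add: edge_len_def)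
    have "s ?D \<le> s K"
    proof -
      have "right_x h ?D = right_x h K - len K"
        unfolding right_x_def l using Kc x' by (simp add: of_nat_diff algebra_simps)
      moreover have "real (y div 2) \<le> real y / 2" by linarith
      then have "(real (y div 2) + 1) * (2 * len K) \<le> (real y / 2 + 1) * (2 * len K)"
        using len_pos[of K] by (intro mult_right_mono) auto
      then have "top_y h ?D \<le> top_y h K + len K"
        unfolding top_y_def l using Kc by (simp add: algebra_simps)
      ultimately show ?thesis by (simp add: s_def)
    qed
    note dm = decay_mono[OF this]
    have wl: "2 / 3 * cf K * exp (- (2 * (S * len K))) \<le> w K ?D"
      by (rule w_cross(2)[OF K coarse(4)]) (use eD Kc coarse(2) in auto)
    have a: "3 / 4 \<le> 1 / east_wt R ?D" "0 < east_wt R ?D" by (simp_all add: east_wt_def)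
    have "1 * (1 - \<eta>) * cf K * Z K = cf K * ((1 - \<eta>) * Z K)" by simp
    also have "\<dots> \<le> cf K * (len K * exp (- S * s K) * exp (- (2 * (S * len K))) / (s K + \<delta>))"
      using Z_le[OF K] pos[OF K] by (intro mult_left_mono) auto
    also have "\<dots> = (2 / 3 * cf K * exp (- (2 * (S * len K)))) * (len ?D * (exp (- S * s K) / (s K + \<delta>)) * (3 / 4))"
      unfolding l using s_pos[of K] by (simp add: field_simps)
    also have "\<dots> \<le> w K ?D * (len ?D * (exp (- S * s ?D) / (s ?D + \<delta>)) * (1 / east_wt R ?D))"
      using wl dm a pos[OF K] w_pos[OF K coarse(4)] len_pos[of ?D] s_pos[of ?D] s_pos[of K]
      by (intro mult_mono mult_nonneg_nonneg divide_nonneg_nonneg) auto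
    also have "\<dots> = w K ?D * (len ?D * exp (- S * s ?D) / (s ?D + \<delta>) / east_wt R ?D)" by simp
    finally have "1 * (cf K * Z K * m (blk n K) * \<psi> 0 (iy K) / bN K) \<le> w K ?D * max (u ?D) 0"
      by (intro inflow_term K coarse) (use coarse Kc q0 in \<open>auto simp: ix_def rows_meet_def\<close>)
    moreover have "ix K - 1 = 0" using coarse(1) Kc by (simp add: ix_def)
    ultimately show ?thesis using one[of ?D] coarse(4) eD by simp
  next
    case fine
    define D where "D \<tau> = Cell (l + 1) (2 * x - 1) (2 * y + \<tau>)" for \<tau>
    have half: "D \<tau> \<in> ?X" "1 / 2 * (cf K * Z K * m (blk n K) * \<psi> 0 (iy K) / bN K) \<le> w K (D \<tau>) * max (u (D \<tau>)) 0"
      if \<tau>: "\<tau> < 2" for \<tau>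
    proof -
      have DR: "D \<tau> \<in> R" using fine(2)[OF \<tau>] by (simp add: D_def)
      have eD: "east (D \<tau>) K" using Kc x0 \<tau> by (auto simp: east_def D_def less_2_cases_iff)
      show "D \<tau> \<in> ?X" using DR eD by simp
      have l: "len (D \<tau>) = len K / 2" using Kc by (simp add: edge_len_def D_def)
      have sD: "s (D \<tau>) \<le> s K"
      proof -
        have "right_x h (D \<tau>) = right_x h K - len K"
          unfolding right_x_def l using Kc x0 by (simp add: of_nat_diff algebra_simps D_def)
        moreover have "(real (2 * y + \<tau>) + 1) * (len K / 2) \<le> (2 * real y + 2) * (len K / 2)"
          using len_pos[of K] \<tau> by (intro mult_right_mono) auto
        then have "top_y h (D \<tau>) \<le> top_y h K"
          unfolding top_y_def l using Kc by (simp add: field_simps D_def)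
        ultimately show ?thesis using len_pos[of K] by (simp add: s_def)
      qed
      note dm = decay_mono[OF sD]
      have wl: "2 / 3 * cf K * exp (- (2 * (S * len K))) \<le> w K (D \<tau>)"
        by (rule w_cross(2)[OF K DR]) (use eD Kc in \<open>auto simp: D_def\<close>)
      have eP: "anc l (east_pos (D \<tau>)) = K"
        using Kc x0 \<tau> by (simp add: east_pos_def D_def anc_Cell less_2_cases_iff)
      \<comment> \<open>The position east of the finer cell lies inside \<open>K\<close>, so the
        antichain property fixes its eastern weight at 2 / 3.\<close>
      have "east_pos (D \<tau>) \<notin> R"
      proof
        assume e: "east_pos (D \<tau>) \<in> R"
        have lv: "level K = l" "level (east_pos (D \<tau>)) = Suc l" using Kc by (simp_all add: east_pos_def D_def)
        then have "east_pos (D \<tau>) = K" using tiling_antichain[OF tR K e] eP by simp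
        then show False using lv by simp
      qed
      then have a: "east_wt R (D \<tau>) = 2 / 3" using eP K by (simp add: east_wt_def D_def)
      have "1 / 2 * (1 - \<eta>) * cf K * Z K = 1 / 2 * cf K * ((1 - \<eta>) * Z K)" by simp
      also have "\<dots> \<le> 1 / 2 * cf K * (len K * exp (- S * s K) * exp (- (2 * (S * len K))) / (s K + \<delta>))"
        using Z_le[OF K] pos[OF K] by (intro mult_left_mono) auto
      also have "\<dots> = (2 / 3 * cf K * exp (- (2 * (S * len K)))) * (len (D \<tau>) * (exp (- S * s K) / (s K + \<delta>)) * (3 / 2))"
        unfolding l using s_pos[of K] by (simp add: field_simps)
      also have "\<dots> \<le> w K (D \<tau>) * (len (D \<tau>) * (exp (- S * s (D \<tau>)) / (s (D \<tau>) + \<delta>)) * (3 / 2))"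
        using wl dm pos[OF K] w_pos[OF K DR] len_pos[of "D \<tau>"] s_pos[of "D \<tau>"] s_pos[of K]
        by (intro mult_mono mult_nonneg_nonneg divide_nonneg_nonneg) auto
      also have "\<dots> = w K (D \<tau>) * (len (D \<tau>) * exp (- S * s (D \<tau>)) / (s (D \<tau>) + \<delta>) / east_wt R (D \<tau>))"
        by (simp add: a)
      finally show "1 / 2 * (cf K * Z K * m (blk n K) * \<psi> 0 (iy K) / bN K) \<le> w K (D \<tau>) * max (u (D \<tau>)) 0"
        by (intro inflow_term K DR)
          (use fine(3,4) fine(5)[OF \<tau>] Kc q0 \<tau> in \<open>auto simp: ix_def rows_meet_def D_def\<close>)
    qed
    have ne: "D 0 \<noteq> D 1" by (simp add: D_def)
    have "(\<Sum>D\<in>{D 0, D 1}. w K D * max (u D) 0) \<le> (\<Sum>D\<in>?X. w K D * max (u D) 0)"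
      using half(1)[of 0] half(1)[of 1] term0 by (intro sum_mono2 fin) auto
    then have "cf K * Z K * m (blk n K) * \<psi> 0 (iy K) / bN K \<le> (\<Sum>D\<in>?X. w K D * max (u D) 0)"
      using half(2)[of 0] half(2)[of 1] ne by simp
    moreover have "ix K - 1 = 0" using fine(1) Kc by (simp add: ix_def)
    ultimately show ?thesis by simp
  qed
qed

end

section \<open>Southern inflow and northern outflow by reflection\<close>

lemma coeff_at_swp: "coeff_at h (\<sigma> \<circ> prod.swap) K = coeff_at h \<sigma> (swp K)"
  by (simp add: coeff_at_def center_def left_x_def right_x_def bottom_y_def top_y_def edge_len_def)

lemma face_wt_swp: "face_wt h (\<sigma> \<circ> prod.swap) K D = face_wt h \<sigma> (swp K) (swp D)"
  by (simp add: face_wt_def coeff_at_swp Let_def)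

context flow
begin

text \<open>\<open>flow\<close> speaks of adjacency but not of the order, and the profile is
  symmetric, so reflection maps its models to models.\<close>

lemma flow_swp: "flow N n h (swp ` Q) (swp ` R) (\<sigma> \<circ> prod.swap) S \<delta> \<eta> \<theta> (m \<circ> swp) \<psi>"
proof -
  interpret sw: mesh N n h "swp ` Q" "swp ` R" by (rule mesh_swp)
  show ?thesis
  proof
    fix K D assume "K \<in> swp ` R" "D \<in> swp ` R" "east K D \<or> east D K \<or> north K D \<or> north D K"
    then show "coeff_at h (\<sigma> \<circ> prod.swap) D \<le> coeff_at h (\<sigma> \<circ> prod.swap) K * exp (S * ((edge_len h K + edge_len h D) / 2))"
      using ratio[of "swp K" "swp D"] by (auto simp: coeff_at_swp swp_image_iff north_def edge_len_def)
  next
    fix C B assume "C \<in> swp ` Q" "B \<in> swp ` Q" "east C B \<or> north C B"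
    then show "(m \<circ> swp) B \<le> \<theta> * (m \<circ> swp) C"
      using m_step[of "swp C" "swp B"] by (auto simp: swp_image_iff north_def)
  qed (use S0 \<delta>0 \<eta>01 \<theta>0 \<psi>_le \<psi>_sym coupling small2 small5 pos m_pos m_le in \<open>auto simp: coeff_at_swp swp_image_iff\<close>)
qed

lemma swapped:
  shows "flow.Z h S \<delta> (swp K) = Z K"
    and "flow.ix n (swp K) = iy K" "flow.iy n (swp K) = ix K"
    and "flow.bN (swp ` R) (swp K) = east_wt R K"
    and "flow.u n h (swp ` R) S \<delta> (m \<circ> swp) \<psi> (swp K) = u K"
proof -
  interpret sw: flow N n h "swp ` Q" "swp ` R" "\<sigma> \<circ> prod.swap" S \<delta> \<eta> \<theta> "m \<circ> swp" \<psi> by (rule flow_swp)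
  have l: "len (swp K) = len K" by (simp add: edge_len_def)
  have s: "sw.s (swp K) = s K"
    unfolding sw.s_def s_def right_x_def top_y_def l by simp
  show "sw.Z (swp K) = Z K" unfolding sw.Z_def Z_def l s ..
  show i: "sw.ix (swp K) = iy K" "sw.iy (swp K) = ix K"
    by (simp_all add: sw.ix_def sw.iy_def ix_def iy_def)
  show b: "sw.bN (swp K) = east_wt R K" by (simp add: sw.bN_def)
  show "sw.u (swp K) = u K"
    unfolding sw.u_def u_def i b l s by (simp add: blk_swp \<psi>_sym[of "iy K"] bN_def mult.commute)
qed

lemma sum_swp: "(\<Sum>D\<in>{D \<in> swp ` R. P D}. f D) = (\<Sum>D\<in>{D \<in> R. P (swp D)}. f (swp D))"
proof -
  have "{D \<in> swp ` R. P D} = swp ` {D \<in> R. P (swp D)}" by auto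
  moreover have "inj_on swp A" for A by (auto simp: inj_on_def)
  ultimately show ?thesis by (simp add: sum.reindex)
qed

lemma inflow_south:
  assumes "K \<in> R" "0 < ypos K"
  shows "cf K * Z K * m (blk n K) * \<psi> (ix K) (iy K - 1) / east_wt R K
    \<le> (\<Sum>D\<in>{D \<in> R. north D K}. w K D * max (u D) 0)"
proof -
  interpret sw: flow N n h "swp ` Q" "swp ` R" "\<sigma> \<circ> prod.swap" S \<delta> \<eta> \<theta> "m \<circ> swp" \<psi> by (rule flow_swp)
  show ?thesis
    using sw.inflow_west[of "swp K"] assms
    by (simp add: sum_swp swapped coeff_at_swp face_wt_swp north_def blk_swp \<psi>_sym[of "ix K"])
qed

lemma north_outflow:
  assumes "K \<in> R"
  shows "(\<Sum>D\<in>{D \<in> R. north K D}. w K D) \<le> cf K * bN K * exp (2 * (S * len K))"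
    and "bN K = 1 \<Longrightarrow> (\<Sum>D\<in>{D \<in> R. north K D}. w K D) \<le> cf K * exp (S * len K / 2)"
proof -
  interpret sw: flow N n h "swp ` Q" "swp ` R" "\<sigma> \<circ> prod.swap" S \<delta> \<eta> \<theta> "m \<circ> swp" \<psi> by (rule flow_swp)
  have l: "len (swp K) = len K" by (simp add: edge_len_def)
  show "(\<Sum>D\<in>{D \<in> R. north K D}. w K D) \<le> cf K * bN K * exp (2 * (S * len K))"
    using sw.east_outflow(1)[of "swp K"] assms by (simp add: sum_swp coeff_at_swp face_wt_swp north_def bN_def l)
  show "(\<Sum>D\<in>{D \<in> R. north K D}. w K D) \<le> cf K * exp (S * len K / 2)" if "bN K = 1"
    using sw.east_outflow(2)[of "swp K"] assms that
    by (simp add: sum_swp coeff_at_swp face_wt_swp north_def bN_def l east_wt_def split: if_splits)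
qed

end

text \<open>\<open>p\<close> stands for \<open>a' / (a' + b')\<close> with outgoing weights in {2/3,
  1, 4/3}, which lies between 1 / 3 and 2 / 3. The surplus \<open>1 + \<eta>\<close> in
  \<open>layer\<close> pays for the first-order errors via \<open>small1\<close>;
  \<open>bulk\<close> has no surplus and relies on \<open>small6\<close>. \<open>small3\<close>
  makes the boundary term sufficient, and \<open>small4\<close> gives
  \<open>u K < 1\<close>.\<close>

locale subsolution = flow +
  fixes a :: real
  assumes a: "a = real N * h"
    and small1: "exp (2 * (S * (h / 2 ^ n))) \<le> (1 + \<eta>) * ((1 - (S * (h / 2 ^ n))\<^sup>2) * (1 - 9 / 4 * (h / 2 ^ n / \<delta>)))"
    and small3: "3 / 2 * (h / 2 ^ n) * exp (S * (h / 2 ^ n)) \<le> \<delta>"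
    and small4: "9 / 4 * (h / 2 ^ n) < \<delta>"
    and small6: "(2 * a + \<delta>) * S\<^sup>2 * (h / 2 ^ n) \<le> 1 / 10"
    and bulk: "1 \<le> i \<Longrightarrow> i < 2 ^ n \<Longrightarrow> 1 \<le> j \<Longrightarrow> j < 2 ^ n \<Longrightarrow> 2 * \<psi> i j \<le> \<psi> (i - 1) j + \<psi> i (j - 1)"
    and layer: "1 \<le> i \<Longrightarrow> i \<le> 2 ^ n \<Longrightarrow> 1 \<le> j \<Longrightarrow> j \<le> 2 ^ n \<Longrightarrow> i = 2 ^ n \<or> j = 2 ^ n \<Longrightarrow>
      1 / 3 \<le> p \<Longrightarrow> p \<le> 2 / 3 \<Longrightarrow> 0 < \<psi> i j \<Longrightarrow> \<psi> i j * (1 + \<eta>) \<le> p * \<psi> (i - 1) j + (1 - p) * \<psi> i (j - 1)"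
begin

lemma right_top_le: "K \<in> R \<Longrightarrow> right_x h K \<le> a" "K \<in> R \<Longrightarrow> top_y h K \<le> a"
proof -
  assume K: "K \<in> R"
  have "(real (xpos K) + 1) * len K \<le> real (N * 2 ^ level K) * len K" "(real (ypos K) + 1) * len K \<le> real (N * 2 ^ level K) * len K"
    using tiling_range[OF tR K] len_pos[of K] by (intro mult_right_mono; linarith)+
  moreover have "real (N * 2 ^ level K) * len K = a" by (simp add: a edge_len_def)
  ultimately show "right_x h K \<le> a" "top_y h K \<le> a" by (simp_all add: right_x_def top_y_def)
qed

definition outer :: "cell \<Rightarrow> real" where "outer K = len K * exp (- S * s K) * m (blk n K)"

lemma u_eq: "u K = outer K / (s K + \<delta>) * \<psi> (ix K) (iy K) / (east_wt R K * bN K)"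
  by (simp add: u_def outer_def)

lemma Z_eq: "Z K * m (blk n K) = outer K * (exp (S * len K / 2) * (1 - (S * len K)\<^sup>2)) / (s K - len K + \<delta>)"
  by (simp add: Z_def outer_def)

lemma outer_pos: "K \<in> R \<Longrightarrow> 0 < outer K"
  using m_pos[OF blk_in(1)] len_pos[of K] by (simp add: outer_def)

lemma outer_le: "K \<in> R \<Longrightarrow> outer K \<le> 9 / 10 * len K"
proof -
  assume K: "K \<in> R"
  have "exp (- S * s K) \<le> 1" using S0 s_ge[of K] len_pos[of K] by simp
  moreover have "0 < m (blk n K)" using m_pos[OF blk_in(1)[OF K]] .
  ultimately have "exp (- S * s K) * m (blk n K) \<le> 1 * (9 / 10)"
    using m_le[OF blk_in(1)[OF K]] by (intro mult_mono) auto
  then have "len K * (exp (- S * s K) * m (blk n K)) \<le> len K * (9 / 10)"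
    using len_pos[of K] by (intro mult_left_mono) auto
  then show ?thesis by (simp add: outer_def)
qed

lemma weights: "0 < east_wt R K" "0 < bN K" "2 / 3 \<le> east_wt R K" "2 / 3 \<le> bN K"
  "1 / 3 \<le> east_wt R K / (east_wt R K + bN K)" "east_wt R K / (east_wt R K + bN K) \<le> 2 / 3"
  "4 / 9 \<le> east_wt R K * bN K" "east_wt R K * bN K \<le> 16 / 9"
  by (simp_all add: bN_def east_wt_def)

text \<open>On a fine mesh one incoming contribution never exceeds \<open>cf K\<close>. Hence a
  single boundary edge, which contributes \<open>2 * cf K\<close>, replaces both of them.\<close>

lemma inflow_boundary:
  assumes K: "K \<in> R" and c: "2 / 3 \<le> c"
  shows "cf K * Z K * m (blk n K) * \<psi> i j / c \<le> cf K"
proof -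
  let ?G = "h / 2 ^ n"
  have G: "len K \<le> ?G" using len_le[OF K] .
  have "0 \<le> S * len K" using S0 len_pos[of K] by simp
  then have SH: "S * len K / 2 \<le> S * ?G" "\<bar>S * len K\<bar> \<le> 1"
    using small5 mult_left_mono[OF G S0] by linarith+
  have k2: "(S * len K)\<^sup>2 \<le> 1" using SH(2) by (simp only: abs_square_le_1)
  have "Z K = len K * (exp (- S * s K) * exp (S * len K / 2) * (1 - (S * len K)\<^sup>2)) / (s K - len K + \<delta>)"
    by (simp add: Z_def)
  also have "\<dots> \<le> ?G * (1 * exp (S * ?G) * 1) / \<delta>"
  proof (intro frac_le mult_mono mult_nonneg_nonneg)
    show "exp (S * len K / 2) \<le> exp (S * ?G)" using SH by (simp only: exp_le_cancel_iff)
    show "\<delta> \<le> s K - len K + \<delta>" using s_ge[of K] len_pos[of K] by simp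
  qed (use S0 s_ge[of K] len_pos[of K] h \<delta>0 G k2 in auto)
  finally have Z: "Z K \<le> ?G * exp (S * ?G) / \<delta>" by simp
  have "Z K * (m (blk n K) * (\<psi> i j / c)) \<le> Z K * (1 * (3 / 2))"
  proof (intro mult_left_mono Z_nonneg[OF K])
    have "\<psi> i j / c \<le> 1 / c" using \<psi>_le c by (intro divide_right_mono) auto
    also have "\<dots> \<le> 3 / 2" using c by (simp add: field_simps)
    finally have "m (blk n K) * (\<psi> i j / c) \<le> m (blk n K) * (3 / 2)"
      using m_pos[OF blk_in(1)[OF K]] by (intro mult_left_mono) auto
    then show "m (blk n K) * (\<psi> i j / c) \<le> 1 * (3 / 2)" using m_le[OF blk_in(1)[OF K]] by simp
  qed
  also have "\<dots> \<le> ?G * exp (S * ?G) / \<delta> * (3 / 2)" using mult_right_mono[OF Z, of "3 / 2"] by (simp only: mult_1_left)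
  also have "\<dots> = 3 / 2 * ?G * exp (S * ?G) / \<delta>" by simp
  also have "\<dots> \<le> 1" using small3 \<delta>0 by (simp only: divide_le_eq_1_pos)
  finally have "cf K * (Z K * (m (blk n K) * (\<psi> i j / c))) \<le> cf K * 1"
    using pos[OF K] by (intro mult_left_mono) auto
  then show ?thesis by (simp add: mult_ac)
qed

lemma inflow:
  assumes K: "K \<in> R"
  defines "r \<equiv> {(D, E). D \<in> R \<and> E \<in> R \<and> zless D E}"
  shows "cf K * (Z K * m (blk n K)) * (\<psi> (ix K - 1) (iy K) / bN K + \<psi> (ix K) (iy K - 1) / east_wt R K)
    \<le> 2 * real (boundary_edges a h K) * cf K + (\<Sum>D\<in>prec_nbrs h R r K. w K D * max (u D) 0)"
proof -
  let ?E = "{D \<in> R. east D K}" and ?N = "{D \<in> R. north D K}" and ?f = "\<lambda>D. w K D * max (u D) 0"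
  let ?W = "cf K * Z K * m (blk n K) * \<psi> (ix K - 1) (iy K) / bN K"
  let ?S = "cf K * Z K * m (blk n K) * \<psi> (ix K) (iy K - 1) / east_wt R K"
  have fin: "finite ?E" "finite ?N" using tiling_finite[OF tR] by simp_all
  have f0: "0 \<le> ?f D" if "D \<in> R" for D using w_pos[OF K that] by simp
  have sub: "?E \<union> ?N \<subseteq> prec_nbrs h R r K"
    using K nbrs_iff[OF h tR K] east_zless north_zless by (auto simp: prec_nbrs_def r_def)
  have subR: "prec_nbrs h R r K \<subseteq> R" by (auto simp: prec_nbrs_def nbrs_def)
  note finp = finite_subset[OF subR tiling_finite[OF tR]] subR
  have "(\<Sum>D\<in>?E. ?f D) + (\<Sum>D\<in>?N. ?f D) = (\<Sum>D\<in>?E \<union> ?N. ?f D)"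
    using not_east_north by (intro sum.union_disjoint[symmetric] fin) auto
  also have "\<dots> \<le> (\<Sum>D\<in>prec_nbrs h R r K. ?f D)"
    using sub finp f0 by (intro sum_mono2) auto
  finally have le: "(\<Sum>D\<in>?E. ?f D) + (\<Sum>D\<in>?N. ?f D) \<le> (\<Sum>D\<in>prec_nbrs h R r K. ?f D)" .
  have B: "1 \<le> boundary_edges a h K" if "xpos K = 0 \<or> ypos K = 0"
    using boundary_edges_pos[OF h that right_top_le[OF K]] .
  have Bc: "2 * cf K \<le> 2 * real (boundary_edges a h K) * cf K" if "xpos K = 0 \<or> ypos K = 0"
    using B[OF that] pos[OF K] by simp
  have B0: "0 \<le> 2 * real (boundary_edges a h K) * cf K" using pos[OF K] by simp
  have s0: "0 \<le> (\<Sum>D\<in>?E. ?f D)" "0 \<le> (\<Sum>D\<in>?N. ?f D)" using f0 by (auto intro!: sum_nonneg)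
  have W: "?W \<le> cf K" "?S \<le> cf K" using inflow_boundary[OF K] weights[of K] by auto
  have W': "0 < xpos K \<Longrightarrow> ?W \<le> (\<Sum>D\<in>?E. ?f D)" using inflow_west[OF K] .
  have S': "0 < ypos K \<Longrightarrow> ?S \<le> (\<Sum>D\<in>?N. ?f D)" using inflow_south[OF K] .
  have "?W + ?S \<le> 2 * real (boundary_edges a h K) * cf K + (\<Sum>D\<in>prec_nbrs h R r K. ?f D)"
  \<comment> \<open>If just one of the two neighbours is missing, the boundary term still covers
    both contributions, and no further case distinction arises.\<close>
  proof (cases "xpos K = 0 \<or> ypos K = 0")
    case True
    then show ?thesis using W Bc s0 le by linarith
  next
    case False
    then show ?thesis using W' S' B0 le by linarith
  qed
  then show ?thesis by (simp add: algebra_simps)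
qed

lemma outflow:
  assumes K: "K \<in> R"
  defines "r \<equiv> {(D, E). D \<in> R \<and> E \<in> R \<and> zless D E}"
  shows "(\<Sum>D\<in>succ_nbrs h R r K. w K D) \<le> (\<Sum>D\<in>{D \<in> R. east K D}. w K D) + (\<Sum>D\<in>{D \<in> R. north K D}. w K D)"
proof -
  let ?E = "{D \<in> R. east K D}" and ?N = "{D \<in> R. north K D}"
  have fin: "finite ?E" "finite ?N" using tiling_finite[OF tR] by simp_all
  have "\<not> zless K D" if "zless D K" for D using that zless_trans zless_irrefl by blast
  then have "succ_nbrs h R r K \<subseteq> ?E \<union> ?N"
    using K nbrs_iff[OF h tR K] east_zless north_zless by (auto simp: succ_nbrs_def r_def)
  then have "(\<Sum>D\<in>succ_nbrs h R r K. w K D) \<le> (\<Sum>D\<in>?E \<union> ?N. w K D)"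
    using fin w_pos[OF K] less_imp_le by (intro sum_mono2) auto
  also have "\<dots> = (\<Sum>D\<in>?E. w K D) + (\<Sum>D\<in>?N. w K D)"
    using not_east_north by (intro sum.union_disjoint fin) auto
  finally show ?thesis .
qed


lemma subsolution:
  assumes K: "K \<in> R" and u0: "0 < u K"
  defines "r \<equiv> {(D, E). D \<in> R \<and> E \<in> R \<and> zless D E}"
  shows "\<exists>T>0. (\<Sum>D\<in>succ_nbrs h R r K. w K D) \<le> T \<and>
    T * u K \<le> (2 * real (boundary_edges a h K) * cf K + (\<Sum>D\<in>prec_nbrs h R r K. w K D * max (u D) 0)) * (1 - u K)"
proof -
  define H where "H = len K"
  define G where "G = h / 2 ^ n"
  define P where "P = \<psi> (ix K) (iy K)"
  define a' b' where "a' = east_wt R K" "b' = bN K"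
  define I where "I = 2 * real (boundary_edges a h K) * cf K + (\<Sum>D\<in>prec_nbrs h R r K. w K D * max (u D) 0)"
  define F where "F = \<psi> (ix K - 1) (iy K) / b' + \<psi> (ix K) (iy K - 1) / a'"
  define \<kappa> where "\<kappa> = (1 - (S * H)\<^sup>2)"
  have H: "0 < H" "H \<le> G" using len_pos[of K] len_le[OF K] by (auto simp: H_def G_def)
  have SH: "0 \<le> S * H" "S * H \<le> S * G" "S * G \<le> 1"
    using S0 H(1) small5 mult_left_mono[OF H(2) S0] by (auto simp: G_def)
  have \<kappa>: "0 \<le> \<kappa>" "1 - (S * G)\<^sup>2 \<le> \<kappa>" "\<kappa> \<le> 1"
    unfolding \<kappa>_def using SH power_mono[OF SH(2,1), of 2] power_mono[of "S * H" 1 2] by auto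
  have ab: "0 < a'" "0 < b'" "1 / 3 \<le> a' / (a' + b')" "a' / (a' + b') \<le> 2 / 3" "4 / 9 \<le> a' * b'"
    using weights[of K] by (auto simp: a'_b'_def)
  have sp: "0 < s K - H + \<delta>" "0 < s K + \<delta>" "\<delta> \<le> s K + \<delta>" using s_pos[of K] s_ge[of K] H by (auto simp: H_def)
  have o: "0 < outer K" "outer K \<le> 9 / 10 * H" using outer_pos[OF K] outer_le[OF K] by (auto simp: H_def)
  have uK: "u K = outer K / (s K + \<delta>) * P / (a' * b')" by (simp add: u_eq P_def a'_b'_def)
  have P: "0 < P"
  proof (rule ccontr)
    assume "\<not> 0 < P"
    then have "u K \<le> 0" unfolding uK using o sp ab by (intro divide_nonpos_pos mult_nonneg_nonpos) auto
    then show False using u0 by simp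
  qed
  have P1: "P \<le> 1" using \<psi>_le by (simp add: P_def)
  have u_le: "u K \<le> 9 / 4 * (G / \<delta>)"
  proof -
    have "u K = outer K * P / ((s K + \<delta>) * (a' * b'))" by (simp add: uK)
    also have "\<dots> \<le> G * 1 / (\<delta> * (4 / 9))"
      using o P P1 H sp ab \<delta>0 by (intro frac_le mult_mono mult_pos_pos) auto
    finally show ?thesis by simp
  qed
  moreover have "9 / 4 * G / \<delta> < 1" using small4 \<delta>0 unfolding G_def by (simp only: divide_less_eq_1_pos)
  ultimately have u1: "u K < 1" by (simp only: times_divide_eq_right)
  have inn: "cf K * (outer K * (exp (S * H / 2) * \<kappa>) / (s K - H + \<delta>)) * F \<le> I"
    using inflow[OF K] unfolding Z_eq by (simp add: H_def I_def F_def r_def \<kappa>_def a'_b'_def)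
  have cf: "0 < cf K" using pos[OF K] .
  note out = outflow[OF K, folded r_def]
  have i: "1 \<le> ix K" "ix K \<le> q" "1 \<le> iy K" "iy K \<le> q" by (auto simp: ix_def iy_def Suc_le_eq)
  show ?thesis
  proof (cases "ix K < q \<and> iy K < q")
    case True
    have ab1: "a' = 1" "b' = 1"
      using east_wt_inner[OF K] bN_inner[OF K] True by (auto simp: a'_b'_def ix_def iy_def)
    have "east_pos K \<in> R" using ab1(1) by (auto simp: a'_b'_def east_wt_def split: if_splits)
    then have S: "(\<Sum>D\<in>succ_nbrs h R r K. w K D) \<le> 2 * cf K * exp (S * H / 2)"
      using out east_outflow(2)[OF K] north_outflow(2)[OF K] ab1 by (simp add: H_def a'_b'_def)
    have F: "2 * P \<le> F"
      using bulk[of "ix K" "iy K"] True i by (simp add: F_def ab1 P_def)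
    \<comment> \<open>Passing from \<open>s K - H\<close> to \<open>s K\<close> gains the relative
      amount \<open>H / (s K + \<delta>)\<close>. As block factors are at most 9 / 10,
      \<open>u K\<close> consumes nine tenths of it; by \<open>small6\<close> the last tenth covers
      the second-order loss in \<open>\<kappa>\<close>.\<close>
    have key: "1 / (s K + \<delta>) \<le> \<kappa> * (1 - u K) / (s K - H + \<delta>)"
    proof -
      have "u K \<le> 9 / 10 * H / (s K + \<delta>)"
      proof -
        have "outer K * P \<le> 9 / 10 * H * 1" using o P P1 by (intro mult_mono) auto
        then have "outer K * P / (s K + \<delta>) \<le> 9 / 10 * H * 1 / (s K + \<delta>)"
          using sp by (intro divide_right_mono) auto
        moreover have "u K = outer K * P / (s K + \<delta>)" by (simp add: uK ab1)
        ultimately show ?thesis by (simp only: mult_1_right)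
      qed
      then have 1: "s K + \<delta> - 9 / 10 * H \<le> (s K + \<delta>) * (1 - u K)"
        using sp by (simp add: field_simps)
      have "s K \<le> 2 * a" using right_top_le[OF K] by (simp add: s_def)
      then have "(s K + \<delta>) * (S\<^sup>2 * G) \<le> (2 * a + \<delta>) * (S\<^sup>2 * G)"
        using H by (intro mult_right_mono) auto
      also have "\<dots> \<le> 1 / 10" using small6 by (simp add: G_def mult.assoc)
      finally have "(s K + \<delta>) * (S\<^sup>2 * G) * H \<le> 1 / 10 * H" using H by (intro mult_right_mono) auto
      moreover have "(s K + \<delta>) * (S * H)\<^sup>2 \<le> (s K + \<delta>) * (S\<^sup>2 * G) * H"
        using H sp by (simp add: power_mult_distrib power2_eq_square[of H] mult.assoc mult_left_mono mult_right_mono)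
      ultimately have 2: "(s K + \<delta>) * (S * H)\<^sup>2 \<le> 1 / 10 * H" by linarith
      have "(s K + \<delta> - 9 / 10 * H) * (S * H)\<^sup>2 \<le> (s K + \<delta>) * (S * H)\<^sup>2"
        using H by (intro mult_right_mono) auto
      moreover have "(s K + \<delta> - 9 / 10 * H) * \<kappa> = (s K + \<delta> - 9 / 10 * H) - (s K + \<delta> - 9 / 10 * H) * (S * H)\<^sup>2"
        by (simp only: \<kappa>_def right_diff_distrib mult_1_right)
      ultimately have "s K - H + \<delta> \<le> (s K + \<delta> - 9 / 10 * H) * \<kappa>"
        using 2 by linarith
      also have "\<dots> \<le> (s K + \<delta>) * (1 - u K) * \<kappa>" using 1 \<kappa> by (intro mult_right_mono) auto
      finally show ?thesis using sp by (simp add: field_simps)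
    qed
    have "2 * cf K * exp (S * H / 2) * u K = cf K * outer K * exp (S * H / 2) * (1 / (s K + \<delta>)) * (2 * P)"
      by (simp add: uK ab1)
    also have "\<dots> \<le> cf K * outer K * exp (S * H / 2) * (\<kappa> * (1 - u K) / (s K - H + \<delta>)) * F"
      using key F P cf o \<kappa> u1 sp by (intro mult_mono mult_left_mono mult_nonneg_nonneg divide_nonneg_nonneg) auto
    also have "\<dots> = cf K * (outer K * (exp (S * H / 2) * \<kappa>) / (s K - H + \<delta>)) * F * (1 - u K)" by simp
    also have "\<dots> \<le> I * (1 - u K)" using inn u1 by (intro mult_right_mono) auto
    finally show ?thesis using S cf unfolding I_def by (intro exI[of _ "2 * cf K * exp (S * H / 2)"]) auto
  next
    case False
    define p where "p = a' / (a' + b')"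
    have S: "(\<Sum>D\<in>succ_nbrs h R r K. w K D) \<le> cf K * (a' + b') * exp (2 * (S * H))"
      using out east_outflow(1)[OF K] north_outflow(1)[OF K] by (simp add: H_def a'_b'_def algebra_simps)
    have "P * (1 + \<eta>) \<le> p * \<psi> (ix K - 1) (iy K) + (1 - p) * \<psi> (ix K) (iy K - 1)"
      unfolding P_def by (rule layer) (use i False ab P in \<open>auto simp: p_def P_def\<close>)
    \<comment> \<open>The inflow is a convex combination with the outgoing weights as coefficients,
      which brings it into the form of \<open>layer\<close>.\<close>
    moreover have "F = (a' + b') / (a' * b') * (p * \<psi> (ix K - 1) (iy K) + (1 - p) * \<psi> (ix K) (iy K - 1))"
    proof -
      have "(a' + b') * p = a'" "(a' + b') * (1 - p) = b'" using ab by (simp_all add: p_def field_simps)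
      then have "(a' + b') * (p * X + (1 - p) * Y) = a' * X + b' * Y" for X Y
        by (metis (no_types, lifting) distrib_left mult.assoc)
      moreover have "F = (a' * \<psi> (ix K - 1) (iy K) + b' * \<psi> (ix K) (iy K - 1)) / (a' * b')"
        using ab(1,2) by (simp add: F_def field_simps)
      ultimately show ?thesis by (simp only: times_divide_eq_left)
    qed
    ultimately have F: "(a' + b') / (a' * b') * (P * (1 + \<eta>)) \<le> F"
      using ab(1,2) by (metis (no_types, lifting) add_pos_pos divide_pos_pos less_imp_le mult_left_mono mult_pos_pos)
    \<comment> \<open>Here the gain from \<open>s K - H\<close> is simply dropped;
      \<open>1 + \<eta>\<close> pays for the exponent, for \<open>\<kappa>\<close> and for
      \<open>1 - u K\<close>.\<close>
    have key: "exp (2 * (S * H)) / (s K + \<delta>) \<le> (1 + \<eta>) * (exp (S * H / 2) * \<kappa> * (1 - u K) / (s K - H + \<delta>))"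
    proof -
      have "exp (2 * (S * H)) \<le> exp (2 * (S * G))" using SH by simp
      also have "\<dots> \<le> (1 + \<eta>) * ((1 - (S * G)\<^sup>2) * (1 - 9 / 4 * (G / \<delta>)))" using small1 by (simp add: G_def)
      also have "\<dots> \<le> (1 + \<eta>) * (\<kappa> * (1 - u K))"
        using \<kappa> u_le u1 \<eta>01 small4 \<delta>0 by (intro mult_left_mono mult_mono) (auto simp: G_def field_simps)
      finally have "exp (2 * (S * H)) / (s K + \<delta>) \<le> (1 + \<eta>) * (\<kappa> * (1 - u K)) / (s K + \<delta>)"
        using sp by (intro divide_right_mono) auto
      also have "\<dots> \<le> (1 + \<eta>) * (\<kappa> * (1 - u K)) / (s K - H + \<delta>)"
        using sp H \<kappa> u1 \<eta>01 by (intro divide_left_mono mult_pos_pos mult_nonneg_nonneg) auto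
      also have "\<dots> = (1 + \<eta>) * (1 * \<kappa> * (1 - u K) / (s K - H + \<delta>))" by simp
      also have "\<dots> \<le> (1 + \<eta>) * (exp (S * H / 2) * \<kappa> * (1 - u K) / (s K - H + \<delta>))"
        using \<eta>01 sp SH \<kappa> u1 by (intro mult_left_mono divide_right_mono mult_right_mono) auto
      finally show ?thesis .
    qed
    have "cf K * (a' + b') * exp (2 * (S * H)) * u K
        = cf K * outer K * ((a' + b') / (a' * b') * P) * (exp (2 * (S * H)) / (s K + \<delta>))"
      by (simp add: uK mult_ac)
    also have "\<dots> \<le> cf K * outer K * ((a' + b') / (a' * b') * P) * ((1 + \<eta>) * (exp (S * H / 2) * \<kappa> * (1 - u K) / (s K - H + \<delta>)))"
      using key cf o ab P by (intro mult_left_mono) auto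
    also have "\<dots> = cf K * outer K * (exp (S * H / 2) * \<kappa> * (1 - u K) / (s K - H + \<delta>)) * ((a' + b') / (a' * b') * (P * (1 + \<eta>)))"
      by (simp add: mult_ac)
    also have "\<dots> \<le> cf K * outer K * (exp (S * H / 2) * \<kappa> * (1 - u K) / (s K - H + \<delta>)) * F"
      using F cf o \<kappa> u1 sp by (intro mult_left_mono mult_nonneg_nonneg divide_nonneg_nonneg) auto
    also have "\<dots> = cf K * (outer K * (exp (S * H / 2) * \<kappa>) / (s K - H + \<delta>)) * F * (1 - u K)" by simp
    also have "\<dots> \<le> I * (1 - u K)" using inn u1 by (intro mult_right_mono) auto
    finally show ?thesis using S cf ab unfolding I_def
      by (intro exI[of _ "cf K * (a' + b') * exp (2 * (S * H))"]) auto
  qed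
qed

text \<open>16 / 9 is the largest product of the two outgoing weights. Outside the last row and
  column both weights are 1, a saving on which the sharp bound depends.\<close>

lemma lecn_bound:
  assumes "quadtree N R r" "K \<in> R" "0 < \<psi> (ix K) (iy K)"
  shows "lecn h R r (fv_matrix a h \<sigma> R) K \<le> (s K + \<delta>) * exp (S * s K) / len K * (16 / 9 / (m (blk n K) * \<psi> (ix K) (iy K)))"
    and "ix K < q \<Longrightarrow> iy K < q \<Longrightarrow>
      lecn h R r (fv_matrix a h \<sigma> R) K \<le> (s K + \<delta>) * exp (S * s K) / len K * (1 / (m (blk n K) * \<psi> (ix K) (iy K)))"
proof -
  have K: "K \<in> R" by fact
  have r: "r = {(D, E). D \<in> R \<and> E \<in> R \<and> zless D E}" using quadtree_zless[OF assms(1)] .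
  have m: "0 < m (blk n K)" using m_pos[OF blk_in(1)[OF K]] .
  have u0: "0 < u K"
    unfolding u_eq using outer_pos[OF K] s_pos[of K] assms(3) weights[of K] by simp
  have le: "lecn h R r (fv_matrix a h \<sigma> R) K \<le> 1 / u K"
    by (rule lecn_le[OF assms(1) h pos]) (use subsolution K u0 in \<open>auto simp: r\<close>)
  have eq: "1 / u K = (s K + \<delta>) * exp (S * s K) / len K * (east_wt R K * bN K / (m (blk n K) * \<psi> (ix K) (iy K)))"
    using s_pos[of K] by (simp add: u_def exp_minus field_simps)
  have "east_wt R K * bN K \<le> 16 / 9" using weights[of K] by simp
  then have "1 / u K \<le> (s K + \<delta>) * exp (S * s K) / len K * (16 / 9 / (m (blk n K) * \<psi> (ix K) (iy K)))"
    unfolding eq using s_pos[of K] len_pos[of K] m assms(3)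
    by (intro mult_left_mono divide_right_mono divide_nonneg_nonneg mult_nonneg_nonneg) auto
  with le show "lecn h R r (fv_matrix a h \<sigma> R) K \<le> (s K + \<delta>) * exp (S * s K) / len K * (16 / 9 / (m (blk n K) * \<psi> (ix K) (iy K)))"
    by linarith
  show "lecn h R r (fv_matrix a h \<sigma> R) K \<le> (s K + \<delta>) * exp (S * s K) / len K * (1 / (m (blk n K) * \<psi> (ix K) (iy K)))"
    if "ix K < q" "iy K < q"
  proof -
    have "east_wt R K = 1" "bN K = 1"
      using east_wt_inner[OF K] bN_inner[OF K] that by (auto simp: ix_def iy_def)
    then show ?thesis using le unfolding eq by simp
  qed
qed

end

section \<open>Profiles in a block\<close>

text \<open>An elementary Wallis-type estimate: consecutive quotients are
  \<open>(2 * n + 1) / (2 * n + 2)\<close>, and \<open>(2 * n + 1) * (2 * n + 3)\<close> is at most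
  the square of \<open>2 * n + 2\<close>.\<close>

lemma central_binomial_le: "(real ((2 * n) choose n) / 4 ^ n)\<^sup>2 * (2 * real n + 1) \<le> 1"
proof (induction n)
  case (Suc n)
  have "(Suc n) * ((2 * Suc n) choose Suc n) = 2 * (2 * n + 1) * ((2 * n) choose n)"
  proof -
    have e: "Suc (2 * n) choose Suc n = Suc (2 * n) choose n"
      using binomial_symmetric[of n "Suc (2 * n)"] by simp
    have "(2 * Suc n) choose Suc n = 2 * (Suc (2 * n) choose Suc n)"
      using e by simp
    then have "Suc n * ((2 * Suc n) choose Suc n) = 2 * (Suc n * (Suc (2 * n) choose Suc n))"
      by (simp only: mult.left_commute)
    also have "Suc n * (Suc (2 * n) choose Suc n) = Suc (2 * n) * ((2 * n) choose n)"
      by (rule Suc_times_binomial)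
    finally show ?thesis by simp
  qed
  then have *: "real (Suc n) * real ((2 * Suc n) choose Suc n) = 2 * (2 * real n + 1) * real ((2 * n) choose n)"
    by (metis (no_types, lifting) of_nat_1 of_nat_add of_nat_mult of_nat_numeral)
  have e: "real ((2 * Suc n) choose Suc n) / 4 ^ Suc n
      = (2 * real n + 1) / (2 * (real n + 1)) * (real ((2 * n) choose n) / 4 ^ n)"
  proof -
    have gen: "A / (4 * x) = (2 * r + 1) / (2 * (r + 1)) * (c / x)"
      if "(r + 1) * A = 2 * (2 * r + 1) * c" "0 < x" "0 \<le> r" for A c x r :: real
    proof -
      have A: "A = 2 * (2 * r + 1) * c / (r + 1)" using that(1,3) by (simp add: eq_divide_eq mult_ac)
      show ?thesis unfolding A using that(2,3) by (auto simp: divide_simps algebra_simps)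
    qed
    show ?thesis
      unfolding power_Suc by (rule gen) (use * in \<open>simp_all only: of_nat_Suc add.commute\<close>, simp_all)
  qed
  have "(2 * real n + 1) * (2 * real n + 3) \<le> (2 * (real n + 1))\<^sup>2"
    by (simp add: power2_eq_square algebra_simps)
  then have q: "(2 * real n + 1) * (2 * real n + 3) / (2 * (real n + 1))\<^sup>2 \<le> 1"
    by (simp add: divide_le_eq_1)
  have "(real ((2 * Suc n) choose Suc n) / 4 ^ Suc n)\<^sup>2 * (2 * real (Suc n) + 1)
    = ((2 * real n + 1) * (2 * real n + 3) / (2 * (real n + 1))\<^sup>2) * ((real ((2 * n) choose n) / 4 ^ n)\<^sup>2 * (2 * real n + 1))"
    unfolding e power_mult_distrib power_divide by (simp add: power2_eq_square field_simps)
  also have "\<dots> \<le> 1 * 1" using q Suc by (intro mult_mono) auto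
  finally show ?case by simp
qed simp

text \<open>The probability that \<open>i\<close> of \<open>i + k\<close> fair steps go east: the
  kernel of the recursion that averages the western and the southern value.\<close>

definition walk :: "nat \<Rightarrow> nat \<Rightarrow> real" where
  "walk i k = real ((i + k) choose i) / 2 ^ (i + k)"

lemma walk_nonneg: "0 \<le> walk i k"
  by (simp add: walk_def)

lemma walk_sym: "walk i k = walk k i"
  using binomial_symmetric[of i "i + k"] by (simp add: walk_def add.commute)

lemma walk_step: "2 * walk (Suc i) (Suc k) = walk i (Suc k) + walk (Suc i) k"
  by (simp add: walk_def add_divide_distrib)

lemma walk_edge: "2 * walk (Suc i) 0 = walk i 0"
  by (simp add: walk_def)

text \<open>Averaging does not raise the maximum over an antidiagonal, so the values are bounded by
  the maximum on the antidiagonal \<open>2 * N\<close>, the central binomial coefficient.\<close>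

lemma walk_le: "2 * N \<le> i + k \<Longrightarrow> (walk i k)\<^sup>2 * (2 * real N + 1) \<le> 1"
proof -
  have le: "walk i k \<le> real ((2 * N) choose N) / 4 ^ N" if "i + k = 2 * N + d" for d i k
    using that
  proof (induction d arbitrary: i k)
    case 0
    then have e: "i + k = 2 * N" by simp
    have "(2::real) ^ (2 * N) = 4 ^ N" by (simp add: power_mult)
    then show ?case unfolding walk_def e
      using binomial_maximum'[of N i] by (simp add: divide_right_mono)
  next
    case (Suc d)
    show ?case
    proof (cases "i = 0 \<or> k = 0")
      case True
      then obtain l where l: "walk i k = walk (Suc l) 0" "l + 0 = 2 * N + d"
        using Suc.prems walk_sym by (cases i; cases k) auto
      then show ?thesis using Suc.IH[OF l(2)] walk_edge[of l] walk_nonneg[of "Suc l" 0] by linarith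
    next
      case False
      then obtain i' k' where ik: "i = Suc i'" "k = Suc k'" by (metis not0_implies_Suc)
      have "walk i' (Suc k') \<le> real ((2 * N) choose N) / 4 ^ N" "walk (Suc i') k' \<le> real ((2 * N) choose N) / 4 ^ N"
        by (rule Suc.IH; use Suc.prems ik in simp)+
      then show ?thesis unfolding ik using walk_step[of i' k'] by linarith
    qed
  qed
  assume "2 * N \<le> i + k"
  then obtain d where "i + k = 2 * N + d" using le_Suc_ex by blast
  then have "(walk i k)\<^sup>2 \<le> (real ((2 * N) choose N) / 4 ^ N)\<^sup>2" using le walk_nonneg by (intro power_mono) auto
  then have "(walk i k)\<^sup>2 * (2 * real N + 1) \<le> (real ((2 * N) choose N) / 4 ^ N)\<^sup>2 * (2 * real N + 1)"
    by (intro mult_right_mono) auto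
  then show ?thesis using central_binomial_le[of N] by linarith
qed

lemma walk_small:
  assumes "0 < (\<epsilon>::real)"
  shows "\<exists>N. \<forall>i k. N \<le> i + k \<longrightarrow> walk i k \<le> \<epsilon>"
proof -
  obtain N :: nat where N: "1 / \<epsilon>\<^sup>2 < real N" using reals_Archimedean2 by blast
  have "walk i k \<le> \<epsilon>" if "2 * N \<le> i + k" for i k
  proof (rule ccontr)
    assume "\<not> ?thesis"
    then have "\<epsilon>\<^sup>2 \<le> (walk i k)\<^sup>2" using assms by (intro power_mono) auto
    then have "\<epsilon>\<^sup>2 * (2 * real N + 1) \<le> (walk i k)\<^sup>2 * (2 * real N + 1)" by (intro mult_right_mono) auto
    then have "\<epsilon>\<^sup>2 * (2 * real N + 1) \<le> 1" using walk_le[OF that] by linarith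
    moreover have "1 < \<epsilon>\<^sup>2 * real N" using N assms by (simp add: field_simps)
    moreover have "0 < \<epsilon>\<^sup>2" using assms by simp
    ultimately show False by (simp add: algebra_simps)
  qed
  then show ?thesis by blast
qed

text \<open>Rows near the bottom and the middle of a side, where nothing is assumed about the inflow. Their deficit performs
  the random walk \<open>spread\<close>; \<open>tilt\<close> covers the two topmost rows, where the inflow is at least \<open>3 / 4\<close>.\<close>

definition disturbed :: "nat \<Rightarrow> nat \<Rightarrow> nat set" where
  "disturbed q J = {1..J} \<union> {q div 2..q div 2 + J}"

definition spread :: "nat \<Rightarrow> nat \<Rightarrow> nat \<Rightarrow> nat \<Rightarrow> real" where
  "spread q J i j = (\<Sum>r\<in>disturbed q J. if r \<le> j then walk i (j - r) else 0)"

definition tilt :: "nat \<Rightarrow> nat \<Rightarrow> nat \<Rightarrow> real" where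
  "tilt q i j = 5 / 8 * (4 / 5) ^ i * 2 ^ j / 2 ^ q"

text \<open>In the last row and column the averaging weights need not be 1 / 2, so
  \<open>spread\<close> no longer fits the recursion. It has become small by then and is replaced by
  a constant, counted twice in the corner; the jump up to this constant supplies the slack in
  \<open>deficit_layer\<close>.\<close>

definition deficit :: "nat \<Rightarrow> nat \<Rightarrow> real \<Rightarrow> nat \<Rightarrow> nat \<Rightarrow> real" where
  "deficit q J \<epsilon> i j = tilt q i j + tilt q j i
     + (if i \<noteq> q \<and> j \<noteq> q then spread q J i j + spread q J j i else \<epsilon> * (of_bool (i = q) + of_bool (j = q)))"

lemma spread_nonneg: "0 \<le> spread q J i j"
  unfolding spread_def by (intro sum_nonneg) (simp add: walk_nonneg)

lemma tilt_nonneg: "0 \<le> tilt q i j"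
  by (simp add: tilt_def)

lemma deficit_nonneg: "0 \<le> \<epsilon> \<Longrightarrow> 0 \<le> deficit q J \<epsilon> i j"
  by (simp add: deficit_def spread_nonneg tilt_nonneg)

lemma deficit_sym: "deficit q J \<epsilon> i j = deficit q J \<epsilon> j i"
  by (simp add: deficit_def)

text \<open>The kernel of each source row \<open>r\<close> satisfies the averaging identity, with
  value zero below \<open>r\<close>. The sources sit in column 0, outside the range
  \<open>1 \<le> i\<close>.\<close>

lemma spread_step:
  assumes "1 \<le> i" "1 \<le> j"
  shows "spread q J (i - 1) j + spread q J i (j - 1) \<le> 2 * spread q J i j"
  unfolding spread_def sum_distrib_left sum.distrib[symmetric]
proof (rule sum_mono)
  fix r assume "r \<in> disturbed q J"
  obtain i' where i: "i = Suc i'" using assms by (cases i) auto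
  consider "r < j" | "r = j" | "j < r" by linarith
  then show "(if r \<le> j then walk (i - 1) (j - r) else 0) + (if r \<le> j - 1 then walk i (j - 1 - r) else 0)
    \<le> 2 * (if r \<le> j then walk i (j - r) else 0)"
  proof cases
    case 1
    then obtain k where "j = r + Suc k" by (metis less_imp_Suc_add add_Suc_right)
    then show ?thesis using walk_step[of i' k] i by simp
  next
    case 2
    then have "\<not> r \<le> j - 1" using assms(2) by linarith
    then show ?thesis using walk_edge[of i'] i 2 by simp
  next
    case 3
    then have "\<not> r \<le> j" "\<not> r \<le> j - 1" by linarith+
    then show ?thesis by simp
  qed
qed

text \<open>The weighted average is \<open>1 / 2 + 3 / 4 * p\<close> times the value, which is at
  most 1 times it precisely for \<open>p \<le> 2 / 3\<close>; the reflected version needs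
  \<open>1 / 3 \<le> p\<close>. The ratios 4 / 5 and 2 are chosen for this range of weights, in
  which the walk estimate would fail.\<close>

lemma tilt_step:
  assumes "1 \<le> i" "1 \<le> j" "p \<le> 2 / 3"
  shows "p * tilt q (i - 1) j + (1 - p) * tilt q i (j - 1) \<le> tilt q i j"
    and "1 / 3 \<le> p \<Longrightarrow> p * tilt q j (i - 1) + (1 - p) * tilt q (j - 1) i \<le> tilt q j i"
proof -
  obtain i' j' where ij: "i = Suc i'" "j = Suc j'" using assms by (metis Suc_le_D One_nat_def)
  have "p * tilt q (i - 1) j + (1 - p) * tilt q i (j - 1) = tilt q i j * (1 / 2 + 3 / 4 * p)"
    unfolding ij tilt_def by (simp add: field_simps)
  also have "\<dots> \<le> tilt q i j * 1" using assms tilt_nonneg by (intro mult_left_mono) auto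
  finally show "p * tilt q (i - 1) j + (1 - p) * tilt q i (j - 1) \<le> tilt q i j" by simp
  assume "1 / 3 \<le> p"
  have "p * tilt q j (i - 1) + (1 - p) * tilt q (j - 1) i = tilt q j i * (5 / 4 - 3 / 4 * p)"
    unfolding ij tilt_def by (simp add: field_simps)
  also have "\<dots> \<le> tilt q j i * 1" using \<open>1 / 3 \<le> p\<close> tilt_nonneg by (intro mult_left_mono) auto
  finally show "p * tilt q j (i - 1) + (1 - p) * tilt q (j - 1) i \<le> tilt q j i" by simp
qed

lemma deficit_bulk:
  assumes "1 \<le> i" "i < q" "1 \<le> j" "j < q"
  shows "deficit q J \<epsilon> (i - 1) j + deficit q J \<epsilon> i (j - 1) \<le> 2 * deficit q J \<epsilon> i j"
proof -
  have "i \<noteq> q" "j \<noteq> q" "i - 1 \<noteq> q" "j - 1 \<noteq> q" using assms by linarith+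
  then show ?thesis
    using assms spread_step[of i j q J] spread_step[of j i q J] tilt_step[of i j "1 / 2" q]
    by (simp add: deficit_def)
qed

text \<open>At least a third of the average comes from inside the block, where the value is
  \<open>\<epsilon> / 4\<close> instead of \<open>\<epsilon>\<close>; a third of the difference is
  the slack \<open>\<epsilon> / 4\<close>. In the corner the value rises from
  \<open>\<epsilon>\<close> to \<open>2 * \<epsilon>\<close>.\<close>

lemma deficit_layer:
  assumes ij: "1 \<le> i" "i \<le> q" "1 \<le> j" "j \<le> q" "i = q \<or> j = q" and p: "1 / 3 \<le> p" "p \<le> 2 / 3" and \<epsilon>: "0 \<le> \<epsilon>"
    and small: "\<And>k. 1 \<le> k \<Longrightarrow> k < q \<Longrightarrow> spread q J (q - 1) k + spread q J k (q - 1) \<le> \<epsilon> / 4"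
  shows "p * deficit q J \<epsilon> (i - 1) j + (1 - p) * deficit q J \<epsilon> i (j - 1) + \<epsilon> / 4 \<le> deficit q J \<epsilon> i j"
proof -
  define E where "E i j = (if i \<noteq> q \<and> j \<noteq> q then spread q J i j + spread q J j i else \<epsilon> * (of_bool (i = q) + of_bool (j = q)))" for i j
  have D: "deficit q J \<epsilon> i j = tilt q i j + tilt q j i + E i j" for i j by (simp add: deficit_def E_def)
  have "p * E (i - 1) j + (1 - p) * E i (j - 1) + \<epsilon> / 4 \<le> E i j"
  proof -
    consider "i = q" "j = q" | "i = q" "j < q" | "i < q" "j = q" using ij by linarith
    then show ?thesis
    proof cases
      case 1
      then have "E i j = 2 * \<epsilon>" "E (i - 1) j = \<epsilon>" "E i (j - 1) = \<epsilon>" using ij by (auto simp: E_def)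
      then show ?thesis using \<epsilon> by (simp add: algebra_simps)
    next
      case 2
      then have e: "E i j = \<epsilon>" "E i (j - 1) = \<epsilon>" "E (i - 1) j \<le> \<epsilon> / 4" using ij small[of j] by (auto simp: E_def)
      have "p * E (i - 1) j \<le> p * (\<epsilon> / 4)" using e(3) p by (intro mult_left_mono) auto
      moreover have "1 / 3 * \<epsilon> \<le> p * \<epsilon>" using p \<epsilon> by (intro mult_right_mono) auto
      ultimately show ?thesis using e by (simp add: algebra_simps)
    next
      case 3
      then have e: "E i j = \<epsilon>" "E (i - 1) j = \<epsilon>" "E i (j - 1) \<le> \<epsilon> / 4" using ij small[of i] by (auto simp: E_def)
      have "(1 - p) * E i (j - 1) \<le> (1 - p) * (\<epsilon> / 4)" using e(3) p by (intro mult_left_mono) auto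
      moreover have "p * \<epsilon> \<le> 2 / 3 * \<epsilon>" using p \<epsilon> by (intro mult_right_mono) auto
      ultimately show ?thesis using e by (simp add: algebra_simps)
    qed
  qed
  then show ?thesis using tilt_step[OF ij(1,3) p(2), of q] p(1) unfolding D by (simp add: algebra_simps)
qed

text \<open>There are at most \<open>2 * J + 1\<close> sources, and the hypothesis on
  \<open>M\<close> keeps each of them at least \<open>M\<close> steps away from the cells in
  question.\<close>

lemma spread_bound:
  assumes w: "\<And>i k. M \<le> i + k \<Longrightarrow> walk i k \<le> \<epsilon>" and \<epsilon>: "0 \<le> \<epsilon>" and M: "M + q div 2 + J < q" and k: "k < q"
  shows "spread q J (q - 1) k + spread q J k (q - 1) \<le> 2 * real (2 * J + 1) * \<epsilon>"
proof -
  have c: "card (disturbed q J) \<le> 2 * J + 1"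
    unfolding disturbed_def by (rule order_trans[OF card_Un_le]) simp
  have b: "(\<Sum>r\<in>disturbed q J. f r) \<le> real (2 * J + 1) * \<epsilon>" if "\<And>r. r \<in> disturbed q J \<Longrightarrow> f r \<le> \<epsilon>" for f
  proof -
    have "(\<Sum>r\<in>disturbed q J. f r) \<le> real (card (disturbed q J)) * \<epsilon>" using that by (intro sum_bounded_above)
    also have "\<dots> \<le> real (2 * J + 1) * \<epsilon>" using c \<epsilon> by (intro mult_right_mono) linarith+
    finally show ?thesis .
  qed
  have "spread q J (q - 1) k \<le> real (2 * J + 1) * \<epsilon>"
    unfolding spread_def by (rule b) (use w \<epsilon> M in auto)
  moreover have "spread q J k (q - 1) \<le> real (2 * J + 1) * \<epsilon>"
    unfolding spread_def by (rule b) (use w \<epsilon> M in \<open>auto simp: disturbed_def\<close>)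
  ultimately show ?thesis by (simp add: algebra_simps)
qed

lemma spread_source:
  assumes "j \<in> disturbed q J"
  shows "1 \<le> spread q J 0 j"
proof -
  have "finite (disturbed q J)" by (simp add: disturbed_def)
  then have "(\<Sum>r\<in>{j}. if r \<le> j then walk 0 (j - r) else 0) \<le> spread q J 0 j"
    unfolding spread_def using assms by (intro sum_mono2) (auto simp: walk_nonneg)
  then show ?thesis by (simp add: walk_def)
qed

text \<open>The reason for the shape of \<open>disturbed\<close>. Bottom rows may face bottom rows,
  and so may rows just above the middle when the neighbour is finer. Just below the middle, at
  \<open>Suc j = q div 2\<close>, a finer neighbour may present its topmost row, whose northern
  weight need not be 1. Rows count from 0 here, profile indices from 1.\<close>

lemma rows_meet_inner:
  assumes "rows_meet q j r" "j < q" "r < q" "even q" "Suc j \<notin> disturbed q J" "Suc (Suc j) < q"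
  shows "J div 2 \<le> r" "Suc r < q"
proof -
  obtain q' where q: "q = 2 * q'" using assms(4) by (auto elim: evenE)
  have j: "J \<le> j" "Suc j < q' \<or> q' + J \<le> j" using assms(5) by (auto simp: disturbed_def q)
  have "J div 2 \<le> r \<and> Suc r < q"
    using assms(1) unfolding rows_meet_def
  proof (elim disjE exE conjE)
    fix \<tau> assume \<tau>: "\<tau> < (2::nat)" and r: "r = (2 * j + \<tau>) mod q"
    from j(2) show ?thesis
    proof
      assume "Suc j < q'"
      then have "r = 2 * j + \<tau>" using r \<tau> q by simp
      then show ?thesis using j(1) \<tau> \<open>Suc j < q'\<close> q by linarith
    next
      assume a: "q' + J \<le> j"
      have "2 * j + \<tau> = q + (2 * j + \<tau> - q)" using a q by simp
      moreover have "2 * j + \<tau> - q < q" using assms(6) \<tau> by linarith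
      ultimately have "r = 2 * j + \<tau> - q" using r by (metis mod_add_self1 mod_less)
      then show ?thesis using a q \<tau> assms(6) by linarith
    qed
  qed (use j assms(6) q in linarith)+
  then show "J div 2 \<le> r" "Suc r < q" by auto
qed

lemma rows_meet_top:
  assumes "rows_meet q j r" "j < q" "even q" "q \<le> Suc (Suc j)" "2 * J + 4 \<le> q"
  shows "J div 2 \<le> r"
proof -
  obtain q' where q: "q = 2 * q'" using assms(3) by (auto elim: evenE)
  show ?thesis
    using assms(1) unfolding rows_meet_def
  proof (elim disjE exE conjE)
    fix \<tau> assume \<tau>: "\<tau> < (2::nat)" and r: "r = (2 * j + \<tau>) mod q"
    have "2 * j + \<tau> = q + (2 * j + \<tau> - q)" "2 * j + \<tau> - q < q" using assms \<tau> by linarith+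
    then have "r = 2 * j + \<tau> - q" using r by (metis mod_add_self1 mod_less)
    then show ?thesis using assms \<tau> by linarith
  qed (use assms q in linarith)+
qed

text \<open>Of the two tilts, the one emitted from the southern side is the larger on the eastern
  side; it decays like \<open>(4 / 5) ^ r\<close> upwards, so it is negligible from row
  \<open>J div 2\<close> on.\<close>

lemma deficit_outflow:
  assumes "J div 2 \<le> r" "r < q" "0 \<le> \<epsilon>"
  shows "deficit q J \<epsilon> q (Suc r) \<le> 2 * \<epsilon> + 5 / 4 * (4 / 5) ^ (J div 2)"
proof -
  have "tilt q q (Suc r) \<le> 5 / 8 * (4 / 5) ^ q"
  proof -
    have "(2::real) ^ Suc r \<le> 2 ^ q" using assms(2) by (intro power_increasing) auto
    then have "5 / 8 * (4 / 5) ^ q * (2 ^ Suc r / 2 ^ q) \<le> 5 / 8 * (4 / 5 :: real) ^ q * 1"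
      by (intro mult_left_mono) auto
    then show ?thesis by (simp add: tilt_def)
  qed
  also have "\<dots> \<le> 5 / 8 * (4 / 5) ^ (J div 2)" using assms by (intro mult_left_mono power_decreasing) auto
  finally have 1: "tilt q q (Suc r) \<le> 5 / 8 * (4 / 5) ^ (J div 2)" .
  have "tilt q (Suc r) q = 5 / 8 * (4 / 5) ^ Suc r" by (simp add: tilt_def)
  also have "\<dots> \<le> 5 / 8 * (4 / 5) ^ (J div 2)" using assms by (intro mult_left_mono power_decreasing) auto
  finally show ?thesis using 1 assms(3) by (cases "Suc r = q") (simp_all add: deficit_def)
qed

text \<open>In disturbed rows the deficit is at least 1 and nothing is claimed. In the topmost row
  the worst weights 2 / 3 against 4 / 3 ask for a deficit of 1 / 2. The row below has weight 1 but
  may face a topmost row of weight 4 / 3, which asks for 1 / 4. The tilt provides 5 / 8 and 5 / 16.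
  In all other rows both weights are 1, and \<open>1 - \<epsilon>\<close> covers the deficit of the
  outflow, at most \<open>\<epsilon> / 2\<close>, and the loss
  \<open>\<epsilon> / 32\<close>.\<close>

lemma deficit_coupling:
  assumes rm: "rows_meet q j r" "j < q" "r < q" and q: "even q" "2 * J + 4 \<le> q"
    and bc: "\<beta> \<in> {1, 2 / 3, 4 / 3}" "\<gamma> \<in> {1, 2 / 3, 4 / 3}" "Suc j \<noteq> q \<Longrightarrow> \<beta> = 1" "Suc r \<noteq> q \<Longrightarrow> \<gamma> = 1"
    and \<epsilon>: "0 < \<epsilon>" "\<epsilon> \<le> 1 / 20" "5 / 4 * (4 / 5) ^ (J div 2) \<le> \<epsilon> / 4"
  shows "(1 - \<epsilon>) * (1 - deficit q J (\<epsilon> / 8) 0 (Suc j)) / \<beta>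
    \<le> (1 - \<epsilon> / 32) * max (1 - deficit q J (\<epsilon> / 8) q (Suc r)) 0 / \<gamma>"
proof -
  let ?d = "deficit q J (\<epsilon> / 8) 0 (Suc j)" and ?D = "deficit q J (\<epsilon> / 8) q (Suc r)"
  have pos: "0 < \<beta>" "0 < \<gamma>" "2 / 3 \<le> \<beta>" "\<gamma> \<le> 4 / 3" using bc by auto
  have rhs0: "0 \<le> (1 - \<epsilon> / 32) * max (1 - ?D) 0 / \<gamma>" using \<epsilon> pos by simp
  have d0: "0 \<le> ?d" using deficit_nonneg \<epsilon> by simp
  have D: "1 - \<epsilon> / 2 \<le> max (1 - ?D) 0" if "J div 2 \<le> r"
    using deficit_outflow[OF that rm(3), of "\<epsilon> / 8"] \<epsilon> by simp
  have DD: "1 - \<epsilon> \<le> (1 - \<epsilon> / 32) * max (1 - ?D) 0" if "J div 2 \<le> r"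
  proof -
    have "(1 - \<epsilon> / 32) * (1 - \<epsilon> / 2) \<le> (1 - \<epsilon> / 32) * max (1 - ?D) 0"
      using D[OF that] \<epsilon> by (intro mult_left_mono) auto
    moreover have "1 - \<epsilon> \<le> (1 - \<epsilon> / 32) * (1 - \<epsilon> / 2)" using \<epsilon> by (simp add: algebra_simps)
    ultimately show ?thesis by linarith
  qed
  consider "Suc j \<in> disturbed q J" "Suc j \<noteq> q" | "Suc j = q" | "Suc (Suc j) = q" | "Suc j \<notin> disturbed q J" "Suc (Suc j) < q"
    using rm by linarith
  then show ?thesis
  proof cases
    case 1
    have "1 \<le> ?d" using spread_source[OF 1(1)] 1(2) rm spread_nonneg[of q J "Suc j" 0] tilt_nonneg
      by (simp add: deficit_def add.commute add_increasing)
    then have "(1 - \<epsilon>) * (1 - ?d) / \<beta> \<le> 0" using \<epsilon> pos by (intro divide_nonpos_pos mult_nonneg_nonpos) auto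
    then show ?thesis using rhs0 by linarith
  next
    case 2
    have "5 / 8 \<le> ?d" using 2 \<epsilon> tilt_nonneg[of q q 0] by (simp add: deficit_def tilt_def)
    then have "(1 - \<epsilon>) * (1 - ?d) \<le> (1 - \<epsilon>) * (3 / 8)" using \<epsilon> by (intro mult_left_mono) auto
    then have "(1 - \<epsilon>) * (1 - ?d) / \<beta> \<le> (1 - \<epsilon>) * (3 / 8) / (2 / 3)" using pos \<epsilon> by (intro frac_le) auto
    also have "\<dots> \<le> (1 - \<epsilon>) / (4 / 3)" using \<epsilon> by simp
    also have "\<dots> \<le> (1 - \<epsilon> / 32) * max (1 - ?D) 0 / \<gamma>"
      using DD rows_meet_top[OF rm(1,2) q(1) _ q(2)] 2 pos \<epsilon> by (intro frac_le) auto
    finally show ?thesis .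
  next
    case 3
    then have b: "\<beta> = 1" using bc(3) by simp
    have "(2::real) ^ Suc j / 2 ^ q = 1 / 2" unfolding 3[symmetric] by simp
    then have "5 / 16 \<le> ?d"
      using 3 \<epsilon> tilt_nonneg[of q "Suc j" 0] spread_nonneg[of q J 0 "Suc j"] spread_nonneg[of q J "Suc j" 0] rm q
      by (simp add: deficit_def tilt_def)
    then have "(1 - \<epsilon>) * (1 - ?d) \<le> (1 - \<epsilon>) * (11 / 16)" using \<epsilon> by (intro mult_left_mono) auto
    then have "(1 - \<epsilon>) * (1 - ?d) / \<beta> \<le> (1 - \<epsilon>) * (11 / 16)" by (simp only: b div_by_1)
    also have "\<dots> \<le> (1 - \<epsilon>) / (4 / 3)" using \<epsilon> by simp
    also have "\<dots> \<le> (1 - \<epsilon> / 32) * max (1 - ?D) 0 / \<gamma>"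
      using DD rows_meet_top[OF rm(1,2) q(1) _ q(2)] 3 pos \<epsilon> by (intro frac_le) auto
    finally show ?thesis .
  next
    case 4
    note i = rows_meet_inner[OF rm q(1) 4]
    have "\<beta> = 1" "\<gamma> = 1" using bc 4 i by auto
    moreover have "(1 - \<epsilon>) * (1 - ?d) \<le> (1 - \<epsilon>) * 1" using d0 \<epsilon> by (intro mult_left_mono) auto
    ultimately show ?thesis using DD[OF i(1)] by simp
  qed
qed

text \<open>The condition \<open>1 < i, j\<close> in \<open>I0\<close> enters here: for
  \<open>k = 2\<close> the tilt amounts to 5 / 16 * 16 / 25 = 1 / 5, whereas for
  \<open>k = 1\<close> it would use up the whole 1 / 4.\<close>

lemma deficit_I0:
  assumes "2 \<le> k" "k < q" "J div 2 < q" and \<epsilon>: "0 < \<epsilon>" "\<epsilon> \<le> 1 / 20" "5 / 4 * (4 / 5) ^ (J div 2) \<le> \<epsilon> / 4"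
    and small: "spread q J (q - 1) k + spread q J k (q - 1) \<le> \<epsilon> / 32"
  shows "deficit q J (\<epsilon> / 8) (q - 1) k \<le> 1 / 4"
proof -
  obtain p where p: "q = Suc p" using assms by (cases q) auto
  have "tilt q p k \<le> 5 / 8 * (4 / 5) ^ p"
  proof -
    have "(2::real) ^ k \<le> 2 ^ q" using assms(2) by (intro power_increasing) auto
    then have "5 / 8 * (4 / 5) ^ p * (2 ^ k / 2 ^ q) \<le> 5 / 8 * (4 / 5 :: real) ^ p * 1"
      by (intro mult_left_mono) auto
    then show ?thesis by (simp add: tilt_def)
  qed
  also have "\<dots> \<le> 5 / 8 * (4 / 5) ^ (J div 2)" using assms p by (intro mult_left_mono power_decreasing) auto
  finally have 1: "tilt q p k \<le> \<epsilon> / 8" using \<epsilon>(3) by linarith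
  have "tilt q k p = 5 / 16 * (4 / 5) ^ k" by (simp add: tilt_def p)
  also have "\<dots> \<le> 5 / 16 * (4 / 5) ^ 2" using assms by (intro mult_left_mono power_decreasing) auto
  finally have "tilt q k p \<le> 1 / 5" by (simp add: power2_eq_square)
  then show ?thesis using 1 small assms \<epsilon> p by (simp add: deficit_def)
qed

section \<open>The estimate\<close>

lemma center_in_square:
  assumes "0 < h" "tiling N R" "K \<in> R" "a = real N * h"
  shows "center h K \<in> square_domain a"
proof -
  have p: "0 < edge_len h K" using assms(1) by (simp add: edge_len_def)
  have "(real (xpos K) + 1) * edge_len h K \<le> real (N * 2 ^ level K) * edge_len h K"
    "(real (ypos K) + 1) * edge_len h K \<le> real (N * 2 ^ level K) * edge_len h K"
    using tiling_range[OF assms(2,3)] p by (intro mult_right_mono; linarith)+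
  moreover have "real (N * 2 ^ level K) * edge_len h K = a" by (simp add: assms(4) edge_len_def)
  moreover have "0 \<le> real (xpos K) * edge_len h K" "0 \<le> real (ypos K) * edge_len h K" using p by simp_all
  ultimately show ?thesis
    using p by (simp add: center_def square_domain_def left_x_def right_x_def bottom_y_def top_y_def algebra_simps)
qed

lemma east_center_dist:
  assumes h: "0 < h" and e: "east K D"
  shows "\<bar>fst (center h K) - fst (center h D)\<bar> \<le> (edge_len h K + edge_len h D) / 2"
    and "\<bar>snd (center h K) - snd (center h D)\<bar> \<le> (edge_len h K + edge_len h D) / 2"
proof -
  have d: "right_x h E = left_x h E + edge_len h E" "top_y h E = bottom_y h E + edge_len h E" "0 < edge_len h E" for E
    using h by (simp_all add: right_x_def left_x_def top_y_def bottom_y_def edge_len_def field_simps)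
  have "right_x h K = left_x h D" "bottom_y h K < top_y h D" "bottom_y h D < top_y h K"
    using e east_iff[OF h] by auto
  then show "\<bar>fst (center h K) - fst (center h D)\<bar> \<le> (edge_len h K + edge_len h D) / 2"
    "\<bar>snd (center h K) - snd (center h D)\<bar> \<le> (edge_len h K + edge_len h D) / 2"
    using d[of K] d[of D] by (auto simp: center_def abs_le_iff field_simps)
qed

lemma adjacent_center_dist:
  assumes h: "0 < h" and e: "east K D \<or> east D K \<or> north K D \<or> north D K"
  shows "\<bar>fst (center h K) - fst (center h D)\<bar> \<le> (edge_len h K + edge_len h D) / 2"
    and "\<bar>snd (center h K) - snd (center h D)\<bar> \<le> (edge_len h K + edge_len h D) / 2"
proof -
  have s: "fst (center h (swp C)) = snd (center h C)" "snd (center h (swp C)) = fst (center h C)"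
    "edge_len h (swp C) = edge_len h C" for C
    by (simp_all add: center_def left_x_def right_x_def bottom_y_def top_y_def edge_len_def)
  show "\<bar>fst (center h K) - fst (center h D)\<bar> \<le> (edge_len h K + edge_len h D) / 2"
    "\<bar>snd (center h K) - snd (center h D)\<bar> \<le> (edge_len h K + edge_len h D) / 2"
    using e east_center_dist[OF h, of K D] east_center_dist[OF h, of D K]
      east_center_dist[OF h, of "swp K" "swp D"] east_center_dist[OF h, of "swp D" "swp K"]
    by (auto simp: north_def s abs_minus_commute add.commute)
qed

text \<open>The assumptions on \<open>\<psi>\<close> in \<open>flow\<close> and
  \<open>subsolution\<close>, bundled so that the two profiles can be checked outside these
  locales.\<close>

definition profile :: "nat \<Rightarrow> real \<Rightarrow> real \<Rightarrow> (nat \<Rightarrow> nat \<Rightarrow> real) \<Rightarrow> bool" where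
  "profile q \<eta> \<theta> \<psi> \<longleftrightarrow> (\<forall>i j. \<psi> i j \<le> 1) \<and> (\<forall>i j. \<psi> i j = \<psi> j i)
    \<and> (\<forall>j r \<beta> \<gamma>. j < q \<longrightarrow> r < q \<longrightarrow> rows_meet q j r \<longrightarrow> \<beta> \<in> {1, 2 / 3, 4 / 3} \<longrightarrow> \<gamma> \<in> {1, 2 / 3, 4 / 3} \<longrightarrow>
        (Suc j \<noteq> q \<longrightarrow> \<beta> = 1) \<longrightarrow> (Suc r \<noteq> q \<longrightarrow> \<gamma> = 1) \<longrightarrow>
        \<theta> * \<psi> 0 (Suc j) / \<beta> \<le> (1 - \<eta>) * max (\<psi> q (Suc r)) 0 / \<gamma>)
    \<and> (\<forall>i j. 1 \<le> i \<longrightarrow> i < q \<longrightarrow> 1 \<le> j \<longrightarrow> j < q \<longrightarrow> 2 * \<psi> i j \<le> \<psi> (i - 1) j + \<psi> i (j - 1))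
    \<and> (\<forall>i j p. 1 \<le> i \<longrightarrow> i \<le> q \<longrightarrow> 1 \<le> j \<longrightarrow> j \<le> q \<longrightarrow> i = q \<or> j = q \<longrightarrow> 1 / 3 \<le> p \<longrightarrow> p \<le> 2 / 3 \<longrightarrow> 0 < \<psi> i j \<longrightarrow>
        \<psi> i j * (1 + \<eta>) \<le> p * \<psi> (i - 1) j + (1 - p) * \<psi> i (j - 1))"

text \<open>The number of preceding blocks is a potential that increases strictly with each step to
  the east or north, so every step loses a factor \<open>\<theta>\<close>. The total loss is at most
  \<open>\<theta> ^ card Q\<close>, independently of the refinement depth.\<close>

definition block_factor :: "cell set \<Rightarrow> real \<Rightarrow> cell \<Rightarrow> real" where
  "block_factor Q \<theta> B = 9 / 10 * \<theta> ^ card {C \<in> Q. zless C B}"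

lemma block_factor_bounds:
  assumes "finite Q" "0 < \<theta>" "\<theta> \<le> 1"
  shows "0 < block_factor Q \<theta> B" "block_factor Q \<theta> B \<le> 9 / 10" "9 / 10 * \<theta> ^ card Q \<le> block_factor Q \<theta> B"
proof -
  show "0 < block_factor Q \<theta> B" "block_factor Q \<theta> B \<le> 9 / 10"
    using assms by (simp_all add: block_factor_def power_le_one)
  have "card {C \<in> Q. zless C B} \<le> card Q" using assms(1) by (intro card_mono) auto
  then show "9 / 10 * \<theta> ^ card Q \<le> block_factor Q \<theta> B"
    using assms by (simp add: block_factor_def power_decreasing)
qed

lemma block_factor_step:
  assumes "finite Q" "0 < \<theta>" "\<theta> \<le> 1" "C \<in> Q" "zless C B"
  shows "block_factor Q \<theta> B \<le> \<theta> * block_factor Q \<theta> C"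
proof -
  have "{D \<in> Q. zless D C} \<subset> {D \<in> Q. zless D B}"
    using assms(4,5) zless_trans zless_irrefl by blast
  then have "Suc (card {D \<in> Q. zless D C}) \<le> card {D \<in> Q. zless D B}"
    using assms(1) by (intro Suc_leI psubset_card_mono) auto
  then have "\<theta> ^ card {D \<in> Q. zless D B} \<le> \<theta> ^ Suc (card {D \<in> Q. zless D C})"
    using assms by (intro power_decreasing) auto
  then show ?thesis by (simp add: block_factor_def)
qed

lemma subsolutionI:
  assumes h: "0 < h" and a: "a = real N * h" and Q: "is_quadtree N Q" and bal: "balanced h Q"
    and pos: "\<forall>x\<in>square_domain a. 0 < \<sigma> x" and C1: "C1_on (square_domain a) \<sigma> \<sigma>'"
    and S: "S = sup_grad (square_domain a) \<sigma> \<sigma>'"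
    and par: "0 < \<delta>" "0 \<le> \<eta>" "\<eta> < 1" "0 < \<theta>" "\<theta> \<le> 1"
    and prof: "profile (2 ^ n) \<eta> \<theta> \<psi>"
    and small: "exp (2 * (S * (h / 2 ^ n))) \<le> (1 + \<eta>) * ((1 - (S * (h / 2 ^ n))\<^sup>2) * (1 - 9 / 4 * (h / 2 ^ n / \<delta>)))"
      "1 - \<eta> \<le> exp (- (5 / 2 * (S * (h / 2 ^ n)))) * (1 - h / 2 ^ n / \<delta>)"
      "3 / 2 * (h / 2 ^ n) * exp (S * (h / 2 ^ n)) \<le> \<delta>"
      "9 / 4 * (h / 2 ^ n) < \<delta>"
      "S * (h / 2 ^ n) \<le> 1"
      "(2 * a + \<delta>) * S\<^sup>2 * (h / 2 ^ n) \<le> 1 / 10"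
  shows "subsolution N n h Q (uniform_refine n Q) \<sigma> S \<delta> \<eta> \<theta> (block_factor Q \<theta>) \<psi> a"
proof -
  let ?R = "uniform_refine n Q"
  have tQ: "tiling N Q" using Q tiling_quadtree by (auto simp: is_quadtree_def)
  have tR: "tiling N ?R" using tiling_refine[OF Q] .
  note fin = tiling_finite[OF tQ]
  have sq: "center h K \<in> square_domain a" if "K \<in> ?R" for K
    using center_in_square[OF h tR that a] .
  show ?thesis
  proof
    show "0 < coeff_at h \<sigma> K" if "K \<in> ?R" for K
      using pos sq[OF that] by (simp add: coeff_at_def)
    show "coeff_at h \<sigma> D \<le> coeff_at h \<sigma> K * exp (S * ((edge_len h K + edge_len h D) / 2))"
      if "K \<in> ?R" "D \<in> ?R" "east K D \<or> east D K \<or> north K D \<or> north D K" for K D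
      unfolding coeff_at_def S
      by (rule coefficient_ratio[OF C1 pos sq[OF that(2)] sq[OF that(1)]])
        (use adjacent_center_dist[OF h that(3)] in \<open>simp_all add: abs_minus_commute\<close>)
    show "0 \<le> S" unfolding S using sup_grad_nonneg[OF C1 pos] a h by simp
    show "block_factor Q \<theta> B \<le> \<theta> * block_factor Q \<theta> C" if "C \<in> Q" "B \<in> Q" "east C B \<or> north C B" for C B
      using that east_zless north_zless block_factor_step[OF fin par(4,5)] by blast
    show "0 < block_factor Q \<theta> B" "block_factor Q \<theta> B \<le> 9 / 10" for B
      using block_factor_bounds[OF fin par(4,5)] by blast+
    note p = prof[unfolded profile_def]
    show "\<psi> i j \<le> 1" "\<psi> i j = \<psi> j i" for i j using p by blast+
    show "\<theta> * \<psi> 0 (Suc j) / \<beta> \<le> (1 - \<eta>) * max (\<psi> (2 ^ n) (Suc r)) 0 / \<gamma>"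
      if "j < 2 ^ n" "r < 2 ^ n" "rows_meet (2 ^ n) j r" "\<beta> \<in> {1, 2 / 3, 4 / 3}" "\<gamma> \<in> {1, 2 / 3, 4 / 3}"
        "Suc j \<noteq> 2 ^ n \<Longrightarrow> \<beta> = 1" "Suc r \<noteq> 2 ^ n \<Longrightarrow> \<gamma> = 1" for j r \<beta> \<gamma>
      using conjunct1[OF conjunct2[OF conjunct2[OF p]]] that by blast
    show "2 * \<psi> i j \<le> \<psi> (i - 1) j + \<psi> i (j - 1)" if "1 \<le> i" "i < 2 ^ n" "1 \<le> j" "j < 2 ^ n" for i j
      using conjunct1[OF conjunct2[OF conjunct2[OF conjunct2[OF p]]]] that by blast
    show "\<psi> i j * (1 + \<eta>) \<le> p' * \<psi> (i - 1) j + (1 - p') * \<psi> i (j - 1)"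
      if "1 \<le> i" "i \<le> 2 ^ n" "1 \<le> j" "j \<le> 2 ^ n" "i = 2 ^ n \<or> j = 2 ^ n" "1 / 3 \<le> p'" "p' \<le> 2 / 3" "0 < \<psi> i j"
      for i j p'
      using conjunct2[OF conjunct2[OF conjunct2[OF conjunct2[OF p]]]] that by blast
  qed (fact h tQ bal tR refl par small a less_imp_le[OF par(4)])+
qed

text \<open>With \<open>\<delta>\<close> and \<open>\<eta>\<close> fixed, each condition holds
  strictly at mesh width 0.\<close>

lemma eventually_small:
  fixes h S a \<delta> \<eta> :: real
  assumes "0 < \<delta>" "0 < \<eta>"
  shows "\<forall>\<^sub>F n in sequentially.
      exp (2 * (S * (h / 2 ^ n))) \<le> (1 + \<eta>) * ((1 - (S * (h / 2 ^ n))\<^sup>2) * (1 - 9 / 4 * (h / 2 ^ n / \<delta>)))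
    \<and> 1 - \<eta> \<le> exp (- (5 / 2 * (S * (h / 2 ^ n)))) * (1 - h / 2 ^ n / \<delta>)
    \<and> 3 / 2 * (h / 2 ^ n) * exp (S * (h / 2 ^ n)) \<le> \<delta>
    \<and> 9 / 4 * (h / 2 ^ n) < \<delta>
    \<and> S * (h / 2 ^ n) \<le> 1
    \<and> (2 * a + \<delta>) * S\<^sup>2 * (h / 2 ^ n) \<le> 1 / 10"
proof -
  have "(\<lambda>n. h * (1 / 2) ^ n) \<longlonglongrightarrow> h * 0" by (intro tendsto_intros LIMSEQ_power_zero) simp
  then have x: "(\<lambda>n. h / 2 ^ n) \<longlonglongrightarrow> 0" by (simp add: power_divide)
  have "(\<lambda>n. (1 + \<eta>) * ((1 - (S * (h / 2 ^ n))\<^sup>2) * (1 - 9 / 4 * (h / 2 ^ n / \<delta>))) - exp (2 * (S * (h / 2 ^ n))))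
      \<longlonglongrightarrow> (1 + \<eta>) * ((1 - (S * 0)\<^sup>2) * (1 - 9 / 4 * (0 / \<delta>))) - exp (2 * (S * 0))"
    using assms by (intro tendsto_intros x) auto
  then have 1: "\<forall>\<^sub>F n in sequentially. 0 < (1 + \<eta>) * ((1 - (S * (h / 2 ^ n))\<^sup>2) * (1 - 9 / 4 * (h / 2 ^ n / \<delta>))) - exp (2 * (S * (h / 2 ^ n)))"
    by (rule order_tendstoD(1)) (use assms in simp)
  have "(\<lambda>n. exp (- (5 / 2 * (S * (h / 2 ^ n)))) * (1 - h / 2 ^ n / \<delta>)) \<longlonglongrightarrow> exp (- (5 / 2 * (S * 0))) * (1 - 0 / \<delta>)"
    using assms by (intro tendsto_intros x) auto
  then have 2: "\<forall>\<^sub>F n in sequentially. 1 - \<eta> < exp (- (5 / 2 * (S * (h / 2 ^ n)))) * (1 - h / 2 ^ n / \<delta>)"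
    by (rule order_tendstoD(1)) (use assms in simp)
  have "(\<lambda>n. 3 / 2 * (h / 2 ^ n) * exp (S * (h / 2 ^ n))) \<longlonglongrightarrow> 3 / 2 * 0 * exp (S * 0)"
    by (intro tendsto_intros x)
  then have 3: "\<forall>\<^sub>F n in sequentially. 3 / 2 * (h / 2 ^ n) * exp (S * (h / 2 ^ n)) < \<delta>"
    by (rule order_tendstoD(2)) (use assms in simp)
  have "(\<lambda>n. 9 / 4 * (h / 2 ^ n)) \<longlonglongrightarrow> 9 / 4 * 0" by (intro tendsto_intros x)
  then have 4: "\<forall>\<^sub>F n in sequentially. 9 / 4 * (h / 2 ^ n) < \<delta>"
    by (rule order_tendstoD(2)) (use assms in simp)
  have "(\<lambda>n. S * (h / 2 ^ n)) \<longlonglongrightarrow> S * 0" by (intro tendsto_intros x)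
  then have 5: "\<forall>\<^sub>F n in sequentially. S * (h / 2 ^ n) < 1"
    by (rule order_tendstoD(2)) (use assms in simp)
  have "(\<lambda>n. (2 * a + \<delta>) * S\<^sup>2 * (h / 2 ^ n)) \<longlonglongrightarrow> (2 * a + \<delta>) * S\<^sup>2 * 0" by (intro tendsto_intros x)
  then have 6: "\<forall>\<^sub>F n in sequentially. (2 * a + \<delta>) * S\<^sup>2 * (h / 2 ^ n) < 1 / 10"
    by (rule order_tendstoD(2)) (use assms in simp)
  show ?thesis
    using 1 2 3 4 5 6 by eventually_elim (auto intro: less_imp_le)
qed

text \<open>The drop by 1 / 8 in the last row and column, weighted with at least 1 / 3, gives the
  surplus 1 / 24. For the coupling, \<open>\<theta>\<close> may be any number up to the worst weight
  ratio 1 / 2 times the smallest outflow 3 / 4 times 23 / 24; 1 / 4 is such a number.\<close>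

lemma profile_crude:
  "profile q (1 / 24) (1 / 4) (\<lambda>i j. 1 - 1 / 8 * (of_bool (i = q) + of_bool (j = q)))"
proof -
  let ?\<psi> = "\<lambda>i j. 1 - 1 / 8 * (of_bool (i = q) + of_bool (j = q) :: real)"
  have "1 / 4 * ?\<psi> 0 (Suc j) / \<beta> \<le> (1 - 1 / 24) * max (?\<psi> q (Suc r)) 0 / \<gamma>"
    if "\<beta> \<in> {1, 2 / 3, 4 / 3}" "\<gamma> \<in> {1, 2 / 3, 4 / 3}" for j r and \<beta> \<gamma> :: real
  proof -
    have "1 / 4 * ?\<psi> 0 (Suc j) / \<beta> \<le> 1 / 4 / (2 / 3)" using that by (intro frac_le) auto
    also have "\<dots> \<le> (1 - 1 / 24) * (3 / 4) / (4 / 3)" by simp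
    also have "\<dots> \<le> (1 - 1 / 24) * max (?\<psi> q (Suc r)) 0 / \<gamma>" using that by (intro frac_le mult_left_mono) auto
    finally show ?thesis .
  qed
  note coupling = this
  show ?thesis
    unfolding profile_def
  proof (intro conjI allI impI)
    fix i j and p :: real
    assume "1 \<le> i" "i \<le> q" "1 \<le> j" "j \<le> q" "i = q \<or> j = q" "1 / 3 \<le> p" "p \<le> 2 / 3"
    then show "?\<psi> i j * (1 + 1 / 24) \<le> p * ?\<psi> (i - 1) j + (1 - p) * ?\<psi> i (j - 1)"
      by (auto simp: algebra_simps diff_divide_distrib)
  qed (use coupling in auto)
qed

text \<open>The surplus \<open>\<epsilon> / 32\<close> is the slack of \<open>deficit_layer\<close>
  for the constant \<open>\<epsilon> / 8\<close>, as the profile is at most 1.\<close>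

lemma profile_sharp:
  assumes q: "even q" "2 * J + 4 \<le> q" and \<epsilon>: "0 < \<epsilon>" "\<epsilon> \<le> 1 / 20" "5 / 4 * (4 / 5) ^ (J div 2) \<le> \<epsilon> / 4"
    and small: "\<And>k. 1 \<le> k \<Longrightarrow> k < q \<Longrightarrow> spread q J (q - 1) k + spread q J k (q - 1) \<le> \<epsilon> / 32"
  shows "profile q (\<epsilon> / 32) (1 - \<epsilon>) (\<lambda>i j. 1 - deficit q J (\<epsilon> / 8) i j)"
  unfolding profile_def
proof (intro conjI allI impI)
  fix i j
  show "1 - deficit q J (\<epsilon> / 8) i j \<le> 1" using deficit_nonneg \<epsilon> by simp
  show "1 - deficit q J (\<epsilon> / 8) i j = 1 - deficit q J (\<epsilon> / 8) j i" by (simp add: deficit_sym)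
next
  fix j r and \<beta> \<gamma> :: real
  assume "j < q" "r < q" "rows_meet q j r" "\<beta> \<in> {1, 2 / 3, 4 / 3}" "\<gamma> \<in> {1, 2 / 3, 4 / 3}"
    "Suc j \<noteq> q \<longrightarrow> \<beta> = 1" "Suc r \<noteq> q \<longrightarrow> \<gamma> = 1"
  then show "(1 - \<epsilon>) * (1 - deficit q J (\<epsilon> / 8) 0 (Suc j)) / \<beta>
    \<le> (1 - \<epsilon> / 32) * max (1 - deficit q J (\<epsilon> / 8) q (Suc r)) 0 / \<gamma>"
    using deficit_coupling[OF _ _ _ q _ _ _ _ \<epsilon>] by blast
next
  fix i j assume "1 \<le> i" "i < q" "1 \<le> j" "j < q"
  then show "2 * (1 - deficit q J (\<epsilon> / 8) i j) \<le> 1 - deficit q J (\<epsilon> / 8) (i - 1) j + (1 - deficit q J (\<epsilon> / 8) i (j - 1))"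
    using deficit_bulk[of i q j J "\<epsilon> / 8"] by simp
next
  fix i j and p :: real
  assume ij: "1 \<le> i" "i \<le> q" "1 \<le> j" "j \<le> q" "i = q \<or> j = q" and p: "1 / 3 \<le> p" "p \<le> 2 / 3"
    and pos: "0 < 1 - deficit q J (\<epsilon> / 8) i j"
  have "p * deficit q J (\<epsilon> / 8) (i - 1) j + (1 - p) * deficit q J (\<epsilon> / 8) i (j - 1) + \<epsilon> / 8 / 4 \<le> deficit q J (\<epsilon> / 8) i j"
    by (rule deficit_layer[OF ij p]) (use \<epsilon> small in auto)
  moreover have "(1 - deficit q J (\<epsilon> / 8) i j) * (\<epsilon> / 32) \<le> 1 * (\<epsilon> / 32)"
    using deficit_nonneg[of "\<epsilon> / 8" q J i j] \<epsilon> by (intro mult_right_mono) auto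
  ultimately show "(1 - deficit q J (\<epsilon> / 8) i j) * (1 + \<epsilon> / 32)
    \<le> p * (1 - deficit q J (\<epsilon> / 8) (i - 1) j) + (1 - p) * (1 - deficit q J (\<epsilon> / 8) i (j - 1))"
    by (simp add: algebra_simps)
qed

text \<open>By the choice of \<open>\<delta>\<close>, \<open>s K + \<delta>\<close> is at most 9 / 8
  of the coordinate sum of the block corner, while \<open>g_bound\<close> contains twice this sum.
  The resulting 9 / 16 cancels the factor 16 / 9 of the first bound and is kept in the
  second.\<close>

lemma (in subsolution) tau_bound:
  assumes Q: "is_quadtree N Q" and C: "C \<in> Q" and ij: "(i, j) \<in> index_set n" and \<psi>: "0 < \<psi> i j"
    and \<delta>: "8 * \<delta> \<le> right_x h C + top_y h C"
  shows "tau N a h \<sigma> Q n C (i, j) \<le> g_bound h S C n (i, j) * (1 / (m C * \<psi> i j))"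
    and "i < 2 ^ n \<Longrightarrow> j < 2 ^ n \<Longrightarrow> tau N a h \<sigma> Q n C (i, j) \<le> g_bound h S C n (i, j) * (9 / 16 / (m C * \<psi> i j))"
proof -
  define K where "K = subcell n C (i, j)"
  obtain i' j' where i': "i = Suc i'" "i' < q" and j': "j = Suc j'" "j' < q"
    using ij by (cases i; cases j) (auto simp: index_set_def)
  have Kc: "K = Cell (level C + n) (q * xpos C + i') (q * ypos C + j')"
    by (simp add: K_def subcell_def i' j')
  have b: "blk n K = C" unfolding Kc by (cases C) (simp add: blk_Cell i' j')
  have K: "K \<in> R" using C b by (simp add: R_def uniform_refine_iff blk_def Kc)
  have ix: "ix K = i" "iy K = j" using i' j' by (simp_all add: ix_def iy_def Kc)
  have l: "len K = h / 2 ^ (level C + n)" "0 < len K" by (simp add: Kc edge_len_def) (rule len_pos)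
  define sC where "sC = right_x h C + top_y h C"
  have len: "edge_len h C = 2 ^ n * len K" by (simp add: Kc edge_len_def power_add)
  have s: "s K = sC - (2 ^ (n + 1) - real i - real j) * h / 2 ^ (level C + n)"
  proof -
    have "s K = (2 ^ n * real (xpos C) + 2 ^ n * real (ypos C) + real i + real j) * len K"
      unfolding s_def right_x_def top_y_def by (simp add: Kc i' j' algebra_simps)
    moreover have "sC = (2 ^ n * real (xpos C) + 2 ^ n * real (ypos C) + 2 * 2 ^ n) * len K"
      unfolding sC_def right_x_def top_y_def len by (simp add: algebra_simps)
    moreover have "(2 ^ (n + 1) - real i - real j) * h / 2 ^ (level C + n) = (2 ^ (n + 1) - real i - real j) * len K"
      by (simp only: l(1) times_divide_eq_right)
    ultimately show ?thesis by (simp add: algebra_simps)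
  qed
  have g: "g_bound h S C n (i, j) = 2 * sC * exp (S * s K) / len K"
    unfolding g_bound_def fst_conv snd_conv sC_def[symmetric] s[symmetric] l
    using h by (simp add: power_add field_simps)
  have "real i \<le> 2 ^ n" "real j \<le> 2 ^ n" using ij by (auto simp: index_set_def)
  then have "0 \<le> (2::real) ^ (n + 1) - real i - real j" unfolding power_add power_one_right by linarith
  then have "0 \<le> (2 ^ (n + 1) - real i - real j) * h / 2 ^ (level C + n)"
    using h by (intro divide_nonneg_nonneg mult_nonneg_nonneg) auto
  then have "s K \<le> sC" unfolding s by (simp only: diff_le_eq le_add_same_cancel1)
  then have sd: "s K + \<delta> \<le> 9 / 16 * (2 * sC)" using \<delta>[folded sC_def] by linarith
  have le: "(s K + \<delta>) * exp (S * s K) / len K \<le> 9 / 16 * g_bound h S C n (i, j)"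
  proof -
    have "0 \<le> exp (S * s K) / len K" using l(2) by simp
    then show ?thesis
      unfolding g using mult_right_mono[OF sd, of "exp (S * s K) / len K"] by (simp add: mult.assoc)
  qed
  have qt: "quadtree N R (quad_order N R)" unfolding R_def using quad_order_refine[OF Q] .
  have tau: "tau N a h \<sigma> Q n C (i, j) = lecn h R (quad_order N R) (fv_matrix a h \<sigma> R) K"
    by (simp add: tau_def Let_def K_def R_def)
  have m: "0 < m C * \<psi> i j" using m_pos[OF C] \<psi> by simp
  have "tau N a h \<sigma> Q n C (i, j) \<le> (s K + \<delta>) * exp (S * s K) / len K * (16 / 9 / (m C * \<psi> i j))"
    unfolding tau using lecn_bound(1)[OF qt K] \<psi> by (simp add: ix b)
  also have "\<dots> \<le> 9 / 16 * g_bound h S C n (i, j) * (16 / 9 / (m C * \<psi> i j))"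
    using le m by (intro mult_right_mono) auto
  finally show "tau N a h \<sigma> Q n C (i, j) \<le> g_bound h S C n (i, j) * (1 / (m C * \<psi> i j))" by simp
  assume "i < 2 ^ n" "j < 2 ^ n"
  then have "tau N a h \<sigma> Q n C (i, j) \<le> (s K + \<delta>) * exp (S * s K) / len K * (1 / (m C * \<psi> i j))"
    unfolding tau using lecn_bound(2)[OF qt K] \<psi> by (simp add: ix b)
  also have "\<dots> \<le> 9 / 16 * g_bound h S C n (i, j) * (1 / (m C * \<psi> i j))"
    using le m by (intro mult_right_mono) auto
  finally show "tau N a h \<sigma> Q n C (i, j) \<le> g_bound h S C n (i, j) * (9 / 16 / (m C * \<psi> i j))" by simp
qed

text \<open>The Landau condition does not see finitely many \<open>n\<close>. For the exceptional
  ones the finite sum of all absolute values is a correction uniform in the block and the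
  index.\<close>

lemma finite_correction:
  fixes f g :: "nat \<Rightarrow> 'a \<Rightarrow> 'b \<Rightarrow> real"
  assumes "finite Q" "\<And>n. finite (I n)"
    and g: "\<And>n C x. C \<in> Q \<Longrightarrow> x \<in> I n \<Longrightarrow> 0 \<le> g n C x"
    and ev: "\<forall>\<^sub>F n in sequentially. \<forall>C\<in>Q. \<forall>x\<in>I n. f n C x \<le> g n C x"
  shows "\<exists>r :: nat \<Rightarrow> real. r \<in> o(\<lambda>n. 2 ^ n) \<and> (\<forall>n. \<forall>C\<in>Q. \<forall>x\<in>I n. f n C x \<le> g n C x + r n)"
proof -
  define r where "r n = (if \<forall>C\<in>Q. \<forall>x\<in>I n. f n C x \<le> g n C x then 0 else (\<Sum>C\<in>Q. \<Sum>x\<in>I n. \<bar>f n C x\<bar>))" for n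
  have "\<forall>\<^sub>F n in sequentially. r n = 0"
    using ev by eventually_elim (simp add: r_def)
  then have "r \<in> o(\<lambda>n. 2 ^ n)"
    by (intro landau_o.smallI) (auto elim!: eventually_mono)
  moreover have "f n C x \<le> g n C x + r n" if "C \<in> Q" "x \<in> I n" for n C x
  proof (cases "\<forall>C\<in>Q. \<forall>x\<in>I n. f n C x \<le> g n C x")
    case True
    then show ?thesis using that by (simp add: r_def)
  next
    case False
    have "f n C x \<le> (\<Sum>x\<in>I n. \<bar>f n C x\<bar>)"
      using member_le_sum[OF that(2), of "\<lambda>x. \<bar>f n C x\<bar>"] assms(2) by fastforce
    also have "\<dots> \<le> (\<Sum>C\<in>Q. \<Sum>x\<in>I n. \<bar>f n C x\<bar>)"
      using member_le_sum[OF that(1), of "\<lambda>C. \<Sum>x\<in>I n. \<bar>f n C x\<bar>"] assms(1) by (simp add: sum_nonneg)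
    also have "\<dots> = r n" using False unfolding r_def by (simp only: if_False)
    finally show ?thesis using g[OF that] by linarith
  qed
  ultimately show ?thesis by blast
qed

lemma g_bound_nonneg: "0 < h \<Longrightarrow> 0 \<le> g_bound h S C n ij"
  by (simp add: g_bound_def right_x_def top_y_def edge_len_def)

theorem theorem4p4:
  fixes a h P\<^sub>\<sigma> :: real and N :: nat and \<sigma> :: "real \<times> real \<Rightarrow> real"
    and \<sigma>' :: "real \<times> real \<Rightarrow> real \<times> real" and O\<^sub>0 :: "cell set"
  assumes "0 < h" and "1 \<le> N" and "a = real N * h"
    and "is_quadtree N O\<^sub>0" and "balanced h O\<^sub>0"
    and "\<forall>x\<in>square_domain a. 0 < \<sigma> x"
    and "C1_on (square_domain a) \<sigma> \<sigma>'"
    and "\<forall>n. \<forall>C\<in>uniform_refine n O\<^sub>0. \<forall>C'\<in>nbrs h (uniform_refine n O\<^sub>0) C.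
           \<bar>coeff_at h \<sigma> C' / coeff_at h \<sigma> C - 1\<bar> \<le> P\<^sub>\<sigma> / 2 ^ (n + 1)"
  shows "(\<exists>r :: nat \<Rightarrow> real. r \<in> o(\<lambda>n. 2 ^ n) \<and>
            (\<forall>n. \<forall>C\<in>O\<^sub>0. \<forall>ij\<in>I0 n.
               tau N a h \<sigma> O\<^sub>0 n C ij \<le> g_bound h (sup_grad (square_domain a) \<sigma> \<sigma>') C n ij + r n)) \<and>
         (\<exists>c :: real. \<exists>r :: nat \<Rightarrow> real. r \<in> o(\<lambda>n. 2 ^ n) \<and>
            (\<forall>n. \<forall>C\<in>O\<^sub>0. \<forall>ij\<in>index_set n.
               tau N a h \<sigma> O\<^sub>0 n C ij \<le> c * g_bound h (sup_grad (square_domain a) \<sigma> \<sigma>') C n ij + r n))"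
proof -
  note h = assms(1) and Q = assms(4)
  define S where "S = sup_grad (square_domain a) \<sigma> \<sigma>'"
  have tQ: "tiling N O\<^sub>0" using Q tiling_quadtree by (auto simp: is_quadtree_def)
  note fin = tiling_finite[OF tQ]
  define V where "V = card O\<^sub>0"
  \<comment> \<open>A length independent of \<open>n\<close>: \<open>8 * \<delta>\<close> is twice
    the smallest edge length in \<open>O\<^sub>0\<close>, while each coordinate of an upper right
    corner is at least one edge length.\<close>
  define \<delta> where "\<delta> = h / 2 ^ (Max (level ` O\<^sub>0) + 2)"
  have \<delta>: "0 < \<delta>" using h by (simp add: \<delta>_def)
  have \<delta>C: "8 * \<delta> \<le> right_x h C + top_y h C" if "C \<in> O\<^sub>0" for C
  proof -
    have "level C \<le> Max (level ` O\<^sub>0)" using fin that by simp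
    then have "h / 2 ^ Max (level ` O\<^sub>0) \<le> edge_len h C"
      unfolding edge_len_def using h by (intro divide_left_mono power_increasing) auto
    moreover have "edge_len h C \<le> right_x h C" "edge_len h C \<le> top_y h C"
      using h by (simp_all add: right_x_def top_y_def edge_len_def field_simps)
    ultimately show ?thesis by (simp add: \<delta>_def power_add)
  qed
  have sub: "subsolution N n h O\<^sub>0 (uniform_refine n O\<^sub>0) \<sigma> S \<delta> \<eta> \<theta> (block_factor O\<^sub>0 \<theta>) \<psi> a"
    if "profile (2 ^ n) \<eta> \<theta> \<psi>" "0 < \<eta>" "\<eta> < 1" "0 < \<theta>" "\<theta> \<le> 1"
      "exp (2 * (S * (h / 2 ^ n))) \<le> (1 + \<eta>) * ((1 - (S * (h / 2 ^ n))\<^sup>2) * (1 - 9 / 4 * (h / 2 ^ n / \<delta>)))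
    \<and> 1 - \<eta> \<le> exp (- (5 / 2 * (S * (h / 2 ^ n)))) * (1 - h / 2 ^ n / \<delta>)
    \<and> 3 / 2 * (h / 2 ^ n) * exp (S * (h / 2 ^ n)) \<le> \<delta>
    \<and> 9 / 4 * (h / 2 ^ n) < \<delta>
    \<and> S * (h / 2 ^ n) \<le> 1
    \<and> (2 * a + \<delta>) * S\<^sup>2 * (h / 2 ^ n) \<le> 1 / 10" for n \<eta> \<theta> \<psi>
    using that \<delta> by (intro subsolutionI[OF h assms(3) Q assms(5-7)]) (auto simp: S_def)
  have sharp: "\<forall>\<^sub>F n in sequentially. \<forall>C\<in>O\<^sub>0. \<forall>ij\<in>I0 n. tau N a h \<sigma> O\<^sub>0 n C ij \<le> g_bound h S C n ij"
  proof -
    \<comment> \<open>By the Bernoulli inequality the losses of all \<open>V\<close> blocks together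
      cost at most 1 / 20.\<close>
    define \<epsilon> where "\<epsilon> = 1 / (20 * (real V + 1))"
    have \<epsilon>: "0 < \<epsilon>" "\<epsilon> \<le> 1 / 20" "real V * \<epsilon> \<le> 1 / 20"
      by (auto simp: \<epsilon>_def divide_simps)
    have "1 + real V * (- \<epsilon>) \<le> (1 + - \<epsilon>) ^ V" using \<epsilon> by (intro Bernoulli_inequality) auto
    then have V: "19 / 20 \<le> (1 - \<epsilon>) ^ V" using \<epsilon> by simp
    \<comment> \<open>\<open>\<epsilon> / 5\<close> because of the factor 5 / 4 of the two tilts in
      \<open>deficit_outflow\<close>; the outcome is the \<open>\<epsilon> / 4\<close> of
      \<open>deficit_coupling\<close>.\<close>
    obtain J' where J': "(4 / 5 :: real) ^ J' < \<epsilon> / 5"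
      using real_arch_pow_inv[of "\<epsilon> / 5" "4 / 5"] \<epsilon> by auto
    define J where "J = 2 * J'"
    have J: "5 / 4 * (4 / 5) ^ (J div 2) \<le> \<epsilon> / 4" using J' by (simp add: J_def)
    define X where "X = 2 * real (2 * J + 1)"
    have X: "0 < X" by (simp add: X_def)
    \<comment> \<open>\<open>X\<close> bounds the number of sources on both sides together. Their
      total \<open>\<epsilon> / 32\<close> is a quarter of the constant
      \<open>\<epsilon> / 8\<close>, as \<open>deficit_layer\<close> requires.\<close>
    define \<mu> where "\<mu> = \<epsilon> / 32 / X"
    have \<mu>: "0 < \<mu>" "X * \<mu> = \<epsilon> / 32" using \<epsilon> X by (simp_all add: \<mu>_def)
    obtain M where M: "\<And>i k. M \<le> i + k \<Longrightarrow> walk i k \<le> \<mu>" using walk_small[OF \<mu>(1)] by blast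
    have "\<forall>\<^sub>F n in sequentially. 2 * (M + 2 * J + 4) < (2::nat) ^ n"
      using eventually_ge_at_top[of "2 * (M + 2 * J + 4)"] by eventually_elim (meson le_less_trans less_exp)
    moreover have "\<forall>\<^sub>F n :: nat in sequentially. 1 \<le> n" by (rule eventually_ge_at_top)
    moreover have "0 < \<epsilon> / 32" using \<epsilon>(1) by simp
    note eventually_small[OF \<delta> this, of S h a]
    ultimately show ?thesis
    proof eventually_elim
      case (elim n)
      let ?q = "(2::nat) ^ n"
      have ev: "even ?q" using elim(2) by simp
      have "2 * J + 4 \<le> q" "M + q div 2 + J < q" if "2 * (M + 2 * J + 4) < q" for q :: nat
        using that by simp_all
      from this[OF elim(1)] have big: "2 * J + 4 \<le> ?q" "M + ?q div 2 + J < ?q" .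
      have sp: "spread ?q J (?q - 1) k + spread ?q J k (?q - 1) \<le> \<epsilon> / 32" if "k < ?q" for k
        using spread_bound[OF M less_imp_le[OF \<mu>(1)] big(2) that] unfolding X_def[symmetric] \<mu>(2) .
      have prof: "profile ?q (\<epsilon> / 32) (1 - \<epsilon>) (\<lambda>i j. 1 - deficit ?q J (\<epsilon> / 8) i j)"
        by (rule profile_sharp[OF ev big(1) \<epsilon>(1,2) J sp])
      interpret subsolution N n h O\<^sub>0 "uniform_refine n O\<^sub>0" \<sigma> S \<delta> "\<epsilon> / 32" "1 - \<epsilon>"
        "block_factor O\<^sub>0 (1 - \<epsilon>)" "\<lambda>i j. 1 - deficit ?q J (\<epsilon> / 8) i j" a
        by (rule sub[OF prof]) (use \<epsilon> elim(3) in auto)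
      show ?case
      proof (intro ballI)
        fix C ij assume C: "C \<in> O\<^sub>0" and ij0: "ij \<in> I0 n"
        obtain i j where ij: "ij = (i, j)" "2 \<le> i" "i < ?q" "2 \<le> j" "j < ?q" "i = ?q - 1 \<or> j = ?q - 1"
          using ij0 by (auto simp: I0_def)
        have "deficit ?q J (\<epsilon> / 8) (?q - 1) k \<le> 1 / 4" if "2 \<le> k" "k < ?q" for k
          by (rule deficit_I0[OF that _ \<epsilon>(1,2) J sp]) (use big that in auto)
        then have d: "3 / 4 \<le> 1 - deficit ?q J (\<epsilon> / 8) i j"
          using ij deficit_sym[of ?q J "\<epsilon> / 8" i j] by fastforce
        have "9 / 10 * (19 / 20) \<le> block_factor O\<^sub>0 (1 - \<epsilon>) C"
          using block_factor_bounds(3)[OF fin, of "1 - \<epsilon>" C] V \<epsilon> by (simp add: V_def)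
        \<comment> \<open>The product is 0.64125, which exceeds 9 / 16 = 0.5625.\<close>
        then have "9 / 10 * (19 / 20) * (3 / 4) \<le> block_factor O\<^sub>0 (1 - \<epsilon>) C * (1 - deficit ?q J (\<epsilon> / 8) i j)"
          using d by (intro mult_mono) auto
        then have le: "9 / 16 / (block_factor O\<^sub>0 (1 - \<epsilon>) C * (1 - deficit ?q J (\<epsilon> / 8) i j)) \<le> 1"
          by (simp add: divide_le_eq)
        have "tau N a h \<sigma> O\<^sub>0 n C (i, j)
          \<le> g_bound h S C n (i, j) * (9 / 16 / (block_factor O\<^sub>0 (1 - \<epsilon>) C * (1 - deficit ?q J (\<epsilon> / 8) i j)))"
          by (rule tau_bound(2)[OF Q C]) (use ij d \<delta>C[OF C] in \<open>auto simp: index_set_def\<close>)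
        also have "\<dots> \<le> g_bound h S C n (i, j) * 1"
          using le g_bound_nonneg[OF h] by (intro mult_left_mono)
        finally show "tau N a h \<sigma> O\<^sub>0 n C ij \<le> g_bound h S C n ij" by (simp add: ij)
      qed
    qed
  qed
  \<comment> \<open>The reciprocal of the smallest possible block factor times the smallest value 3
    / 4 of the crude profile, attained in the corner of a block.\<close>
  define c where "c = 1 / (9 / 10 * (1 / 4 :: real) ^ V * (3 / 4))"
  have e24: "(0::real) < 1 / 24" by simp
  have crude: "\<forall>\<^sub>F n in sequentially. \<forall>C\<in>O\<^sub>0. \<forall>ij\<in>index_set n. tau N a h \<sigma> O\<^sub>0 n C ij \<le> c * g_bound h S C n ij"
    using eventually_small[OF \<delta> e24, of S h a]
  proof eventually_elim
    case (elim n)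
    let ?q = "(2::nat) ^ n"
    let ?\<psi> = "\<lambda>i j. 1 - 1 / 8 * (of_bool (i = ?q) + of_bool (j = ?q)) :: real"
    interpret subsolution N n h O\<^sub>0 "uniform_refine n O\<^sub>0" \<sigma> S \<delta> "1 / 24" "1 / 4" "block_factor O\<^sub>0 (1 / 4)" ?\<psi> a
      by (rule sub[OF profile_crude]) (use elim in auto)
    show ?case
    proof (intro ballI)
      fix C ij assume C: "C \<in> O\<^sub>0" and ij0: "ij \<in> index_set n"
      obtain i j where ij: "ij = (i, j)" by (cases ij)
      have d: "3 / 4 \<le> ?\<psi> i j" by simp
      have "9 / 10 * (1 / 4) ^ V \<le> block_factor O\<^sub>0 (1 / 4) C"
        using block_factor_bounds(3)[OF fin, of "1 / 4" C] by (simp add: V_def)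
      then have "9 / 10 * (1 / 4) ^ V * (3 / 4) \<le> block_factor O\<^sub>0 (1 / 4) C * ?\<psi> i j"
        using d block_factor_bounds(1)[OF fin, of "1 / 4" C] by (intro mult_mono) auto
      then have le: "1 / (block_factor O\<^sub>0 (1 / 4) C * ?\<psi> i j) \<le> c"
        unfolding c_def by (rule divide_left_mono)
          (use block_factor_bounds(1)[OF fin, of "1 / 4" C] in \<open>auto intro!: mult_pos_pos\<close>)
      have "tau N a h \<sigma> O\<^sub>0 n C (i, j) \<le> g_bound h S C n (i, j) * (1 / (block_factor O\<^sub>0 (1 / 4) C * ?\<psi> i j))"
        by (rule tau_bound(1)[OF Q C]) (use ij ij0 d \<delta>C[OF C] in auto)
      also have "\<dots> \<le> g_bound h S C n (i, j) * c"
        using le g_bound_nonneg[OF h] by (intro mult_left_mono)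
      finally show "tau N a h \<sigma> O\<^sub>0 n C ij \<le> c * g_bound h S C n ij" by (simp add: ij mult.commute)
    qed
  qed
  have c: "0 \<le> c" by (simp add: c_def)
  have fI: "finite (index_set n)" "finite (I0 n)" for n
  proof -
    show "finite (index_set n)" by (simp add: index_set_def)
    then show "finite (I0 n)" by (rule rev_finite_subset) (auto simp: I0_def index_set_def)
  qed
  show ?thesis
    unfolding S_def[symmetric]
  proof (intro conjI exI[of _ c])
    show "\<exists>r :: nat \<Rightarrow> real. r \<in> o(\<lambda>n. 2 ^ n) \<and> (\<forall>n. \<forall>C\<in>O\<^sub>0. \<forall>ij\<in>I0 n. tau N a h \<sigma> O\<^sub>0 n C ij \<le> g_bound h S C n ij + r n)"
      by (rule finite_correction[OF fin fI(2) _ sharp]) (rule g_bound_nonneg[OF h])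
    show "\<exists>r :: nat \<Rightarrow> real. r \<in> o(\<lambda>n. 2 ^ n) \<and> (\<forall>n. \<forall>C\<in>O\<^sub>0. \<forall>ij\<in>index_set n. tau N a h \<sigma> O\<^sub>0 n C ij \<le> c * g_bound h S C n ij + r n)"
      by (rule finite_correction[OF fin fI(1) _ crude]) (use c g_bound_nonneg[OF h] in simp)
  qed
qed

end
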